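(* Let $\otimes\in\{\parallel,\vee,\wedge,\%\}$. For all specifications $\mathcal{P},\mathcal{P}',\mathcal{Q},\mathcal{Q}'$ such that $\mathcal{P}\simeq_r\mathcal{P}'$ (same alphabets), $\mathcal{Q}\simeq_r\mathcal{Q}'$ (same alphabets), and the pair $(\mathcal{P},\mathcal{Q})$ is $\otimes$-composable, we have $\mathcal{P}\otimes\mathcal{Q}\simeq_r\mathcal{P}'\otimes\mathcal{Q}'$. That is, $\simeq_r$ is a congruence with respect to $\parallel$, $\vee$, $\wedge$ and $\%$, subject to composability.
   Context: TIOTS. A timed I/O transition system (TIOTS) is $\mathcal{P}=\langle I,O,S,s^0,\to\rangle$ where $I,O$ are disjoint finite sets of input and output actions ($A=I\cup O$), $S=P\uplus\{\top,\bot\}$ with $P$ the set of plain states, $s^0\in S$ is the initial state, and $\to\subseteq S\times(I\uplus O\uplus\mathbb{R}^{>0})\times S$. Let $tA=I\uplus O\uplus\mathbb{R}^{>0}$ and $tO=O\uplus\mathbb{R}^{>0}$. Every TIOTS is assumed to satisfy: $\top$ and $\bot$ are chaotic (their outgoing transitions are exactly one self-loop for each $\alpha\in tA$); time additivity ($p\xrightarrow{d_1+d_2}s'$ iff $p\xrightarrow{d_1}s\xrightarrow{d_2}s'$ for some $s$); non-zenoness (no infinite execution visiting only plain states contains infinitely many actions with finite total delay). A TIOTS is deterministic if $s\xrightarrow{\alpha}s'$ and $s\xrightarrow{\alpha}s''$ imply $s'=s''$; it is $\bot$-free if $\bot$ is unreachable from $s^0$. The $\top$-TIOTS (resp. $\bot$-TIOTS)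 is the one with initial state $\top$ (resp. $\bot$). TIOTSs are identified up to isomorphism. Completion/removal. $\mathcal{P}^\bot$ adds $p\xrightarrow{a}\bot$ for each plain $p$ and each $a\in I$ not enabled at $p$; $\mathcal{P}^\top$ adds $p\xrightarrow{\alpha}\top$ for each plain $p$ and each $\alpha\in tO$ not enabled at $p$; $\top$-removal deletes all output and delay transitions from plain states to $\top$. $\mathcal{P}$ is $\bot$-complete if $\mathcal{P}=\mathcal{P}^\bot$. Special plain states (in a $\top/\bot$-completed TIOTS). A plain state $p$ is auto-$\bot$ if $p\xrightarrow{a}\bot$ for some $a\in O$; semi-$\bot$ if every input transition from $p$ or from any plain state reachable from $p$ by a delay leads to $\bot$, and $p\xrightarrow{d}\bot$ for some $d>0$; auto-$\top$ if $p\xrightarrow{a}\top$ for some $a\in I$; semi-$\top$ if every output transition from $p$ or from any plain state reachable from $p$ by a delay leads to $\top$, and $p\xrightarrow{d}\top$ for some $d>0$. Specification: a $\bot$-complete TIOTS from which $\top$ is unreachable and whose $\top$-completion has no semi-$\top$ state. Synchronised product. For a binary operation $\otimes$ on states and alphabets, and TIOTSs $\mathcal{P}_0,\mathcal{P}_1$ with disjoint plain-state sets, $\mathcal{P}_0\prod_\otimes\mathcal{P}_1$ has alphabet $(I_0,O_0)\otimes(I_1,O_1)$, states $(P_0\times P_1)\uplus P_0\uplus P_1\uplus\{\top,\bot\}$, initial state $s^0_0\otimes s^0_1$, and the smallest transition relation containing $\to_0\cup\to_1$ and satisfying: if $p_0\xrightarrow{\alpha}_0s_0'$ and $p_1\xrightarrow{\alpha}_1s_1'$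 then $p_0\otimes p_1\xrightarrow{\alpha}s_0'\otimes s_1'$; if $p_0\xrightarrow{a}_0s_0'$ and $a\notin A_1$ then $p_0\otimes p_1\xrightarrow{a}s_0'\otimes p_1$; if $p_1\xrightarrow{a}_1s_1'$ and $a\notin A_0$ then $p_0\otimes p_1\xrightarrow{a}p_0\otimes s_1'$. For plain $p_0,p_1$, $p_0\otimes p_1$ is the pair $(p_0,p_1)$; otherwise: - $\parallel$: $s\parallel\top=\top\parallel s=\top$; $s\parallel\bot=\bot\parallel s=\bot$ for $s\neq\top$. Composable iff $O_0\cap O_1=\emptyset$; alphabet $((I_0\cup I_1)\setminus(O_0\cup O_1),\,O_0\cup O_1)$. - $\wedge$: any state $\wedge\,\top$ or $\top\wedge$ any state is $\top$; $p\wedge\bot=\bot\wedge p=p$; $\bot\wedge\bot=\bot$. Composable iff alphabets identical; same alphabet. - $\vee$: any state $\vee\,\bot$ or $\bot\vee$ any state is $\bot$; $p\vee\top=\top\vee p=p$; $\top\vee\top=\top$. Composable iff alphabets identical; same alphabet. - $\%$ (first operand $s_0$): $s_0\%\top=\bot$ for all $s_0$; $\top\%p_1=\top$, $\bot\%p_1=\bot$; $\top\%\bot=p_0\%\bot=\top$, $\bot\%\bot=\bot$. Composable iff $A_1\subseteq A_0$ and $O_1\subseteq O_0$; alphabet $(I_0\cup O_1,\,O_0\setminus O_1)$. Determinisation. For a $\bot$-complete TIOTS, $\mathcal{P}^D$ is the subset construction whose states are the sets of states reachable from $s^0$ along a common timed trace, each set being reduced to $\bot$ if it contains $\bot$, and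 otherwise having $\top$ removed unless it equals $\{\top\}$ (identified with $\top$). Normalisation. For a specification, $\mathcal{P}^N$ is obtained from $\mathcal{P}^D$ by repeatedly collapsing every auto-$\bot$ or semi-$\bot$ plain state into $\bot$ until none remain. Realisation. For a $\top/\bot$-complete TIOTS, $\mathcal{P}^R$ is obtained from $\mathcal{P}^D$ by repeatedly collapsing every auto-$\top$ or semi-$\top$ plain state into $\top$ until none remain, then applying $\top$-removal unless the result is the $\top$-TIOTS. Operators on specifications: $\mathcal{P}\parallel\mathcal{Q}=\mathcal{P}\prod_\parallel\mathcal{Q}$; $\mathcal{P}\vee\mathcal{Q}$ is the $\top$-removal of $\mathcal{P}^\top\prod_\vee\mathcal{Q}^\top$; $\mathcal{P}\wedge\mathcal{Q}=((\mathcal{P}^N)^\top\prod_\wedge(\mathcal{Q}^N)^\top)^R$; $\mathcal{P}\%\mathcal{Q}=((\mathcal{P}^N)^\top\prod_\%(\mathcal{Q}^D)^\top)^R$. Refinement. An environment of $\mathcal{P}$ is a TIOTS with inputs $O_\mathcal{P}$ and outputs $I_\mathcal{P}$. For specifications $\mathcal{P},\mathcal{Q}$ with identical alphabets, $\mathcal{Q}\sqsubseteq_r\mathcal{P}$ iff for every environment specification $\mathcal{R}$, $\mathcal{Q}\parallel\mathcal{R}$ is $\bot$-free implies $\mathcal{P}\parallel\mathcal{R}$ is $\bot$-free; $\mathcal{P}\simeq_r\mathcal{Q}$ iff $\mathcal{P}\sqsubseteq_r\mathcal{Q}$ and $\mathcal{Q}\sqsubseteq_r\mathcal{P}$.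
   Formalization: For ∧ and % it is additionally assumed that the determinisations of P, P', Q and Q' are themselves TIOTSs (in particular non-zeno); without this the operators are not well defined on TIOTSs and the claim can fail for infinitely branching specifications. *)

theory Defs
  imports Complex_Main
begin

section \<open>Timed I/O transition systems\<close>

datatype 's st = Top | Bot | Plain 's

datatype 'a label = Act 'a | Delay real

record ('a, 's) tiots =
  inputs :: "'a set"
  outputs :: "'a set"
  plains :: "'s set"
  init :: "'s st"
  trans :: "('s st \<times> 'a label \<times> 's st) set"

definition actions :: "('a, 's) tiots \<Rightarrow> 'a set" where
  "actions P = inputs P \<union> outputs P"

definition states :: "('a, 's) tiots \<Rightarrow> 's st set" where
  "states P = {Top, Bot} \<union> Plain ` plains P"

definition delays :: "'a label set" where
  "delays = {Delay d | d. d > 0}"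

definition tA :: "('a, 's) tiots \<Rightarrow> 'a label set" where
  "tA P = Act ` actions P \<union> delays"

definition tO :: "('a, 's) tiots \<Rightarrow> 'a label set" where
  "tO P = Act ` outputs P \<union> delays"

definition enabled :: "('a, 's) tiots \<Rightarrow> 's st \<Rightarrow> 'a label \<Rightarrow> bool" where
  "enabled P s \<alpha> \<longleftrightarrow> (\<exists>s'. (s, \<alpha>, s') \<in> trans P)"

definition chaotic :: "('a, 's) tiots \<Rightarrow> 's st \<Rightarrow> bool" where
  "chaotic P s \<longleftrightarrow> (\<forall>\<alpha> s'. (s, \<alpha>, s') \<in> trans P \<longleftrightarrow> \<alpha> \<in> tA P \<and> s' = s)"

definition time_additive :: "('a, 's) tiots \<Rightarrow> bool" where
  "time_additive P \<longleftrightarrow>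
     (\<forall>s s' d1 d2. d1 > 0 \<longrightarrow> d2 > 0 \<longrightarrow>
        ((s, Delay (d1 + d2), s') \<in> trans P \<longleftrightarrow>
         (\<exists>m. (s, Delay d1, m) \<in> trans P \<and> (m, Delay d2, s') \<in> trans P)))"

primrec duration :: "'a label \<Rightarrow> real" where
  "duration (Act a) = 0"
| "duration (Delay d) = d"

text \<open>As durations are nonnegative, summability says that the total delay is finite.\<close>

definition nonzeno :: "('a, 's) tiots \<Rightarrow> bool" where
  "nonzeno P \<longleftrightarrow>
     \<not> (\<exists>(p :: nat \<Rightarrow> 's) \<alpha>.
          (\<forall>n. (Plain (p n), \<alpha> n, Plain (p (Suc n))) \<in> trans P) \<and>
          infinite {n. \<exists>a. \<alpha> n = Act a} \<and>
          summable (\<lambda>n. duration (\<alpha> n)))"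

definition tiots :: "('a, 's) tiots \<Rightarrow> bool" where
  "tiots P \<longleftrightarrow>
     finite (inputs P) \<and> finite (outputs P) \<and> inputs P \<inter> outputs P = {} \<and>
     init P \<in> states P \<and> trans P \<subseteq> states P \<times> tA P \<times> states P \<and>
     chaotic P Top \<and> chaotic P Bot \<and> time_additive P \<and> nonzeno P"

inductive path :: "('a, 's) tiots \<Rightarrow> 's st \<Rightarrow> 'a label list \<Rightarrow> 's st \<Rightarrow> bool" for P where
  path_Nil: "path P s [] s"
| path_Cons: "(s, \<alpha>, s') \<in> trans P \<Longrightarrow> path P s' w s'' \<Longrightarrow> path P s (\<alpha> # w) s''"

definition reachable :: "('a, 's) tiots \<Rightarrow> 's st \<Rightarrow> bool" where
  "reachable P s \<longleftrightarrow> (\<exists>w. path P (init P) w s)"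

definition bot_free :: "('a, 's) tiots \<Rightarrow> bool" where
  "bot_free P \<longleftrightarrow> \<not> reachable P Bot"


section \<open>Completion, removal and special states\<close>

definition bot_completion :: "('a, 's) tiots \<Rightarrow> ('a, 's) tiots" where
  "bot_completion P = P\<lparr>trans := trans P \<union>
     {(Plain p, Act a, Bot) | p a. p \<in> plains P \<and> a \<in> inputs P \<and> \<not> enabled P (Plain p) (Act a)}\<rparr>"

definition top_completion :: "('a, 's) tiots \<Rightarrow> ('a, 's) tiots" where
  "top_completion P = P\<lparr>trans := trans P \<union>
     {(Plain p, \<alpha>, Top) | p \<alpha>. p \<in> plains P \<and> \<alpha> \<in> tO P \<and> \<not> enabled P (Plain p) \<alpha>}\<rparr>"

definition top_removal :: "('a, 's) tiots \<Rightarrow> ('a, 's) tiots" where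
  "top_removal P = P\<lparr>trans := trans P - {(Plain p, \<alpha>, Top) | p \<alpha>. \<alpha> \<in> tO P}\<rparr>"

definition bot_complete :: "('a, 's) tiots \<Rightarrow> bool" where
  "bot_complete P \<longleftrightarrow> P = bot_completion P"

definition delay_closure :: "('a, 's) tiots \<Rightarrow> 's \<Rightarrow> 's set" where
  "delay_closure P p = {p} \<union> {q. \<exists>d. (Plain p, Delay d, Plain q) \<in> trans P}"

text \<open>
  Special states belong to completed systems, but \<open>top_completion\<close> changes neither \<open>auto_bot\<close>
  nor \<open>semi_bot\<close>: it adds no transition to \<open>Bot\<close>, no input and no delay to a plain state.
\<close>

definition auto_bot :: "('a, 's) tiots \<Rightarrow> 's \<Rightarrow> bool" where
  "auto_bot P p \<longleftrightarrow> (\<exists>a\<in>outputs P. (Plain p, Act a, Bot) \<in> trans P)"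

definition semi_bot :: "('a, 's) tiots \<Rightarrow> 's \<Rightarrow> bool" where
  "semi_bot P p \<longleftrightarrow>
     (\<forall>q\<in>delay_closure P p. \<forall>a\<in>inputs P. \<forall>s. (Plain q, Act a, s) \<in> trans P \<longrightarrow> s = Bot) \<and>
     (\<exists>d>0. (Plain p, Delay d, Bot) \<in> trans P)"

definition auto_top :: "('a, 's) tiots \<Rightarrow> 's \<Rightarrow> bool" where
  "auto_top P p \<longleftrightarrow> (\<exists>a\<in>inputs P. (Plain p, Act a, Top) \<in> trans P)"

definition semi_top :: "('a, 's) tiots \<Rightarrow> 's \<Rightarrow> bool" where
  "semi_top P p \<longleftrightarrow>
     (\<forall>q\<in>delay_closure P p. \<forall>a\<in>outputs P. \<forall>s. (Plain q, Act a, s) \<in> trans P \<longrightarrow> s = Top) \<and>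
     (\<exists>d>0. (Plain p, Delay d, Top) \<in> trans P)"

definition is_spec :: "('a, 's) tiots \<Rightarrow> bool" where
  "is_spec P \<longleftrightarrow>
     tiots P \<and> bot_complete P \<and> \<not> reachable P Top \<and>
     (\<forall>p\<in>plains P. \<not> semi_top (top_completion P) p)"


section \<open>Synchronised product\<close>

text \<open>The tags make the union of the pairs and of the two sets of plain states disjoint.\<close>

datatype ('p, 'q) pstate = Both 'p 'q | Fst 'p | Snd 'q

text \<open>In the four state operations below the earlier equations take precedence.\<close>

fun par_st :: "'p st \<Rightarrow> 'q st \<Rightarrow> ('p, 'q) pstate st" where
  "par_st Top _ = Top"
| "par_st _ Top = Top"
| "par_st Bot _ = Bot"
| "par_st _ Bot = Bot"
| "par_st (Plain p) (Plain q) = Plain (Both p q)"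

fun conj_st :: "'p st \<Rightarrow> 'q st \<Rightarrow> ('p, 'q) pstate st" where
  "conj_st Top _ = Top"
| "conj_st _ Top = Top"
| "conj_st Bot Bot = Bot"
| "conj_st (Plain p) Bot = Plain (Fst p)"
| "conj_st Bot (Plain q) = Plain (Snd q)"
| "conj_st (Plain p) (Plain q) = Plain (Both p q)"

fun disj_st :: "'p st \<Rightarrow> 'q st \<Rightarrow> ('p, 'q) pstate st" where
  "disj_st Bot _ = Bot"
| "disj_st _ Bot = Bot"
| "disj_st Top Top = Top"
| "disj_st (Plain p) Top = Plain (Fst p)"
| "disj_st Top (Plain q) = Plain (Snd q)"
| "disj_st (Plain p) (Plain q) = Plain (Both p q)"

fun quot_st :: "'p st \<Rightarrow> 'q st \<Rightarrow> ('p, 'q) pstate st" where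
  "quot_st _ Top = Bot"
| "quot_st Top _ = Top"
| "quot_st Bot _ = Bot"
| "quot_st (Plain p) Bot = Top"
| "quot_st (Plain p) (Plain q) = Plain (Both p q)"

inductive prod_step ::
  "('p st \<Rightarrow> 'q st \<Rightarrow> ('p, 'q) pstate st) \<Rightarrow> ('a, 'p) tiots \<Rightarrow> ('a, 'q) tiots \<Rightarrow>
   ('p, 'q) pstate st \<Rightarrow> 'a label \<Rightarrow> ('p, 'q) pstate st \<Rightarrow> bool"
  for f P Q where
  left: "(s, \<alpha>, s') \<in> trans P \<Longrightarrow> prod_step f P Q (map_st Fst s) \<alpha> (map_st Fst s')"
| right: "(s, \<alpha>, s') \<in> trans Q \<Longrightarrow> prod_step f P Q (map_st Snd s) \<alpha> (map_st Snd s')"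
| sync: "(Plain p, \<alpha>, s) \<in> trans P \<Longrightarrow> (Plain q, \<alpha>, t) \<in> trans Q \<Longrightarrow>
    prod_step f P Q (f (Plain p) (Plain q)) \<alpha> (f s t)"
| only_left: "(Plain p, Act a, s) \<in> trans P \<Longrightarrow> a \<notin> actions Q \<Longrightarrow> q \<in> plains Q \<Longrightarrow>
    prod_step f P Q (f (Plain p) (Plain q)) (Act a) (f s (Plain q))"
| only_right: "(Plain q, Act a, t) \<in> trans Q \<Longrightarrow> a \<notin> actions P \<Longrightarrow> p \<in> plains P \<Longrightarrow>
    prod_step f P Q (f (Plain p) (Plain q)) (Act a) (f (Plain p) t)"

definition product ::
  "('p st \<Rightarrow> 'q st \<Rightarrow> ('p, 'q) pstate st) \<Rightarrow> 'a set \<Rightarrow> 'a set \<Rightarrow>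
   ('a, 'p) tiots \<Rightarrow> ('a, 'q) tiots \<Rightarrow> ('a, ('p, 'q) pstate) tiots" where
  "product f In Out P Q = \<lparr>
     inputs = In,
     outputs = Out,
     plains = {Both p q | p q. p \<in> plains P \<and> q \<in> plains Q} \<union> Fst ` plains P \<union> Snd ` plains Q,
     init = f (init P) (init Q),
     trans = {(s, \<alpha>, s'). prod_step f P Q s \<alpha> s'}\<rparr>"

definition par_composable :: "('a, 'p) tiots \<Rightarrow> ('a, 'q) tiots \<Rightarrow> bool" where
  "par_composable P Q \<longleftrightarrow> outputs P \<inter> outputs Q = {}"

definition same_alphabet :: "('a, 'p) tiots \<Rightarrow> ('a, 'q) tiots \<Rightarrow> bool" where
  "same_alphabet P Q \<longleftrightarrow> inputs P = inputs Q \<and> outputs P = outputs Q"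

definition quot_composable :: "('a, 'p) tiots \<Rightarrow> ('a, 'q) tiots \<Rightarrow> bool" where
  "quot_composable P Q \<longleftrightarrow> actions Q \<subseteq> actions P \<and> outputs Q \<subseteq> outputs P"

definition prod_par :: "('a, 'p) tiots \<Rightarrow> ('a, 'q) tiots \<Rightarrow> ('a, ('p, 'q) pstate) tiots" where
  "prod_par P Q = product par_st
     ((inputs P \<union> inputs Q) - (outputs P \<union> outputs Q)) (outputs P \<union> outputs Q) P Q"

definition prod_conj :: "('a, 'p) tiots \<Rightarrow> ('a, 'q) tiots \<Rightarrow> ('a, ('p, 'q) pstate) tiots" where
  "prod_conj P Q = product conj_st (inputs P) (outputs P) P Q"

definition prod_disj :: "('a, 'p) tiots \<Rightarrow> ('a, 'q) tiots \<Rightarrow> ('a, ('p, 'q) pstate) tiots" where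
  "prod_disj P Q = product disj_st (inputs P) (outputs P) P Q"

definition prod_quot :: "('a, 'p) tiots \<Rightarrow> ('a, 'q) tiots \<Rightarrow> ('a, ('p, 'q) pstate) tiots" where
  "prod_quot P Q = product quot_st (inputs P \<union> outputs Q) (outputs P - outputs Q) P Q"


section \<open>Determinisation, normalisation and realisation\<close>

text \<open>
  A set of states containing neither \<open>Bot\<close> nor only \<open>Top\<close> is reduced to the set of its plain
  states, so the plain states of a determinisation are sets of plain states.
\<close>

definition reduce :: "'s st set \<Rightarrow> 's set st" where
  "reduce X = (if Bot \<in> X then Bot else if X = {Top} then Top else Plain {p. Plain p \<in> X})"

definition post :: "('a, 's) tiots \<Rightarrow> 's set \<Rightarrow> 'a label \<Rightarrow> 's st set" where
  "post P X \<alpha> = {s. \<exists>p\<in>X. (Plain p, \<alpha>, s) \<in> trans P}"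

definition after :: "('a, 's) tiots \<Rightarrow> 'a label list \<Rightarrow> 's st set" where
  "after P w = {s. path P (init P) w s}"

definition det :: "('a, 's) tiots \<Rightarrow> ('a, 's set) tiots" where
  "det P = \<lparr>
     inputs = inputs P,
     outputs = outputs P,
     plains = {X. \<exists>w. after P w \<noteq> {} \<and> reduce (after P w) = Plain X},
     init = reduce {init P},
     trans =
       {(Plain X, \<alpha>, reduce (post P X \<alpha>)) | X \<alpha>.
          (\<exists>w. after P w \<noteq> {} \<and> reduce (after P w) = Plain X) \<and> post P X \<alpha> \<noteq> {}} \<union>
       {(s, \<alpha>, s) | s \<alpha>. s \<in> {Top, Bot} \<and> \<alpha> \<in> tA P}\<rparr>"

text \<open>
  Determinisation may turn an infinitely branching system that is \<open>nonzeno\<close> into one that is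
  not.  Normalisation, realisation and the operators built on them presuppose that the
  determinisations of their operands are timed I/O transition systems, too.
\<close>

text \<open>
  Collapsing a set \<open>C\<close> of plain states of a deterministic system into \<open>t\<close>, one of \<open>Top\<close> and
  \<open>Bot\<close>.  Merging states alone does not preserve time additivity: if \<open>p\<close> delays by \<open>d'\<close> into
  a collapsed state, then, \<open>t\<close> being chaotic, time additivity demands that every delay of \<open>p\<close>
  longer than \<open>d'\<close> leads to \<open>t\<close>, and only to \<open>t\<close>.  Hence delays are redirected to \<open>t\<close> as
  soon as they pass \<open>t\<close> or a collapsed state.
\<close>

definition redirect :: "'s st \<Rightarrow> 's set \<Rightarrow> 's st \<Rightarrow> 's st" where
  "redirect t C s = (if s \<in> Plain ` C then t else s)"

definition passes :: "'s st \<Rightarrow> 's set \<Rightarrow> ('a, 's) tiots \<Rightarrow> 's \<Rightarrow> real \<Rightarrow> bool" where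
  "passes t C P p d \<longleftrightarrow>
     (\<exists>d' s. 0 < d' \<and> d' \<le> d \<and> (Plain p, Delay d', s) \<in> trans P \<and> redirect t C s = t)"

definition collapse :: "'s st \<Rightarrow> 's set \<Rightarrow> ('a, 's) tiots \<Rightarrow> ('a, 's) tiots" where
  "collapse t C P = P\<lparr>
     plains := plains P - C,
     init := redirect t C (init P),
     trans :=
       {(s, \<alpha>, s) | s \<alpha>. s \<in> {Top, Bot} \<and> \<alpha> \<in> tA P} \<union>
       {(Plain p, Act a, redirect t C s) | p a s.
          p \<in> plains P - C \<and> (Plain p, Act a, s) \<in> trans P} \<union>
       {(Plain p, Delay d, s) | p d s.
          p \<in> plains P - C \<and> (Plain p, Delay d, s) \<in> trans P \<and> \<not> passes t C P p d} \<union>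
       {(Plain p, Delay d, t) | p d. p \<in> plains P - C \<and> passes t C P p d}\<rparr>"

text \<open>
  The set of all plain states that disappear when special states are collapsed into \<open>t\<close> over and
  over again; as there may be infinitely many states, the number of rounds need not be finite.
\<close>

definition collapsible ::
  "(('a, 's) tiots \<Rightarrow> 's \<Rightarrow> bool) \<Rightarrow> 's st \<Rightarrow> ('a, 's) tiots \<Rightarrow> 's set" where
  "collapsible special t P =
     lfp (\<lambda>C. C \<union> {p \<in> plains (collapse t C P). special (collapse t C P) p})"

definition special_bot :: "('a, 's) tiots \<Rightarrow> 's \<Rightarrow> bool" where
  "special_bot P p \<longleftrightarrow> auto_bot P p \<or> semi_bot P p"

definition special_top :: "('a, 's) tiots \<Rightarrow> 's \<Rightarrow> bool" where
  "special_top P p \<longleftrightarrow> auto_top P p \<or> semi_top P p"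

definition normalise :: "('a, 's) tiots \<Rightarrow> ('a, 's set) tiots" where
  "normalise P = collapse Bot (collapsible special_bot Bot (det P)) (det P)"

definition realise :: "('a, 's) tiots \<Rightarrow> ('a, 's set) tiots" where
  "realise P =
     (let Q = collapse Top (collapsible special_top Top (det P)) (det P)
      in if init Q = Top then Q else top_removal Q)"

lemma collapsible_unfold:
  assumes "\<And>C C' p. C \<subseteq> C' \<Longrightarrow> p \<in> plains P - C' \<Longrightarrow>
             special (collapse t C P) p \<Longrightarrow> special (collapse t C' P) p"
  shows "\<not> (\<exists>p\<in>plains (collapse t (collapsible special t P) P).
              special (collapse t (collapsible special t P) P) p)"
proof -
  let ?F = "\<lambda>C. C \<union> {p \<in> plains (collapse t C P). special (collapse t C P) p}"
  have "mono ?F"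
  proof (rule monoI, rule subsetI)
    fix C C' p assume "C \<subseteq> C'" "p \<in> ?F C"
    then show "p \<in> ?F C'"
      using assms[of C C' p] by (auto simp: collapse_def)
  qed
  then have "?F (collapsible special t P) = collapsible special t P"
    unfolding collapsible_def by (rule lfp_unfold[symmetric])
  then show ?thesis by (auto simp: collapse_def)
qed

lemma redirect_mono: "C \<subseteq> C' \<Longrightarrow> redirect t C s = t \<Longrightarrow> redirect t C' s = t"
  by (auto simp: redirect_def split: if_splits)

lemma passes_mono: "C \<subseteq> C' \<Longrightarrow> passes t C P p d \<Longrightarrow> passes t C' P p d"
  unfolding passes_def using redirect_mono by blast

lemma collapse_sel [simp]:
  "inputs (collapse t C P) = inputs P" "outputs (collapse t C P) = outputs P"
  "plains (collapse t C P) = plains P - C"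
  by (auto simp: collapse_def)

lemma collapse_act:
  "(Plain p, Act a, s) \<in> trans (collapse t C P) \<longleftrightarrow>
     p \<in> plains P - C \<and> (\<exists>s'. (Plain p, Act a, s') \<in> trans P \<and> s = redirect t C s')"
  by (auto simp: collapse_def)

lemma collapse_delay:
  "(Plain p, Delay d, s) \<in> trans (collapse t C P) \<longleftrightarrow>
     p \<in> plains P - C \<and> (if passes t C P p d then s = t else (Plain p, Delay d, s) \<in> trans P)"
  by (auto simp: collapse_def)

lemma collapse_act_mono:
  assumes "C \<subseteq> C'" "t = Top \<or> t = Bot" "p \<in> plains P - C'"
    and "(Plain p, Act a, t) \<in> trans (collapse t C P)"
  shows "(Plain p, Act a, t) \<in> trans (collapse t C' P)"
  using assms redirect_mono[OF assms(1), of t] unfolding collapse_act by (metis)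

lemma semi_mono:
  assumes C: "C \<subseteq> C'" and t: "t = Top \<or> t = Bot" and p: "p \<in> plains P - C'"
    and *: "(\<forall>q\<in>delay_closure (collapse t C P) p. \<forall>a\<in>A. \<forall>s.
              (Plain q, Act a, s) \<in> trans (collapse t C P) \<longrightarrow> s = t) \<and>
            (\<exists>d>0. (Plain p, Delay d, t) \<in> trans (collapse t C P))"
  shows "(\<forall>q\<in>delay_closure (collapse t C' P) p. \<forall>a\<in>A. \<forall>s.
              (Plain q, Act a, s) \<in> trans (collapse t C' P) \<longrightarrow> s = t) \<and>
            (\<exists>d>0. (Plain p, Delay d, t) \<in> trans (collapse t C' P))"
proof (intro conjI ballI allI impI)
  fix q a s
  assume q: "q \<in> delay_closure (collapse t C' P) p" and a: "a \<in> A"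
    and s: "(Plain q, Act a, s) \<in> trans (collapse t C' P)"
  have "q \<in> delay_closure (collapse t C P) p"
    using q t p C passes_mono[OF C, of t P p]
    by (auto simp: delay_closure_def collapse_delay split: if_splits)
  moreover obtain s' where s': "(Plain q, Act a, s') \<in> trans P" "s = redirect t C' s'"
      "q \<in> plains P - C'"
    using s by (auto simp: collapse_act)
  moreover have "(Plain q, Act a, redirect t C s') \<in> trans (collapse t C P)"
    using s' C by (auto simp: collapse_act)
  ultimately have "redirect t C s' = t" using * a by blast
  then show "s = t" using redirect_mono[OF C] s' by blast
next
  obtain d where d: "d > 0" "(Plain p, Delay d, t) \<in> trans (collapse t C P)" using * by blast
  have "passes t C P p d"
  proof (rule ccontr)
    assume n: "\<not> passes t C P p d"
    then have "(Plain p, Delay d, t) \<in> trans P" using d by (auto simp: collapse_delay)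
    moreover have "redirect t C t = t" by (auto simp: redirect_def)
    ultimately show False using n d(1) unfolding passes_def by blast
  qed
  then have "passes t C' P p d" using passes_mono[OF C] by blast
  then show "\<exists>d>0. (Plain p, Delay d, t) \<in> trans (collapse t C' P)"
    using d(1) p by (auto simp: collapse_delay)
qed

lemma special_bot_mono:
  assumes "C \<subseteq> C'" "p \<in> plains P - C'" "special_bot (collapse Bot C P) p"
  shows "special_bot (collapse Bot C' P) p"
  using assms(3) collapse_act_mono[OF assms(1) _ assms(2), of Bot]
    semi_mono[OF assms(1) _ assms(2), of Bot "inputs P"]
  unfolding special_bot_def auto_bot_def semi_bot_def collapse_sel by blast

lemma special_top_mono:
  assumes "C \<subseteq> C'" "p \<in> plains P - C'" "special_top (collapse Top C P) p"
  shows "special_top (collapse Top C' P) p"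
  using assms(3) collapse_act_mono[OF assms(1) _ assms(2), of Top]
    semi_mono[OF assms(1) _ assms(2), of Top "outputs P"]
  unfolding special_top_def auto_top_def semi_top_def collapse_sel by blast

text \<open>No special states remain after the collapse.\<close>

lemma no_special_bot:
  "p \<in> plains (normalise P) \<Longrightarrow> \<not> auto_bot (normalise P) p \<and> \<not> semi_bot (normalise P) p"
  using collapsible_unfold[of "det P" special_bot Bot] special_bot_mono[of _ _ _ "det P"]
  unfolding normalise_def special_bot_def by blast

lemma no_special_top:
  assumes "p \<in> plains (collapse Top (collapsible special_top Top P) P)"
  shows "\<not> auto_top (collapse Top (collapsible special_top Top P) P) p \<and>
         \<not> semi_top (collapse Top (collapsible special_top Top P) P) p"
  using assms collapsible_unfold[of P special_top Top] special_top_mono[of _ _ _ P]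
  unfolding special_top_def by blast


section \<open>Operators and refinement\<close>

definition spec_par :: "('a, 'p) tiots \<Rightarrow> ('a, 'q) tiots \<Rightarrow> ('a, ('p, 'q) pstate) tiots" where
  "spec_par P Q = prod_par P Q"

definition spec_disj :: "('a, 'p) tiots \<Rightarrow> ('a, 'q) tiots \<Rightarrow> ('a, ('p, 'q) pstate) tiots" where
  "spec_disj P Q = top_removal (prod_disj (top_completion P) (top_completion Q))"

definition spec_conj ::
  "('a, 'p) tiots \<Rightarrow> ('a, 'q) tiots \<Rightarrow> ('a, ('p set, 'q set) pstate set) tiots" where
  "spec_conj P Q =
     realise (prod_conj (top_completion (normalise P)) (top_completion (normalise Q)))"

definition spec_quot ::
  "('a, 'p) tiots \<Rightarrow> ('a, 'q) tiots \<Rightarrow> ('a, ('p set, 'q set) pstate set) tiots" where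
  "spec_quot P Q =
     realise (prod_quot (top_completion (normalise P)) (top_completion (det Q)))"

definition environment :: "('a, 'r) tiots \<Rightarrow> ('a, 'p) tiots \<Rightarrow> bool" where
  "environment R P \<longleftrightarrow> tiots R \<and> inputs R = outputs P \<and> outputs R = inputs P"

text \<open>
  A definition in HOL cannot quantify over the state types of the environments, so their plain
  states are taken to be real numbers.  This is no restriction: by the lemma \<open>refines_environment\<close>
  below, refinement in this sense covers the environments over every type of states.
\<close>

definition refines :: "('a, 'q) tiots \<Rightarrow> ('a, 'p) tiots \<Rightarrow> bool" where
  "refines Q P \<longleftrightarrow> same_alphabet Q P \<and>
     (\<forall>R :: ('a, real) tiots. is_spec R \<longrightarrow> environment R Q \<longrightarrow>
        bot_free (spec_par Q R) \<longrightarrow> bot_free (spec_par P R))"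

definition ref_equiv :: "('a, 'p) tiots \<Rightarrow> ('a, 'q) tiots \<Rightarrow> bool" where
  "ref_equiv P Q \<longleftrightarrow> refines P Q \<and> refines Q P"

subsection \<open>Environments over other types of states\<close>

definition stset :: "'s set \<Rightarrow> 's st set" where
  "stset S = {Top, Bot} \<union> Plain ` S"

lemma stset_simps [simp]: "Top \<in> stset S" "Bot \<in> stset S" "Plain p \<in> stset S \<longleftrightarrow> p \<in> S"
  by (auto simp: stset_def)

definition subsystem :: "'n set \<Rightarrow> ('n \<Rightarrow> 'r) \<Rightarrow> ('a, 'r) tiots \<Rightarrow> ('a, 'n) tiots" where
  "subsystem N e R = \<lparr>
     inputs = inputs R,
     outputs = outputs R,
     plains = N,
     init = (case init R of Top \<Rightarrow> Top | Bot \<Rightarrow> Bot | Plain r \<Rightarrow> Plain (inv_into N e r)),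
     trans = {(x, \<alpha>, y). x \<in> stset N \<and> y \<in> stset N \<and>
                (map_st e x, \<alpha>, map_st e y) \<in> trans R}\<rparr>"

text \<open>The closure conditions under which a subsystem of a specification is a specification.\<close>

definition sub_closed :: "('a, 'r) tiots \<Rightarrow> 'r set \<Rightarrow> bool" where
  "sub_closed R S \<longleftrightarrow> S \<subseteq> plains R \<and> init R \<in> stset S \<and>
     (\<forall>p\<in>S. \<forall>\<alpha>. enabled R (Plain p) \<alpha> \<longrightarrow>
        (\<exists>s\<in>stset S. (Plain p, \<alpha>, s) \<in> trans R)) \<and>
     (\<forall>p\<in>S. \<forall>d1>0. \<forall>d2>0. \<forall>s\<in>stset S. (Plain p, Delay (d1 + d2), s) \<in> trans R \<longrightarrow>
        (\<exists>m\<in>stset S. (Plain p, Delay d1, m) \<in> trans R \<and> (m, Delay d2, s) \<in> trans R)) \<and>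
     (\<forall>p\<in>S. (\<exists>q\<in>delay_closure R p. \<exists>a\<in>outputs R. \<exists>s. (Plain q, Act a, s) \<in> trans R \<and> s \<noteq> Top) \<longrightarrow>
        (\<exists>q\<in>delay_closure R p \<inter> S. \<exists>a\<in>outputs R. \<exists>s\<in>stset S.
           (Plain q, Act a, s) \<in> trans R \<and> s \<noteq> Top))"

lemma bot_complete_iff:
  "bot_complete P \<longleftrightarrow> (\<forall>p\<in>plains P. \<forall>a\<in>inputs P. enabled P (Plain p) (Act a))"
proof
  assume *: "bot_complete P"
  show "\<forall>p\<in>plains P. \<forall>a\<in>inputs P. enabled P (Plain p) (Act a)"
  proof (intro ballI, rule ccontr)
    fix p a assume h: "p \<in> plains P" "a \<in> inputs P" "\<not> enabled P (Plain p) (Act a)"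
    then have "(Plain p, Act a, Bot) \<in> trans (bot_completion P)"
      by (auto simp: bot_completion_def)
    then show False using * h(3) unfolding bot_complete_def enabled_def by metis
  qed
next
  assume *: "\<forall>p\<in>plains P. \<forall>a\<in>inputs P. enabled P (Plain p) (Act a)"
  then have "{(Plain p, Act a, Bot) | p a. p \<in> plains P \<and> a \<in> inputs P \<and>
      \<not> enabled P (Plain p) (Act a)} = {}" by blast
  then have "bot_completion P = P\<lparr>trans := trans P\<rparr>"
    unfolding bot_completion_def by (metis sup_bot.right_neutral)
  then show "bot_complete P" by (simp add: bot_complete_def)
qed

lemma st_map_cases:
  assumes "e ` N = S" "s \<in> stset S"
  obtains x where "x \<in> stset N" "map_st e x = s"
  using assms by (cases s) (force simp: stset_def)+

definition map_right :: "('n \<Rightarrow> 'r) \<Rightarrow> ('q, 'n) pstate st \<Rightarrow> ('q, 'r) pstate st" where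
  "map_right e = map_st (map_pstate id e)"

lemma map_right_par: "map_right e (par_st s x) = par_st s (map_st e x)"
  by (cases s; cases x) (auto simp: map_right_def)

lemma map_right_Fst: "map_right e (map_st Fst s) = map_st Fst s"
  by (cases s) (auto simp: map_right_def)

lemma map_right_Snd: "map_right e (map_st Snd s) = map_st Snd (map_st e s)"
  by (cases s) (auto simp: map_right_def)

lemma par_trans: "(s, \<alpha>, t) \<in> trans (spec_par Q P) \<longleftrightarrow> prod_step par_st Q P s \<alpha> t"
  by (simp add: spec_par_def prod_par_def product_def)

context
  fixes R :: "('a, 'r) tiots" and S N and e :: "'n \<Rightarrow> 'r"
  assumes spec: "is_spec R" and cl: "sub_closed R S"
    and e: "inj_on e N" "e ` N = S"
begin


lemma sub_lift: assumes "s \<in> stset S" obtains x where "x \<in> stset N" "map_st e x = s"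
  using st_map_cases[OF e(2) assms] by blast

lemma sub_map_in: "x \<in> stset N \<Longrightarrow> map_st e x \<in> stset S" using e(2) by (cases x) auto

lemma sub_map_consts [simp]:
  "map_st e x = Top \<longleftrightarrow> x = Top" "map_st e x = Bot \<longleftrightarrow> x = Bot"
  by (cases x; simp)+

lemma sub_sel [simp]: "inputs (subsystem N e R) = inputs R" "outputs (subsystem N e R) = outputs R" "plains (subsystem N e R) = N"
  "actions (subsystem N e R) = actions R" "tA (subsystem N e R) = tA R" "tO (subsystem N e R) = tO R"
  by (auto simp: subsystem_def actions_def tA_def tO_def)

lemma sub_trans: "(x, \<alpha>, y) \<in> trans (subsystem N e R) \<longleftrightarrow>
   x \<in> stset N \<and> y \<in> stset N \<and> (map_st e x, \<alpha>, map_st e y) \<in> trans R"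
  by (simp add: subsystem_def)

lemma sub_base: "tiots R" using spec by (simp add: is_spec_def)

lemma sub_base_Top: "(Top, \<alpha>, s) \<in> trans R \<longleftrightarrow> \<alpha> \<in> tA R \<and> s = Top"
  and sub_base_Bot: "(Bot, \<alpha>, s) \<in> trans R \<longleftrightarrow> \<alpha> \<in> tA R \<and> s = Bot"
  using sub_base unfolding tiots_def chaotic_def by blast+

lemma sub_init: "init (subsystem N e R) \<in> stset N" "map_st e (init (subsystem N e R)) = init R"
proof -
  have "init R \<in> stset S" using cl by (simp add: sub_closed_def)
  then show "init (subsystem N e R) \<in> stset N" "map_st e (init (subsystem N e R)) = init R"
    using e(2) by (cases "init R"; auto simp: subsystem_def inv_into_into f_inv_into_f)+
qed

lemma sub_enabled: "p \<in> N \<Longrightarrow> enabled (subsystem N e R) (Plain p) \<alpha> \<longleftrightarrow> enabled R (Plain (e p)) \<alpha>"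
proof
  assume "p \<in> N" "enabled (subsystem N e R) (Plain p) \<alpha>"
  then show "enabled R (Plain (e p)) \<alpha>" by (auto simp: enabled_def sub_trans)
next
  assume p: "p \<in> N" and "enabled R (Plain (e p)) \<alpha>"
  then obtain s where s: "s \<in> stset S" "(Plain (e p), \<alpha>, s) \<in> trans R"
    using cl e(2) unfolding sub_closed_def by blast
  obtain x where "x \<in> stset N" "map_st e x = s" using sub_lift[OF s(1)] .
  then show "enabled (subsystem N e R) (Plain p) \<alpha>" using s p unfolding enabled_def sub_trans by auto
qed

lemma sub_path: "path (subsystem N e R) x w y \<Longrightarrow> path R (map_st e x) w (map_st e y)"
proof (induction rule: path.induct)
  case (path_Cons s \<alpha> s' w s'')
  then show ?case by (auto simp: sub_trans intro: path.path_Cons)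
qed (rule path.path_Nil)

lemma sub_tiots: "tiots (subsystem N e R)"
proof -
  have "chaotic (subsystem N e R) Top" "chaotic (subsystem N e R) Bot"
    by (auto simp: chaotic_def sub_trans sub_base_Top sub_base_Bot)
  moreover have "time_additive (subsystem N e R)"
    unfolding time_additive_def
  proof (intro allI impI)
    fix x y and d1 d2 :: real assume d: "d1 > 0" "d2 > 0"
    have ta: "(map_st e x, Delay (d1 + d2), map_st e y) \<in> trans R \<longleftrightarrow>
       (\<exists>m. (map_st e x, Delay d1, m) \<in> trans R \<and> (m, Delay d2, map_st e y) \<in> trans R)"
      using sub_base d unfolding tiots_def time_additive_def by blast
    show "(x, Delay (d1 + d2), y) \<in> trans (subsystem N e R) \<longleftrightarrow>
       (\<exists>m. (x, Delay d1, m) \<in> trans (subsystem N e R) \<and> (m, Delay d2, y) \<in> trans (subsystem N e R))" (is "?L \<longleftrightarrow> ?R")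
    proof
      assume ?L
      then have h: "x \<in> stset N" "y \<in> stset N" "(map_st e x, Delay (d1 + d2), map_st e y) \<in> trans R"
        by (auto simp: sub_trans)
      have "\<exists>m\<in>stset S. (map_st e x, Delay d1, m) \<in> trans R \<and> (m, Delay d2, map_st e y) \<in> trans R"
      proof (cases x)
        case (Plain p)
        then have "e p \<in> S" "(Plain (e p), Delay (d1 + d2), map_st e y) \<in> trans R"
          using h e(2) by auto
        then show ?thesis using cl sub_map_in[OF h(2)] d unfolding sub_closed_def Plain st.map by blast
      next
        case Top then show ?thesis using ta h(3) by (auto simp: sub_base_Top)
      next
        case Bot then show ?thesis using ta h(3) by (auto simp: sub_base_Bot)
      qed
      then obtain m where m: "m \<in> stset S" "(map_st e x, Delay d1, m) \<in> trans R"
          "(m, Delay d2, map_st e y) \<in> trans R" by blast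
      obtain z where "z \<in> stset N" "map_st e z = m" using sub_lift[OF m(1)] .
      then show ?R using m h unfolding sub_trans by blast
    next
      assume ?R then show ?L using ta unfolding sub_trans by blast
    qed
  qed
  moreover have "nonzeno (subsystem N e R)"
    unfolding nonzeno_def
  proof (rule notI, elim exE conjE)
    fix p :: "nat \<Rightarrow> 'n" and \<alpha>
    assume "\<forall>n. (Plain (p n), \<alpha> n, Plain (p (Suc n))) \<in> trans (subsystem N e R)"
      and *: "infinite {n. \<exists>a. \<alpha> n = Act a}" "summable (\<lambda>n. duration (\<alpha> n))"
    then have "\<forall>n. (Plain ((e \<circ> p) n), \<alpha> n, Plain ((e \<circ> p) (Suc n))) \<in> trans R"
      by (auto simp: sub_trans)
    then show False using sub_base * unfolding tiots_def nonzeno_def by blast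
  qed
  moreover have "trans (subsystem N e R) \<subseteq> states (subsystem N e R) \<times> tA (subsystem N e R) \<times> states (subsystem N e R)"
    using sub_base unfolding tiots_def states_def by (force simp: sub_trans stset_def)
  moreover have "init (subsystem N e R) \<in> states (subsystem N e R)" using sub_init by (simp add: states_def stset_def)
  ultimately show ?thesis using sub_base by (simp add: tiots_def)
qed

lemma sub_spec: "is_spec (subsystem N e R)"
proof -
  have "bot_complete (subsystem N e R)"
    using spec e(2) cl unfolding is_spec_def bot_complete_iff sub_closed_def
    by (auto simp: sub_enabled)
  moreover have "\<not> reachable (subsystem N e R) Top"
    using sub_path[of "init (subsystem N e R)" _ Top] spec sub_init(2) by (auto simp: reachable_def is_spec_def)
  moreover have "\<not> semi_top (top_completion (subsystem N e R)) x" if x: "x \<in> N" for x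
  proof
    assume st: "semi_top (top_completion (subsystem N e R)) x"
    have ex: "e x \<in> S" "e x \<in> plains R" using x e(2) cl by (auto simp: sub_closed_def)
    obtain d where d: "d > 0" "(Plain x, Delay d, Top) \<in> trans (top_completion (subsystem N e R))"
      using st by (auto simp: semi_top_def)
    have "(Plain (e x), Delay d, Top) \<in> trans (top_completion R)"
      using d(2) ex x
      by (auto simp: top_completion_def sub_enabled sub_trans)
    moreover have "\<not> semi_top (top_completion R) (e x)" using spec ex by (simp add: is_spec_def)
    ultimately obtain q a s where q: "q \<in> delay_closure (top_completion R) (e x)"
        "a \<in> outputs R" "(Plain q, Act a, s) \<in> trans (top_completion R)" "s \<noteq> Top"
      using d(1) unfolding semi_top_def by (auto simp: top_completion_def)
    have "q \<in> delay_closure R (e x)" "(Plain q, Act a, s) \<in> trans R"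
      using q by (auto simp: delay_closure_def top_completion_def)
    then have "\<exists>q\<in>delay_closure R (e x). \<exists>a\<in>outputs R. \<exists>s. (Plain q, Act a, s) \<in> trans R \<and> s \<noteq> Top"
      using q by blast
    then obtain q a s where q: "q \<in> delay_closure R (e x)" "q \<in> S" "a \<in> outputs R" "s \<in> stset S"
        "(Plain q, Act a, s) \<in> trans R" "s \<noteq> Top"
      using cl ex(1) unfolding sub_closed_def by blast
    obtain y where y: "y \<in> N" "e y = q" using q(2) e(2) by blast
    obtain z where z: "z \<in> stset N" "map_st e z = s" using sub_lift[OF q(4)] .
    have "y \<in> delay_closure (subsystem N e R) x"
      using q(1) y x e(1) by (auto simp: delay_closure_def sub_trans inj_on_def)
    then have "y \<in> delay_closure (top_completion (subsystem N e R)) x"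
      by (auto simp: delay_closure_def top_completion_def)
    moreover have "(Plain y, Act a, z) \<in> trans (top_completion (subsystem N e R))"
      using y z q by (auto simp: top_completion_def sub_trans)
    moreover have "z \<noteq> Top" using z q(6) by auto
    ultimately show False using st q(3) unfolding semi_top_def by (auto simp: top_completion_def)
  qed
  ultimately show ?thesis using sub_tiots by (simp add: is_spec_def)
qed

lemma par_init: "map_right e (init (spec_par Q (subsystem N e R))) = init (spec_par Q R)"
  by (simp add: spec_par_def prod_par_def product_def map_right_par sub_init)

lemma step_down:
  "prod_step par_st Q (subsystem N e R) s \<alpha> t \<Longrightarrow> prod_step par_st Q R (map_right e s) \<alpha> (map_right e t)"
proof (induction rule: prod_step.induct)
  case (left s \<alpha> s')
  then show ?case unfolding map_right_Fst by (rule prod_step.left)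
next
  case (right s \<alpha> s')
  then show ?case unfolding map_right_Snd by (auto simp: sub_trans intro: prod_step.right)
next
  case (sync p \<alpha> s q t)
  then show ?case unfolding map_right_par by (auto simp: sub_trans simp del: par_st.simps intro: prod_step.sync)
next
  case (only_left p a s q)
  then show ?case
    using prod_step.only_left[of p a s Q R "e q" par_st] e(2) cl
    unfolding map_right_par by (auto simp: sub_closed_def simp del: par_st.simps)
next
  case (only_right q a t p)
  then show ?case
    using prod_step.only_right[of "e q" a "map_st e t" R Q p par_st]
    unfolding map_right_par by (auto simp: sub_trans simp del: par_st.simps)
qed

lemma path_down:
  "path (spec_par Q (subsystem N e R)) s w t \<Longrightarrow> path (spec_par Q R) (map_right e s) w (map_right e t)"
proof (induction rule: path.induct)
  case (path_Cons s \<alpha> s' w s'')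
  then show ?case using step_down[of Q s \<alpha> s'] by (auto simp: par_trans intro: path.path_Cons)
qed (rule path.path_Nil)

lemma bot_free_down: "bot_free (spec_par Q R) \<Longrightarrow> bot_free (spec_par Q (subsystem N e R))"
  using path_down[of Q "init (spec_par Q (subsystem N e R))" _ Bot]
  unfolding bot_free_def reachable_def par_init by (auto simp: map_right_def)

end

definition right_plains :: "('q, 'r) pstate st \<Rightarrow> 'r set" where
  "right_plains s = (case s of Plain (Both p r) \<Rightarrow> {r} | Plain (Snd r) \<Rightarrow> {r} | _ \<Rightarrow> {})"

lemma right_plains_par: "y \<in> stset N \<Longrightarrow> right_plains (par_st s y) \<subseteq> N"
  by (cases s; cases y) (auto simp: right_plains_def)

lemma right_plains_Fst: "right_plains (map_st Fst s) = {}"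
  and right_plains_Snd: "right_plains (map_st Snd s) = set_st s"
  by (cases s; simp add: right_plains_def)+

lemma finite_set_st: "finite (set_st s)"
  by (cases s) auto

lemma in_stset: "s \<in> stset S \<longleftrightarrow> set_st s \<subseteq> S"
  by (cases s) auto

lemma map_right_eq_Fst:
  assumes "map_right e x = map_st Fst u"
  shows "x = map_st Fst u"
proof (cases x)
  case (Plain z)
  then show ?thesis using assms by (cases z; cases u) (auto simp: map_right_def)
qed (use assms in \<open>cases u; simp add: map_right_def\<close>)+

lemma map_right_eq_Snd:
  assumes "map_right e x = map_st Snd u"
  shows "\<exists>x0. x = map_st Snd x0 \<and> map_st e x0 = u"
proof (cases x)
  case Top
  then show ?thesis using assms by (cases u) (auto simp: map_right_def intro: exI[of _ Top])
next
  case Bot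
  then show ?thesis using assms by (cases u) (auto simp: map_right_def intro: exI[of _ Bot])
next
  case (Plain z)
  then obtain r where "z = Snd r" using assms by (cases z; cases u) (auto simp: map_right_def)
  then show ?thesis using Plain assms by (intro exI[of _ "Plain r"], cases u) (auto simp: map_right_def)
qed

lemma trans_typed:
  assumes "tiots R" "(s, \<alpha>, t) \<in> trans R"
  shows "set_st s \<subseteq> plains R \<and> \<alpha> \<in> tA R \<and> set_st t \<subseteq> plains R"
proof -
  have "s \<in> states R" "\<alpha> \<in> tA R" "t \<in> states R"
    using assms unfolding tiots_def by blast+
  then show ?thesis by (auto simp: states_def)
qed

lemma step_up:
  fixes R :: "('a, 'r) tiots"
  assumes R: "tiots R" and step: "prod_step par_st P R s \<alpha> t"
  shows "\<exists>F. finite F \<and> F \<subseteq> plains R \<and>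
    (\<forall>(N :: 'n set) (e :: 'n \<Rightarrow> 'r) x. F \<subseteq> e ` N \<longrightarrow> map_right e x = s \<longrightarrow> right_plains x \<subseteq> N \<longrightarrow>
       (\<exists>y. map_right e y = t \<and> right_plains y \<subseteq> N \<and> prod_step par_st P (subsystem N e R) x \<alpha> y))"
proof -
  have tr: "set_st t \<subseteq> plains R" if "(s, \<alpha>, t) \<in> trans R" for s \<alpha> t
    using trans_typed[OF R that] by blast
  have lift': "\<exists>z. z \<in> stset N \<and> map_st e z = t" if "set_st t \<subseteq> e ` N" for N :: "'n set" and e :: "'n \<Rightarrow> 'r" and t
    using that st_map_cases[of e N "e ` N" t] by (auto simp: in_stset)
  from step show ?thesis
  proof cases
    case (left u v)
    show ?thesis
    proof (intro exI[of _ "{}"] conjI allI impI)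
      fix N :: "'n set" and e :: "'n \<Rightarrow> 'r" and x assume "map_right e x = s"
      then have "x = map_st Fst u" using map_right_eq_Fst[of e x u] left(1) by simp
      then show "\<exists>y. map_right e y = t \<and> right_plains y \<subseteq> N \<and> prod_step par_st P (subsystem N e R) x \<alpha> y"
        using left prod_step.left[OF left(3), of par_st "subsystem N e R"]
        by (intro exI[of _ "map_st Fst v"]) (auto simp: map_right_Fst right_plains_Fst)
    qed auto
  next
    case (right u v)
    show ?thesis
    proof (intro exI[of _ "set_st v"] conjI allI impI)
      fix N :: "'n set" and e :: "'n \<Rightarrow> 'r" and x
      assume F: "set_st v \<subseteq> e ` N" and x: "map_right e x = s" "right_plains x \<subseteq> N"
      obtain x0 where x0: "x0 \<in> stset N" "x = map_st Snd x0" "map_st e x0 = u"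
        using map_right_eq_Snd[of e x u] x right(1) by (auto simp: right_plains_Snd in_stset)
      obtain y0 where y0: "y0 \<in> stset N" "map_st e y0 = v" using lift'[OF F] by blast
      have "(x0, \<alpha>, y0) \<in> trans (subsystem N e R)"
        using x0 y0 right(3) by (simp add: subsystem_def)
      then have "prod_step par_st P (subsystem N e R) (map_st Snd x0) \<alpha> (map_st Snd y0)"
        by (rule prod_step.right)
      then show "\<exists>y. map_right e y = t \<and> right_plains y \<subseteq> N \<and> prod_step par_st P (subsystem N e R) x \<alpha> y"
        using x0 y0 right
        by (intro exI[of _ "map_st Snd y0"]) (auto simp: map_right_Snd right_plains_Snd in_stset)
    qed (use tr[OF right(3)] finite_set_st in auto)
  next
    case (sync p u q v)
    show ?thesis
    proof (intro exI[of _ "set_st v"] conjI allI impI)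
      fix N :: "'n set" and e :: "'n \<Rightarrow> 'r" and x
      assume F: "set_st v \<subseteq> e ` N" and x: "map_right e x = s" "right_plains x \<subseteq> N"
      obtain q0 where q0: "q0 \<in> N" "e q0 = q" "x = Plain (Both p q0)"
      proof (cases x)
        case (Plain z)
        then show ?thesis using x sync that by (cases z) (auto simp: map_right_def right_plains_def)
      qed (use x sync in \<open>auto simp: map_right_def\<close>)
      obtain y0 where y0: "y0 \<in> stset N" "map_st e y0 = v" using lift'[OF F] by blast
      have "(Plain q0, \<alpha>, y0) \<in> trans (subsystem N e R)"
        using q0 y0 sync by (simp add: subsystem_def)
      from prod_step.sync[OF sync(3) this, of par_st] q0
      show "\<exists>y. map_right e y = t \<and> right_plains y \<subseteq> N \<and> prod_step par_st P (subsystem N e R) x \<alpha> y"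
        using y0 sync right_plains_par[OF y0(1), of u]
        by (intro exI[of _ "par_st u y0"]) (auto simp: map_right_par)
    qed (use tr[OF sync(4)] finite_set_st in auto)
  next
    case (only_left p a u q)
    show ?thesis
    proof (intro exI[of _ "{}"] conjI allI impI)
      fix N :: "'n set" and e :: "'n \<Rightarrow> 'r" and x
      assume x: "map_right e x = s" "right_plains x \<subseteq> N"
      obtain q0 where q0: "q0 \<in> N" "e q0 = q" "x = Plain (Both p q0)"
      proof (cases x)
        case (Plain z)
        then show ?thesis using x only_left that by (cases z) (auto simp: map_right_def right_plains_def)
      qed (use x only_left in \<open>auto simp: map_right_def\<close>)
      have "prod_step par_st P (subsystem N e R) (par_st (Plain p) (Plain q0)) (Act a) (par_st u (Plain q0))"
        using only_left q0 by (intro prod_step.only_left) (auto simp: subsystem_def actions_def)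
      then show "\<exists>y. map_right e y = t \<and> right_plains y \<subseteq> N \<and> prod_step par_st P (subsystem N e R) x \<alpha> y"
        using q0 only_left right_plains_par[of "Plain q0" N u]
        by (intro exI[of _ "par_st u (Plain q0)"]) (auto simp: map_right_par)
    qed auto
  next
    case (only_right q a v p)
    show ?thesis
    proof (intro exI[of _ "set_st v"] conjI allI impI)
      fix N :: "'n set" and e :: "'n \<Rightarrow> 'r" and x
      assume F: "set_st v \<subseteq> e ` N" and x: "map_right e x = s" "right_plains x \<subseteq> N"
      obtain q0 where q0: "q0 \<in> N" "e q0 = q" "x = Plain (Both p q0)"
      proof (cases x)
        case (Plain z)
        then show ?thesis using x only_right that by (cases z) (auto simp: map_right_def right_plains_def)
      qed (use x only_right in \<open>auto simp: map_right_def\<close>)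
      obtain y0 where y0: "y0 \<in> stset N" "map_st e y0 = v" using lift'[OF F] by blast
      have "(Plain q0, Act a, y0) \<in> trans (subsystem N e R)"
        using q0 y0 only_right by (simp add: subsystem_def)
      from prod_step.only_right[OF this only_right(5,6), of par_st] q0
      show "\<exists>y. map_right e y = t \<and> right_plains y \<subseteq> N \<and> prod_step par_st P (subsystem N e R) x \<alpha> y"
        using y0 only_right right_plains_par[OF y0(1), of "Plain p"]
        by (intro exI[of _ "par_st (Plain p) y0"]) (auto simp: map_right_par)
    qed (use tr[OF only_right(4)] finite_set_st in auto)
  qed
qed

lemma path_up:
  fixes R :: "('a, 'r) tiots"
  assumes R: "tiots R" and "path (spec_par P R) s w t"
  shows "\<exists>F. finite F \<and> F \<subseteq> plains R \<and>
    (\<forall>(N :: 'n set) (e :: 'n \<Rightarrow> 'r) x. F \<subseteq> e ` N \<longrightarrow> map_right e x = s \<longrightarrow> right_plains x \<subseteq> N \<longrightarrow>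
       (\<exists>y. map_right e y = t \<and> right_plains y \<subseteq> N \<and> path (spec_par P (subsystem N e R)) x w y))"
  using assms(2)
proof (induction rule: path.induct)
  case (path_Nil s)
  then show ?case by (intro exI[of _ "{}"]) (auto intro: path.path_Nil)
next
  case (path_Cons s \<alpha> s' w s'')
  obtain F where F: "finite F" "F \<subseteq> plains R"
    "\<And>(N :: 'n set) e x. F \<subseteq> e ` N \<Longrightarrow> map_right e x = s' \<Longrightarrow> right_plains x \<subseteq> N \<Longrightarrow>
       \<exists>y. map_right e y = s'' \<and> right_plains y \<subseteq> N \<and> path (spec_par P (subsystem N e R)) x w y"
    using path_Cons.IH by blast
  obtain F' where F': "finite F'" "F' \<subseteq> plains R"
    "\<And>(N :: 'n set) e x. F' \<subseteq> e ` N \<Longrightarrow> map_right e x = s \<Longrightarrow> right_plains x \<subseteq> N \<Longrightarrow>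
       \<exists>y. map_right e y = s' \<and> right_plains y \<subseteq> N \<and> prod_step par_st P (subsystem N e R) x \<alpha> y"
    using step_up[OF R, of P s \<alpha> s'] path_Cons.hyps(1) unfolding par_trans by metis
  show ?case
  proof (intro exI[of _ "F \<union> F'"] conjI allI impI)
    fix N :: "'n set" and e :: "'n \<Rightarrow> 'r" and x
    assume sub: "F \<union> F' \<subseteq> e ` N" and x: "map_right e x = s" "right_plains x \<subseteq> N"
    obtain y where y: "map_right e y = s'" "right_plains y \<subseteq> N"
        "prod_step par_st P (subsystem N e R) x \<alpha> y" using F'(3)[of e N x] sub x by blast
    obtain z where "map_right e z = s''" "right_plains z \<subseteq> N" "path (spec_par P (subsystem N e R)) y w z"
      using F(3)[of e N y] sub y by blast
    then show "\<exists>y. map_right e y = s'' \<and> right_plains y \<subseteq> N \<and>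
        path (spec_par P (subsystem N e R)) x (\<alpha> # w) y"
      using path.path_Cons[of x \<alpha> y "spec_par P (subsystem N e R)" w z] y(3)
      by (auto simp: par_trans)
  qed (use F F' in auto)
qed

context
  includes cardinal_syntax
begin

lemma small_finite:
  assumes "infinite (UNIV :: 'b set)" "finite A"
  shows "|A| \<le>o |UNIV :: 'b set|"
  using assms card_of_ordLeq_infinite ordLeq_total card_of_Well_order by metis

lemma card_of_Un_ordLeq_infinite:
  assumes "infinite (UNIV :: 'b set)" "|A1| \<le>o |UNIV :: 'b set|" "|A2| \<le>o |UNIV :: 'b set|"
  shows "|A1 \<union> A2| \<le>o |UNIV :: 'b set|"
proof -
  have "|\<Union>b\<in>{True, False}. if b then A1 else A2| \<le>o |UNIV :: 'b set|"
    using assms by (intro card_of_UNION_ordLeq_infinite[OF assms(1)] ballI)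
      (auto intro: small_finite)
  then show ?thesis by (simp add: Un_commute)
qed

lemma closure_small:
  fixes K :: "'r \<Rightarrow> 'r \<Rightarrow> 'r set" and F A :: "'r set"
  assumes F: "finite F" "F \<subseteq> A" and K: "\<And>p q. |K p q| \<le>o |UNIV :: real set|"
    and KA: "\<And>p q. p \<in> A \<Longrightarrow> q \<in> A \<Longrightarrow> K p q \<subseteq> A"
  shows "\<exists>S. F \<subseteq> S \<and> S \<subseteq> A \<and> |S| \<le>o |UNIV :: real set| \<and> (\<forall>p\<in>S. \<forall>q\<in>S. K p q \<subseteq> S)"
proof -
  have inf: "infinite (UNIV :: real set)" by (rule infinite_UNIV_char_0)
  define G where "G X = X \<union> (\<Union>p\<in>X. \<Union>q\<in>X. K p q)" for X
  define T where "T n = (G ^^ n) F" for n :: nat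
  have T0: "T 0 = F" and TS: "T (Suc n) = G (T n)" for n by (auto simp: T_def)
  have card: "|T n| \<le>o |UNIV :: real set|" for n
  proof (induction n)
    case 0
    then show ?case unfolding T0 using small_finite[OF inf F(1)] .
  next
    case (Suc n)
    have "|\<Union>p\<in>T n. \<Union>q\<in>T n. K p q| \<le>o |UNIV :: real set|"
      using Suc K by (intro card_of_UNION_ordLeq_infinite[OF inf] ballI) auto
    then show ?case unfolding TS G_def by (intro card_of_Un_ordLeq_infinite[OF inf] Suc)
  qed
  have sub: "T n \<subseteq> A" for n
  proof (induction n)
    case (Suc n) then show ?case using KA unfolding TS G_def by blast
  qed (simp add: T0 F)
  have mono: "T m \<subseteq> T n" if "m \<le> n" for m n
    using that by (induction n rule: dec_induct) (auto simp: TS G_def)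
  have nat: "|UNIV :: nat set| \<le>o |UNIV :: real set|"
    using inf infinite_iff_card_of_nat by blast
  show ?thesis
  proof (intro exI[of _ "\<Union>n. T n"] conjI ballI)
    show "F \<subseteq> (\<Union>n. T n)" using T0 by blast
    show "(\<Union>n. T n) \<subseteq> A" using sub by blast
    show "|\<Union>n. T n| \<le>o |UNIV :: real set|"
      using card nat by (intro card_of_UNION_ordLeq_infinite[OF inf]) auto
    fix p q assume "p \<in> (\<Union>n. T n)" "q \<in> (\<Union>n. T n)"
    then obtain m n where "p \<in> T m" "q \<in> T n" by blast
    then have "p \<in> T (max m n)" "q \<in> T (max m n)" using mono[of m "max m n"] mono[of n "max m n"] by auto
    then have "K p q \<subseteq> T (Suc (max m n))" unfolding TS G_def by blast
    then show "K p q \<subseteq> (\<Union>n. T n)" by blast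
  qed
qed

lemma small_subsystem:
  fixes R :: "('a, 'r) tiots"
  assumes R: "tiots R" and F: "finite F" "F \<subseteq> plains R" "set_st (init R) \<subseteq> F"
  shows "\<exists>S. F \<subseteq> S \<and> |S| \<le>o |UNIV :: real set| \<and> sub_closed R S"
proof -
  have inf: "infinite (UNIV :: real set)" by (rule infinite_UNIV_char_0)
  have tr: "set_st s \<subseteq> plains R" "\<alpha> \<in> tA R" "set_st t \<subseteq> plains R" if "(s, \<alpha>, t) \<in> trans R" for s \<alpha> t
    using trans_typed[OF R that] by auto
  define succ where "succ p \<alpha> = (SOME s. (Plain p, \<alpha>, s) \<in> trans R)" for p \<alpha>
  define mid where "mid p d1 d2 s = (SOME m. (Plain p, Delay d1, m) \<in> trans R \<and> (m, Delay d2, s) \<in> trans R)"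
    for p d1 d2 s
  define W where "W p w \<longleftrightarrow> fst w \<in> delay_closure R p \<and>
    (\<exists>a\<in>outputs R. (Plain (fst w), Act a, snd w) \<in> trans R) \<and> snd w \<noteq> Top" for p and w :: "'r \<times> 'r st"
  define K1 where "K1 p = (\<Union>\<alpha>\<in>{\<alpha>. enabled R (Plain p) \<alpha>}. set_st (succ p \<alpha>))" for p
  define K2 where "K2 p q = (\<Union>s\<in>{Top, Bot, Plain q}. \<Union>d1. \<Union>d2\<in>{d2. 0 < d1 \<and> 0 < d2 \<and>
      (Plain p, Delay (d1 + d2), s) \<in> trans R}. set_st (mid p d1 d2 s))" for p q
  define K3 where "K3 p = (if \<exists>w. W p w then insert (fst (SOME w. W p w)) (set_st (snd (SOME w. W p w))) else {})" for p
  define K where "K p q = K1 p \<union> K2 p q \<union> K3 p" for p q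
  have succ: "(Plain p, \<alpha>, succ p \<alpha>) \<in> trans R" if "enabled R (Plain p) \<alpha>" for p \<alpha>
    using that unfolding enabled_def succ_def by (rule someI_ex)
  have mid: "(Plain p, Delay d1, mid p d1 d2 s) \<in> trans R \<and> (mid p d1 d2 s, Delay d2, s) \<in> trans R"
    if "0 < d1" "0 < d2" "(Plain p, Delay (d1 + d2), s) \<in> trans R" for p d1 d2 s
    unfolding mid_def
  proof (rule someI_ex)
    show "\<exists>m. (Plain p, Delay d1, m) \<in> trans R \<and> (m, Delay d2, s) \<in> trans R"
      using R that unfolding tiots_def time_additive_def by blast
  qed
  have W: "W p (SOME w. W p w)" if "W p w" for p w using that by (rule someI)
  have "|{\<alpha>. enabled R (Plain p) \<alpha>}| \<le>o |UNIV :: real set|" for p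
  proof -
    have "{\<alpha>. enabled R (Plain p) \<alpha>} \<subseteq> Act ` actions R \<union> range Delay"
      using tr(2) by (fastforce simp: enabled_def tA_def delays_def)
    moreover have "|Act ` actions R \<union> (range Delay :: 'a label set)| \<le>o |UNIV :: real set|"
    proof (rule card_of_Un_ordLeq_infinite[OF inf])
      show "|Act ` actions R :: 'a label set| \<le>o |UNIV :: real set|"
        using R by (intro small_finite[OF inf]) (auto simp: tiots_def actions_def)
    qed (rule card_of_image)
    ultimately show ?thesis using card_of_mono1 ordLeq_transitive by blast
  qed
  then have "|K1 p| \<le>o |UNIV :: real set|" for p
    unfolding K1_def using small_finite[OF inf finite_set_st] by (intro card_of_UNION_ordLeq_infinite[OF inf] ballI)
  moreover have "|K2 p q| \<le>o |UNIV :: real set|" for p q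
    unfolding K2_def
    by (intro card_of_UNION_ordLeq_infinite[OF inf] ballI small_finite[OF inf finite_set_st]
          card_of_mono1 small_finite[OF inf]) auto
  moreover have "|K3 p| \<le>o |UNIV :: real set|" for p
    unfolding K3_def by (intro small_finite[OF inf]) (auto simp: finite_set_st)
  ultimately have Kc: "|K p q| \<le>o |UNIV :: real set|" for p q
    unfolding K_def by (intro card_of_Un_ordLeq_infinite[OF inf])
  have Ka: "K p q \<subseteq> plains R" if "p \<in> plains R" "q \<in> plains R" for p q
  proof -
    have "K1 p \<subseteq> plains R" using tr(3)[OF succ] by (auto simp: K1_def)
    moreover have "K2 p q \<subseteq> plains R" using mid tr(3) unfolding K2_def by blast
    moreover have "K3 p \<subseteq> plains R"
    proof (cases "\<exists>w. W p w")
      case True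
      define w where "w = (SOME w. W p w)"
      have "W p w" unfolding w_def using True W by blast
      then obtain a where "(Plain (fst w), Act a, snd w) \<in> trans R" unfolding W_def by blast
      then have "fst w \<in> plains R" "set_st (snd w) \<subseteq> plains R" using tr(1,3) by fastforce+
      then show ?thesis using True unfolding K3_def w_def by auto
    qed (simp add: K3_def)
    ultimately show ?thesis unfolding K_def by blast
  qed
  have "\<exists>S. F \<subseteq> S \<and> S \<subseteq> plains R \<and> |S| \<le>o |UNIV :: real set| \<and> (\<forall>p\<in>S. \<forall>q\<in>S. K p q \<subseteq> S)"
    by (rule closure_small[OF F(1,2) Kc Ka])
  then obtain S where S: "F \<subseteq> S" "S \<subseteq> plains R" "|S| \<le>o |UNIV :: real set|"
      "\<And>p q. p \<in> S \<Longrightarrow> q \<in> S \<Longrightarrow> K p q \<subseteq> S"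
    by blast
  have "sub_closed R S"
    unfolding sub_closed_def
  proof (intro conjI ballI allI impI)
    show "S \<subseteq> plains R" by fact
    show "init R \<in> stset S" using F(3) S(1) by (auto simp: in_stset)
  next
    fix p \<alpha> assume p: "p \<in> S" and en: "enabled R (Plain p) \<alpha>"
    then have "set_st (succ p \<alpha>) \<subseteq> S" using S(4)[OF p p] by (auto simp: K_def K1_def)
    then show "\<exists>s\<in>stset S. (Plain p, \<alpha>, s) \<in> trans R" using succ[OF en] by (auto simp: in_stset)
  next
    fix p d1 d2 s
    assume p: "p \<in> S" and d: "(0::real) < d1" "0 < d2" and s: "s \<in> stset S"
      and t: "(Plain p, Delay (d1 + d2), s) \<in> trans R"
    obtain q where q: "q \<in> S" "s \<in> {Top, Bot, Plain q}" using s p by (cases s) auto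
    have "set_st (mid p d1 d2 s) \<subseteq> K2 p q" using q(2) d t unfolding K2_def by blast
    then have "mid p d1 d2 s \<in> stset S" using S(4)[OF p q(1)] by (auto simp: in_stset K_def)
    then show "\<exists>m\<in>stset S. (Plain p, Delay d1, m) \<in> trans R \<and> (m, Delay d2, s) \<in> trans R"
      using mid[OF d t] by blast
  next
    fix p assume p: "p \<in> S"
      and "\<exists>q\<in>delay_closure R p. \<exists>a\<in>outputs R. \<exists>s. (Plain q, Act a, s) \<in> trans R \<and> s \<noteq> Top"
    then obtain q s where "W p (q, s)" unfolding W_def by auto
    then have w: "W p (SOME w. W p w)" and ex: "\<exists>w. W p w" using W by blast+
    have "fst (SOME w. W p w) \<in> S" "snd (SOME w. W p w) \<in> stset S"
      using S(4)[OF p p] ex by (auto simp: K_def K3_def in_stset)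
    then show "\<exists>q\<in>delay_closure R p \<inter> S. \<exists>a\<in>outputs R. \<exists>s\<in>stset S.
        (Plain q, Act a, s) \<in> trans R \<and> s \<noteq> Top"
      using w unfolding W_def by blast
  qed
  then show ?thesis using S by blast
qed

lemma refines_environment:
  fixes R :: "('a, 'r) tiots"
  assumes ref: "refines Q P" and R: "is_spec R" "environment R Q"
    and free: "bot_free (spec_par Q R)"
  shows "bot_free (spec_par P R)"
proof (rule ccontr)
  assume "\<not> bot_free (spec_par P R)"
  then obtain w where w: "path (spec_par P R) (init (spec_par P R)) w Bot"
    by (auto simp: bot_free_def reachable_def)
  have t: "tiots R" using R by (simp add: is_spec_def)
  obtain F where F: "finite F" "F \<subseteq> plains R"
    "\<And>(N :: real set) e x. F \<subseteq> e ` N \<Longrightarrow> map_right e x = init (spec_par P R) \<Longrightarrow> right_plains x \<subseteq> N \<Longrightarrow>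
       \<exists>y. map_right e y = Bot \<and> right_plains y \<subseteq> N \<and> path (spec_par P (subsystem N e R)) x w y"
    using path_up[OF t w, where ?'n = real] by blast
  have "set_st (init R) \<subseteq> plains R" using t by (auto simp: tiots_def states_def)
  then obtain S where S: "F \<union> set_st (init R) \<subseteq> S" "|S| \<le>o |UNIV :: real set|" "sub_closed R S"
    using small_subsystem[OF t, of "F \<union> set_st (init R)"] F by (auto simp: finite_set_st)
  obtain g :: "'r \<Rightarrow> real" where g: "inj_on g S" using S(2) by (auto simp: card_of_ordLeq[symmetric])
  define e where "e = inv_into S g"
  define N where "N = g ` S"
  have e: "inj_on e N" "e ` N = S"
    using g by (auto simp: e_def N_def inj_on_inv_into image_comp)
  note ctx = R(1) S(3) e
  let ?U = "subsystem N e R"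
  have spec: "is_spec ?U" by (rule sub_spec[OF ctx])
  have "environment ?U Q"
    using R(2) spec by (auto simp: environment_def is_spec_def subsystem_def)
  then have "bot_free (spec_par P ?U)"
    using ref spec bot_free_down[OF ctx free] unfolding refines_def by blast
  moreover have "map_right e (init (spec_par P ?U)) = init (spec_par P R)" by (rule par_init[OF ctx])
  moreover have "right_plains (init (spec_par P ?U)) \<subseteq> N"
    using right_plains_par[OF sub_init(1)[OF ctx]]
    by (simp add: spec_par_def prod_par_def product_def)
  ultimately obtain y where "map_right e y = Bot" "path (spec_par P ?U) (init (spec_par P ?U)) w y"
    using F(3)[of e N] e S(1) by blast
  then have "\<not> bot_free (spec_par P ?U)"
    by (cases y) (auto simp: map_right_def bot_free_def reachable_def)
  then show False using \<open>bot_free (spec_par P ?U)\<close> by blast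
qed

end

end

theory Submission
  imports Defs "HOL-Library.Infinite_Set"
begin

text \<open>
  Refinement is reduced to the question whether a product can reach \<open>Bot\<close>. Let \<open>N\<close> be the
  \<open>\<top>\<close>-completed normal form of \<open>P\<close>. Its mirror, which exchanges inputs with outputs and \<open>Top\<close> with
  \<open>Bot\<close>, is after \<open>\<top>\<close>-removal a specification, and the most demanding environment in which \<open>P\<close> is
  safe: \<open>P\<close> is refined by \<open>S\<close> iff the product of \<open>S\<close> with this mirror is \<open>\<bottom>\<close>-free.

  The mirror of the quotient product is a parallel product, and that of the conjunctive product a
  disjunctive one. Hence \<open>P % Q\<close> is the greatest specification \<open>S\<close> such that \<open>P\<close> is refined by
  \<open>S \<parallel> Q\<close>, and \<open>P \<and> Q\<close> the greatest one refining both operands, so that both depend on their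
  operands up to equivalence only. Disjunction is \<open>\<bottom>\<close>-free in an environment iff both operands are.
  For the parallel product, \<open>(P \<parallel> Q) \<parallel> R\<close> is compared with \<open>P \<parallel> E\<close>, where the environment \<open>E\<close> of
  \<open>P\<close> consists of the weak transitions of \<open>Q \<parallel> R\<close> after hiding the actions foreign to \<open>P\<close>.
\<close>

text \<open>Two facts about \<open>clash\<close> carry the argument and play the roles of identity
  and cut in a sequent calculus: a deterministic system never clashes with its own mirror
  (\<open>no_clash_mirror\<close>), and a clash of \<open>S\<close> with \<open>R\<close> can be cut
  at any complete system \<open>N\<close>, leaving a clash of \<open>S\<close> with \<open>N\<close>
  or of the mirror of \<open>N\<close> with \<open>R\<close> (\<open>clash_cut\<close>). Collapsing
  makes the mirror an admissible environment, and it is harmless because no specification can steer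
  clear of a collapsed state. One obstacle is that products of specifications need not be
  specifications: their tagged copies need not accept all inputs, and time additivity may fail
  around \<open>Bot\<close>. Many lemmas therefore ask for \<open>wf_tiots\<close> only, or for
  properties of reachable states. Another obstacle is that an environment of
  \<open>P \<parallel> Q\<close> also hears the outputs of \<open>Q\<close>, so it need not be an
  environment of \<open>P\<close>. Composing it with \<open>Q\<close> and hiding the surplus repairs
  this; non-zenoness ensures that hiding creates no state that stops time without offering an
  output.\<close>

lemma par_st_eq_Bot: "par_st s t = Bot \<longleftrightarrow> s = Bot \<and> t \<noteq> Top \<or> t = Bot \<and> s \<noteq> Top"
  and par_st_eq_Top: "par_st s t = Top \<longleftrightarrow> s = Top \<or> t = Top"
  and par_st_eq_Plain:
    "par_st s t = Plain x \<longleftrightarrow> (\<exists>p q. s = Plain p \<and> t = Plain q \<and> x = Both p q)"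
  by (cases s; cases t; auto)+

lemma par_st_Top_right [simp]: "par_st s Top = Top"
  by (cases s) auto

text \<open>The part of \<open>tiots\<close> that products, completions, determinisations and
  mirrors all inherit; time additivity and non-zenoness may get lost on the way.\<close>

definition wf_tiots :: "('a, 's) tiots \<Rightarrow> bool" where
  "wf_tiots P \<longleftrightarrow> trans P \<subseteq> states P \<times> tA P \<times> states P \<and> init P \<in> states P \<and>
     chaotic P Top \<and> chaotic P Bot"

lemma wf_tiotsI: "tiots P \<Longrightarrow> wf_tiots P"
  by (simp add: tiots_def wf_tiots_def)

lemma plain_in_states [simp]: "Plain p \<in> states P \<longleftrightarrow> p \<in> plains P"
  and consts_in_states [simp]: "Top \<in> states P" "Bot \<in> states P"
  by (auto simp: states_def)

lemma delay_in_tA [simp]: "Delay d \<in> tA P \<longleftrightarrow> d > 0"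
  and act_in_tA [simp]: "Act a \<in> tA P \<longleftrightarrow> a \<in> actions P"
  and delay_in_tO [simp]: "Delay d \<in> tO P \<longleftrightarrow> d > 0"
  and act_in_tO [simp]: "Act a \<in> tO P \<longleftrightarrow> a \<in> outputs P"
  by (auto simp: tA_def tO_def delays_def)

lemma wf_trans:
  assumes "wf_tiots P" "(s, \<alpha>, t) \<in> trans P"
  shows "s \<in> states P" "\<alpha> \<in> tA P" "t \<in> states P"
  using assms unfolding wf_tiots_def by blast+

lemma wf_trans_Top: "wf_tiots P \<Longrightarrow> (Top, \<alpha>, s) \<in> trans P \<longleftrightarrow> \<alpha> \<in> tA P \<and> s = Top"
  and wf_trans_Bot: "wf_tiots P \<Longrightarrow> (Bot, \<alpha>, s) \<in> trans P \<longleftrightarrow> \<alpha> \<in> tA P \<and> s = Bot"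
  unfolding wf_tiots_def chaotic_def by blast+

lemma wf_trans_plain:
  assumes "wf_tiots P" "(Plain p, \<alpha>, t) \<in> trans P"
  shows "p \<in> plains P" "\<alpha> \<in> tA P" "t \<in> states P"
  using wf_trans[OF assms] by auto

lemma path_from_Top: "wf_tiots P \<Longrightarrow> path P s w t \<Longrightarrow> s = Top \<Longrightarrow> t = Top"
  and path_from_Bot: "wf_tiots P \<Longrightarrow> path P s w t \<Longrightarrow> s = Bot \<Longrightarrow> t = Bot"
  by (rotate_tac 1, induction rule: path.induct; simp add: wf_trans_Top wf_trans_Bot)+

lemma path_append: "path P s u m \<Longrightarrow> path P m v t \<Longrightarrow> path P s (u @ v) t"
  by (induction rule: path.induct) (auto intro: path.intros)

lemma path_appendE:
  assumes "path P s (u @ v) t"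
  obtains m where "path P s u m" "path P m v t"
  using assms
proof (induction u arbitrary: s thesis)
  case Nil then show ?case by (auto intro: path.intros)
next
  case (Cons \<alpha> u)
  from Cons.prems(2) obtain s' where s': "(s, \<alpha>, s') \<in> trans P" "path P s' (u @ v) t"
    by (auto elim: path.cases)
  obtain m where "path P s' u m" "path P m v t" using Cons.IH[OF _ s'(2)] .
  then show ?case using s' Cons.prems(1) by (blast intro: path.intros)
qed

lemma path_Nil_iff [simp]: "path P s [] t \<longleftrightarrow> s = t"
  by (auto elim: path.cases intro: path.intros)

lemma path_Cons_iff: "path P s (\<alpha> # w) t \<longleftrightarrow> (\<exists>m. (s, \<alpha>, m) \<in> trans P \<and> path P m w t)"
  by (auto elim: path.cases intro: path.intros)

lemma reachable_init: "reachable P (init P)"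
  unfolding reachable_def using path_Nil by blast

lemma reachable_step: "reachable P s \<Longrightarrow> (s, \<alpha>, t) \<in> trans P \<Longrightarrow> reachable P t"
  unfolding reachable_def using path_append[of P "init P" _ s "[\<alpha>]" t]
  by (auto simp: path_Cons_iff)

lemma reachable_path: "reachable P s \<Longrightarrow> path P s w t \<Longrightarrow> reachable P t"
  unfolding reachable_def using path_append by blast

lemma reachable_states: "wf_tiots P \<Longrightarrow> reachable P s \<Longrightarrow> s \<in> states P"
proof -
  have "path P x w y \<Longrightarrow> x \<in> states P \<Longrightarrow> wf_tiots P \<Longrightarrow> y \<in> states P" for x w y
    by (induction rule: path.induct) (auto dest: wf_trans)
  then show "wf_tiots P \<Longrightarrow> reachable P s \<Longrightarrow> s \<in> states P"
    unfolding reachable_def wf_tiots_def by blast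
qed

section \<open>Reaching an inconsistency in a parallel product\<close>

text \<open>What one operand contributes to a joint step: on labels outside its alphabet it stays
  where it is. This merges the rules \<open>sync\<close>, \<open>only_left\<close> and
  \<open>only_right\<close> into one.\<close>

definition moves :: "('a, 's) tiots \<Rightarrow> 's \<Rightarrow> 'a label \<Rightarrow> 's st \<Rightarrow> bool" where
  "moves P p \<alpha> s \<longleftrightarrow>
     (if \<alpha> \<in> tA P then (Plain p, \<alpha>, s) \<in> trans P else p \<in> plains P \<and> s = Plain p)"

text \<open>Reachability of \<open>Bot\<close> in the parallel product, stated for pairs of operand
  states. As no product type occurs, operands can be swapped, rebracketed or replaced by similar
  ones without constructing isomorphisms.\<close>

inductive clash :: "('a, 'p) tiots \<Rightarrow> ('a, 'q) tiots \<Rightarrow> 'p st \<Rightarrow> 'q st \<Rightarrow> bool" for P Q where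
  clash_bot: "par_st s t = Bot \<Longrightarrow> clash P Q s t"
| clash_step: "\<alpha> \<in> tA P \<union> tA Q \<Longrightarrow> moves P p \<alpha> s \<Longrightarrow> moves Q q \<alpha> t \<Longrightarrow> clash P Q s t \<Longrightarrow>
    clash P Q (Plain p) (Plain q)"

lemma not_clash_Top [simp]: "\<not> clash P Q Top t" "\<not> clash P Q s Top"
  by (auto elim: clash.cases)

lemma clash_Bot: "t \<noteq> Top \<Longrightarrow> clash P Q Bot t" "s \<noteq> Top \<Longrightarrow> clash P Q s Bot"
  by (auto intro!: clash_bot simp: par_st_eq_Bot)

lemma clash_not_Top: "clash P Q s t \<Longrightarrow> s \<noteq> Top \<and> t \<noteq> Top"
  using not_clash_Top by metis

lemma clash_commute: "clash P Q s t \<Longrightarrow> clash Q P t s"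
  by (induction rule: clash.induct)
    (auto intro: clash_step simp: par_st_eq_Bot clash_Bot)

lemma clash_commute_iff: "clash P Q s t \<longleftrightarrow> clash Q P t s"
  by (rule iffI; erule clash_commute)

lemma moves_not_in: "\<alpha> \<notin> tA P \<Longrightarrow> moves P p \<alpha> s \<longleftrightarrow> p \<in> plains P \<and> s = Plain p"
  and moves_in: "\<alpha> \<in> tA P \<Longrightarrow> moves P p \<alpha> s \<longleftrightarrow> (Plain p, \<alpha>, s) \<in> trans P"
  by (auto simp: moves_def)

lemma moves_plains: "wf_tiots P \<Longrightarrow> moves P p \<alpha> s \<Longrightarrow> p \<in> plains P \<and> s \<in> states P"
  unfolding moves_def using wf_trans_plain by (metis plain_in_states)

section \<open>Steps of the synchronised products\<close>

lemma spec_par_sel: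
  "inputs (spec_par P Q) = (inputs P \<union> inputs Q) - (outputs P \<union> outputs Q)"
  "outputs (spec_par P Q) = outputs P \<union> outputs Q"
  "plains (spec_par P Q) =
     {Both p q | p q. p \<in> plains P \<and> q \<in> plains Q} \<union> Fst ` plains P \<union> Snd ` plains Q"
  "init (spec_par P Q) = par_st (init P) (init Q)"
  "actions (spec_par P Q) = actions P \<union> actions Q"
  "tA (spec_par P Q) = tA P \<union> tA Q"
  by (auto simp: spec_par_def prod_par_def product_def actions_def tA_def)

lemma map_st_eq_consts [simp]:
  "map_st f s = Top \<longleftrightarrow> s = Top" "map_st f s = Bot \<longleftrightarrow> s = Bot"
  "Top = map_st f s \<longleftrightarrow> s = Top" "Bot = map_st f s \<longleftrightarrow> s = Bot"
  by (cases s; simp)+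

lemma map_st_eq_Plain:
  "map_st f s = Plain x \<longleftrightarrow> (\<exists>p. s = Plain p \<and> x = f p)"
  "Plain x = map_st f s \<longleftrightarrow> (\<exists>p. s = Plain p \<and> x = f p)"
  by (cases s; auto)+

text \<open>The operation \<open>f\<close> matters at the source only through its value on plain
  pairs, so this serves the parallel, disjunctive, conjunctive and quotient products alike.\<close>

lemma prod_step_Both:
  assumes wf: "wf_tiots P" "wf_tiots Q" and f: "\<And>p q. f (Plain p) (Plain q) = Plain (Both p q)"
  shows "prod_step f P Q (Plain (Both p q)) \<alpha> x \<longleftrightarrow>
    \<alpha> \<in> tA P \<union> tA Q \<and> (\<exists>s t. moves P p \<alpha> s \<and> moves Q q \<alpha> t \<and> x = f s t)"
proof
  assume "prod_step f P Q (Plain (Both p q)) \<alpha> x"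
  then show "\<alpha> \<in> tA P \<union> tA Q \<and> (\<exists>s t. moves P p \<alpha> s \<and> moves Q q \<alpha> t \<and> x = f s t)"
  proof cases
    case (sync p' s q' t)
    then show ?thesis
      using wf_trans[OF wf(1) sync(3)] wf_trans[OF wf(2) sync(4)] f by (auto simp: moves_def)
  next
    case (only_left p' a s q')
    then show ?thesis using wf_trans[OF wf(1) only_left(4)] f by (force simp: moves_def)
  next
    case (only_right q' a t p')
    then show ?thesis using wf_trans[OF wf(2) only_right(4)] f by (force simp: moves_def)
  qed (auto simp: map_st_eq_Plain)
next
  assume "\<alpha> \<in> tA P \<union> tA Q \<and> (\<exists>s t. moves P p \<alpha> s \<and> moves Q q \<alpha> t \<and> x = f s t)"
  then obtain s t where *: "\<alpha> \<in> tA P \<union> tA Q" "moves P p \<alpha> s" "moves Q q \<alpha> t" "x = f s t"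
    by blast
  have "prod_step f P Q (f (Plain p) (Plain q)) \<alpha> x"
  proof (cases "\<alpha> \<in> tA P \<and> \<alpha> \<in> tA Q")
    case True
    then show ?thesis using * prod_step.sync[of p \<alpha> s P q t Q f] by (simp add: moves_def)
  next
    case False
    then obtain a where a: "\<alpha> = Act a" using *(1) by (cases \<alpha>) auto
    show ?thesis
      using False * prod_step.only_left[of p a s P Q q f] prod_step.only_right[of q a t Q P p f]
      by (auto simp: a moves_def)
  qed
  then show "prod_step f P Q (Plain (Both p q)) \<alpha> x" by (simp add: f)
qed

lemma spec_par_step:
  assumes "wf_tiots P" "wf_tiots Q"
  shows "(Plain (Both p q), \<alpha>, x) \<in> trans (spec_par P Q) \<longleftrightarrow>
    \<alpha> \<in> tA P \<union> tA Q \<and> (\<exists>s t. moves P p \<alpha> s \<and> moves Q q \<alpha> t \<and> x = par_st s t)"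
  by (simp add: par_trans prod_step_Both[OF assms])

lemma product_chaos:
  assumes "wf_tiots P" "wf_tiots Q"
    and f: "\<And>p q. f (Plain p) (Plain q) = Plain (Both p q)"
  shows "(Top, \<alpha>, x) \<in> trans (product f In Out P Q) \<longleftrightarrow> \<alpha> \<in> tA P \<union> tA Q \<and> x = Top"
    "(Bot, \<alpha>, x) \<in> trans (product f In Out P Q) \<longleftrightarrow> \<alpha> \<in> tA P \<union> tA Q \<and> x = Bot"
proof -
  have "prod_step f P Q y \<alpha> x \<longleftrightarrow> \<alpha> \<in> tA P \<union> tA Q \<and> x = y" if y: "y = Top \<or> y = Bot" for y
  proof
    assume "prod_step f P Q y \<alpha> x"
    then show "\<alpha> \<in> tA P \<union> tA Q \<and> x = y"
      by cases (use y f wf_trans_Top[OF assms(1)] wf_trans_Bot[OF assms(1)]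
          wf_trans_Top[OF assms(2)] wf_trans_Bot[OF assms(2)] in auto)
  next
    assume *: "\<alpha> \<in> tA P \<union> tA Q \<and> x = y"
    \<comment> \<open>The constants of the product inherit their loops from the operands by
      \<open>left\<close> and \<open>right\<close>; \<open>z\<close> and \<open>z'\<close> are the
      constant \<open>y\<close> in the types of the operands.\<close>
    define z :: "'b st" where "z = (if y = Top then Top else Bot)"
    define z' :: "'c st" where "z' = (if y = Top then Top else Bot)"
    have z: "y = map_st Fst z" "y = map_st Snd z'" using y by (auto simp: z_def z'_def)
    from * consider "(z, \<alpha>, z) \<in> trans P" | "(z', \<alpha>, z') \<in> trans Q"
      using wf_trans_Top[OF assms(1)] wf_trans_Bot[OF assms(1)]
        wf_trans_Top[OF assms(2)] wf_trans_Bot[OF assms(2)] by (auto simp: z_def z'_def)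
    then show "prod_step f P Q y \<alpha> x"
      using prod_step.left[of z \<alpha> z P f Q] prod_step.right[of z' \<alpha> z' Q f P] * z by metis
  qed
  then show "(Top, \<alpha>, x) \<in> trans (product f In Out P Q) \<longleftrightarrow> \<alpha> \<in> tA P \<union> tA Q \<and> x = Top"
    "(Bot, \<alpha>, x) \<in> trans (product f In Out P Q) \<longleftrightarrow> \<alpha> \<in> tA P \<union> tA Q \<and> x = Bot"
    by (auto simp: product_def)
qed

lemma map_st_Fst_states: "s \<in> states P \<Longrightarrow> map_st Fst s \<in> states (product f In Out P Q)"
  and map_st_Snd_states: "t \<in> states Q \<Longrightarrow> map_st Snd t \<in> states (product f In Out P Q)"
  by (cases s; simp add: product_def) (cases t; simp add: product_def)

lemma product_wf:
  assumes wf: "wf_tiots P" "wf_tiots Q"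
    and f: "\<And>p q. f (Plain p) (Plain q) = Plain (Both p q)"
      "\<And>s t x. f s t = Plain x \<Longrightarrow> case x of Both p q \<Rightarrow> s = Plain p \<and> t = Plain q
         | Fst p \<Rightarrow> s = Plain p | Snd q \<Rightarrow> t = Plain q"
    and alph: "In \<union> Out = actions P \<union> actions Q"
  shows "wf_tiots (product f In Out P Q)"
proof -
  let ?R = "product f In Out P Q"
  have tA: "tA ?R = tA P \<union> tA Q" using alph by (auto simp: tA_def actions_def product_def)
  have f_st: "f s t \<in> states ?R" if "s \<in> states P" "t \<in> states Q" for s t
  proof (cases "f s t")
    case (Plain x)
    then show ?thesis using f(2)[OF Plain] that by (cases x) (auto simp: product_def)
  qed auto
  have "x \<in> states ?R \<and> \<alpha> \<in> tA ?R \<and> y \<in> states ?R" if "prod_step f P Q x \<alpha> y" for x \<alpha> y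
    using that
  proof cases
    case (left s s')
    then show ?thesis
      using wf_trans[OF wf(1) left(3)] by (simp add: map_st_Fst_states tA)
  next
    case (right s s')
    then show ?thesis
      using wf_trans[OF wf(2) right(3)] by (simp add: map_st_Snd_states tA)
  next
    case (sync p s q t)
    then show ?thesis
      using wf_trans[OF wf(1) sync(3)] wf_trans[OF wf(2) sync(4)] by (simp add: f_st tA del: f(1))
  next
    case (only_left p a s q)
    then show ?thesis using wf_trans[OF wf(1) only_left(4)] f_st[of _ "Plain q"] by (simp add: tA)
  next
    case (only_right q a t p)
    then show ?thesis using wf_trans[OF wf(2) only_right(4)] f_st[of "Plain p"] by (simp add: tA)
  qed
  then have "trans ?R \<subseteq> states ?R \<times> tA ?R \<times> states ?R" by (auto simp: product_def)
  moreover have "init ?R \<in> states ?R"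
    using f_st wf unfolding wf_tiots_def by (simp add: product_def)
  ultimately show ?thesis
    using product_chaos[where f = f and In = In and Out = Out, OF wf f(1)]
    by (auto simp: wf_tiots_def chaotic_def tA)
qed

lemma wf_spec_par: "wf_tiots P \<Longrightarrow> wf_tiots Q \<Longrightarrow> wf_tiots (spec_par P Q)"
proof (unfold spec_par_def prod_par_def, rule product_wf)
  fix s :: "'b st" and t :: "'c st" and x assume "par_st s t = Plain x"
  then show "case x of Both p q \<Rightarrow> s = Plain p \<and> t = Plain q
      | Fst p \<Rightarrow> s = Plain p | Snd q \<Rightarrow> t = Plain q"
    by (cases s; cases t) auto
qed (auto simp: actions_def same_alphabet_def)

lemma wf_prod_disj: "wf_tiots P \<Longrightarrow> wf_tiots Q \<Longrightarrow> same_alphabet P Q \<Longrightarrow> wf_tiots (prod_disj P Q)"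
proof (unfold prod_disj_def, rule product_wf)
  fix s :: "'b st" and t :: "'c st" and x assume "disj_st s t = Plain x"
  then show "case x of Both p q \<Rightarrow> s = Plain p \<and> t = Plain q
      | Fst p \<Rightarrow> s = Plain p | Snd q \<Rightarrow> t = Plain q"
    by (cases s; cases t) auto
qed (auto simp: actions_def same_alphabet_def)

lemma spec_par_moves:
  assumes "wf_tiots P" "wf_tiots Q"
  shows "moves (spec_par P Q) (Both p q) \<alpha> x \<longleftrightarrow>
    (\<exists>s t. moves P p \<alpha> s \<and> moves Q q \<alpha> t \<and> x = par_st s t)"
proof (cases "\<alpha> \<in> tA P \<union> tA Q")
  case True
  then show ?thesis
    using spec_par_step[OF assms, of p q \<alpha> x] moves_in[of \<alpha> "spec_par P Q"]
    by (simp add: spec_par_sel)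
next
  case False
  then show ?thesis by (auto simp: moves_not_in spec_par_sel)
qed

text \<open>A plain value of \<open>par_st\<close> is always a pair, so runs that start from such a
  value never enter the tagged copies \<open>Fst\<close> and \<open>Snd\<close>; and steps of pairs
  are pairs of \<open>moves\<close>.\<close>

lemma clash_reaches_Bot:
  assumes "wf_tiots P" "wf_tiots Q"
  shows "(\<exists>w. path (spec_par P Q) (par_st s t) w Bot) \<longleftrightarrow> clash P Q s t"
proof
  have "path (spec_par P Q) x w y \<Longrightarrow> y = Bot \<Longrightarrow> x = par_st s t \<Longrightarrow> clash P Q s t" for x w y
  proof (induction arbitrary: s t rule: path.induct)
    case (path_Nil x)
    then show ?case by (simp add: clash_bot)
  next
    case (path_Cons x \<alpha> x' w y)
    show ?case
    proof (cases x)
      case Top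
      have "x' = Top" using path_Cons.hyps(1) wf_spec_par[OF assms] wf_trans_Top Top by blast
      then show ?thesis
        using path_from_Top[OF wf_spec_par[OF assms] path_Cons.hyps(2)] path_Cons.prems by simp
    next
      case Bot
      then show ?thesis using path_Cons by (simp add: clash_bot)
    next
      case (Plain z)
      then obtain p q where pq: "s = Plain p" "t = Plain q" "z = Both p q"
        using path_Cons.prems by (metis par_st_eq_Plain)
      then obtain s' t' where "\<alpha> \<in> tA P \<union> tA Q" "moves P p \<alpha> s'" "moves Q q \<alpha> t'" "x' = par_st s' t'"
        using path_Cons.hyps(1) Plain spec_par_step[OF assms] by blast
      then show ?thesis
        unfolding pq using path_Cons.IH[OF path_Cons.prems(1)] by (blast intro: clash_step)
    qed
  qed
  then show "\<exists>w. path (spec_par P Q) (par_st s t) w Bot \<Longrightarrow> clash P Q s t" by blast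
next
  assume "clash P Q s t"
  then show "\<exists>w. path (spec_par P Q) (par_st s t) w Bot"
  proof (induction rule: clash.induct)
    case (clash_bot s t)
    then show ?case by (metis path_Nil)
  next
    case (clash_step \<alpha> p s q t)
    then have "(Plain (Both p q), \<alpha>, par_st s t) \<in> trans (spec_par P Q)"
      using spec_par_step[OF assms] by blast
    then show ?case using clash_step.IH path_Cons by fastforce
  qed
qed

lemma bot_free_iff_clash:
  "wf_tiots P \<Longrightarrow> wf_tiots Q \<Longrightarrow> bot_free (spec_par P Q) \<longleftrightarrow> \<not> clash P Q (init P) (init Q)"
  using clash_reaches_Bot[of P Q "init P" "init Q"]
  by (simp add: bot_free_def reachable_def spec_par_sel)

text \<open>The two bracketings have different state types, so the decomposition
  \<open>x = par_st a b\<close> is carried along. It is not unique if \<open>x\<close> is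
  \<open>Top\<close> or \<open>Bot\<close>, hence the induction is over all \<open>a\<close> and
  \<open>b\<close>.\<close>

lemma clash_par_assoc1:
  assumes wf: "wf_tiots A" "wf_tiots B" "wf_tiots C"
  shows "clash (spec_par A B) C x c \<Longrightarrow> x = par_st a b \<Longrightarrow> clash A (spec_par B C) a (par_st b c)"
proof (induction arbitrary: a b rule: clash.induct)
  case (clash_bot x c)
  then show ?case by (cases a; cases b; cases c) (auto intro!: clash.clash_bot)
next
  case (clash_step \<alpha> z x c y)
  obtain p q where pq: "a = Plain p" "b = Plain q" "z = Both p q"
    using clash_step.prems by (metis par_st_eq_Plain)
  obtain s t where "moves A p \<alpha> s" "moves B q \<alpha> t" "x = par_st s t"
    using clash_step.hyps(2) spec_par_moves[OF wf(1,2)] pq by blast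
  moreover have "moves (spec_par B C) (Both q c) \<alpha> (par_st t y)"
    using spec_par_moves[OF wf(2,3)] calculation clash_step by blast
  ultimately show ?case
    using clash.clash_step[of \<alpha> A "spec_par B C" p s "Both q c" "par_st t y"] clash_step pq
    by (simp add: spec_par_sel Un_assoc)
qed

lemma clash_par_assoc2:
  assumes wf: "wf_tiots A" "wf_tiots B" "wf_tiots C"
  shows "clash A (spec_par B C) a x \<Longrightarrow> x = par_st b c \<Longrightarrow> clash (spec_par A B) C (par_st a b) c"
proof (induction arbitrary: b c rule: clash.induct)
  case (clash_bot a x)
  then show ?case by (cases a; cases b; cases c) (auto intro!: clash.clash_bot)
next
  case (clash_step \<alpha> p s z x)
  obtain q r where qr: "b = Plain q" "c = Plain r" "z = Both q r"
    using clash_step.prems by (metis par_st_eq_Plain)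
  obtain t y where ty: "moves B q \<alpha> t" "moves C r \<alpha> y" "x = par_st t y"
    using clash_step.hyps(3) spec_par_moves[OF wf(2,3)] qr by blast
  moreover have "moves (spec_par A B) (Both p q) \<alpha> (par_st s t)"
    using spec_par_moves[OF wf(1,2)] calculation clash_step by blast
  ultimately show ?case
    using clash.clash_step[of \<alpha> "spec_par A B" C "Both p q" "par_st s t" r y] clash_step qr
    by (simp add: spec_par_sel Un_assoc)
qed

lemma clash_par_assoc:
  assumes "wf_tiots A" "wf_tiots B" "wf_tiots C"
  shows "clash (spec_par A B) C (par_st a b) c \<longleftrightarrow> clash A (spec_par B C) a (par_st b c)"
  using clash_par_assoc1[OF assms] clash_par_assoc2[OF assms] by blast

lemma clash_par_swap1:
  assumes wf: "wf_tiots A" "wf_tiots B"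
  shows "clash (spec_par A B) C x c \<Longrightarrow> x = par_st a b \<Longrightarrow> clash (spec_par B A) C (par_st b a) c"
proof (induction arbitrary: a b rule: clash.induct)
  case (clash_bot x c)
  then show ?case by (cases a; cases b; cases c) (auto intro!: clash.clash_bot)
next
  case (clash_step \<alpha> z x c y)
  obtain p q where pq: "a = Plain p" "b = Plain q" "z = Both p q"
    using clash_step.prems by (metis par_st_eq_Plain)
  obtain s t where st: "moves A p \<alpha> s" "moves B q \<alpha> t" "x = par_st s t"
    using clash_step.hyps(2) spec_par_moves[OF wf] pq by blast
  then have "moves (spec_par B A) (Both q p) \<alpha> (par_st t s)"
    using spec_par_moves[OF wf(2,1)] by blast
  then show ?case
    using clash.clash_step[of \<alpha> "spec_par B A" C "Both q p" "par_st t s" c y] clash_step pq st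
    by (auto simp: spec_par_sel)
qed

lemma clash_par_swap:
  assumes "wf_tiots A" "wf_tiots B"
  shows "clash (spec_par A B) C (par_st a b) c \<longleftrightarrow> clash (spec_par B A) C (par_st b a) c"
  using clash_par_swap1[OF assms] clash_par_swap1[OF assms(2,1)] by blast

text \<open>A \<open>Top\<close> in one component makes the product \<open>Top\<close>, from where \<open>Bot\<close> is out of reach.\<close>

lemma clash_modulo_Top:
  assumes "tA P' = tA P" "plains P' = plains P"
    and "\<And>p \<alpha> s. s \<noteq> Top \<Longrightarrow> (Plain p, \<alpha>, s) \<in> trans P' \<longleftrightarrow> (Plain p, \<alpha>, s) \<in> trans P"
  shows "clash P' Q s t \<longleftrightarrow> clash P Q s t"
proof -
  have m: "moves P' p \<alpha> s \<longleftrightarrow> moves P p \<alpha> s" if "s \<noteq> Top" for p \<alpha> s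
    unfolding moves_def assms(1,2) assms(3)[OF that] ..
  have "clash P' Q s t \<Longrightarrow> clash P Q s t"
  proof (induction rule: clash.induct)
    case (clash_step \<alpha> p s q t)
    have "s \<noteq> Top" using clash_step.IH by auto
    then have "moves P p \<alpha> s" using clash_step.hyps(2) m by simp
    then show ?case using clash_step assms(1) by (intro clash.clash_step[of \<alpha>]) simp_all
  qed (rule clash.clash_bot)
  moreover have "clash P Q s t \<Longrightarrow> clash P' Q s t"
  proof (induction rule: clash.induct)
    case (clash_step \<alpha> p s q t)
    have "s \<noteq> Top" using clash_step.IH by auto
    then have "moves P' p \<alpha> s" using clash_step.hyps(2) m by simp
    then show ?case using clash_step assms(1) by (intro clash.clash_step[of \<alpha>]) simp_all
  qed (rule clash.clash_bot)
  ultimately show ?thesis by blast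
qed

section \<open>Completion and removal of transitions to \<open>Top\<close>\<close>

lemma top_completion_sel [simp]:
  "inputs (top_completion P) = inputs P" "outputs (top_completion P) = outputs P"
  "plains (top_completion P) = plains P" "init (top_completion P) = init P"
  "actions (top_completion P) = actions P" "tA (top_completion P) = tA P"
  "tO (top_completion P) = tO P" "states (top_completion P) = states P"
  by (auto simp: top_completion_def actions_def tA_def tO_def states_def)

lemma top_removal_sel [simp]:
  "inputs (top_removal P) = inputs P" "outputs (top_removal P) = outputs P"
  "plains (top_removal P) = plains P" "init (top_removal P) = init P"
  "actions (top_removal P) = actions P" "tA (top_removal P) = tA P"
  "tO (top_removal P) = tO P" "states (top_removal P) = states P"
  by (auto simp: top_removal_def actions_def tA_def tO_def states_def)

lemma tO_subset_tA: "tO P \<subseteq> tA P"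
  by (auto simp: tA_def tO_def actions_def)

lemma top_completion_trans:
  "(s, \<alpha>, t) \<in> trans (top_completion P) \<longleftrightarrow> (s, \<alpha>, t) \<in> trans P \<or>
     (\<exists>p\<in>plains P. s = Plain p \<and> \<alpha> \<in> tO P \<and> \<not> enabled P s \<alpha> \<and> t = Top)"
  by (auto simp: top_completion_def)

lemma top_removal_trans:
  "(s, \<alpha>, t) \<in> trans (top_removal P) \<longleftrightarrow> (s, \<alpha>, t) \<in> trans P \<and>
     \<not> (\<exists>p. s = Plain p \<and> \<alpha> \<in> tO P \<and> t = Top)"
  by (auto simp: top_removal_def)

lemma wf_top_completion: "wf_tiots P \<Longrightarrow> wf_tiots (top_completion P)"
  using tO_subset_tA[of P]
  by (auto simp: wf_tiots_def chaotic_def top_completion_trans dest: wf_trans)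

lemma wf_top_removal: "wf_tiots P \<Longrightarrow> wf_tiots (top_removal P)"
  by (auto simp: wf_tiots_def chaotic_def top_removal_trans dest: wf_trans)

lemma clash_top_completion [simp]: "clash (top_completion P) Q s t \<longleftrightarrow> clash P Q s t"
  by (rule clash_modulo_Top) (auto simp: top_completion_trans)

lemma clash_top_removal [simp]: "clash (top_removal P) Q s t \<longleftrightarrow> clash P Q s t"
  by (rule clash_modulo_Top) (auto simp: top_removal_trans)

lemma clash_top_completion_right [simp]: "clash P (top_completion Q) s t \<longleftrightarrow> clash P Q s t"
  and clash_top_removal_right [simp]: "clash P (top_removal Q) s t \<longleftrightarrow> clash P Q s t"
  by (simp_all add: clash_commute_iff[of P])

section \<open>Mirrors and deterministic complete systems\<close>

fun dual :: "'s st \<Rightarrow> 's st" where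
  "dual Top = Bot"
| "dual Bot = Top"
| "dual (Plain p) = Plain p"

lemma dual_dual [simp]: "dual (dual s) = s"
  and dual_eq_consts [simp]: "dual s = Top \<longleftrightarrow> s = Bot" "dual s = Bot \<longleftrightarrow> s = Top"
    "dual s = Plain p \<longleftrightarrow> s = Plain p"
  by (cases s; simp)+

definition mirror :: "('a, 's) tiots \<Rightarrow> ('a, 's) tiots" where
  "mirror P = \<lparr>inputs = outputs P, outputs = inputs P, plains = plains P, init = dual (init P),
     trans = {(s, \<alpha>, t). (dual s, \<alpha>, dual t) \<in> trans P}\<rparr>"

lemma mirror_sel [simp]:
  "inputs (mirror P) = outputs P" "outputs (mirror P) = inputs P"
  "plains (mirror P) = plains P" "init (mirror P) = dual (init P)"
  "(s, \<alpha>, t) \<in> trans (mirror P) \<longleftrightarrow> (dual s, \<alpha>, dual t) \<in> trans P"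
  "actions (mirror P) = actions P" "tA (mirror P) = tA P"
  "s \<in> states (mirror P) \<longleftrightarrow> s \<in> states P" "dual s \<in> states P \<longleftrightarrow> s \<in> states P"
  "mirror (mirror P) = P"
  by (cases s; auto simp: mirror_def actions_def tA_def states_def)+

lemma wf_mirror: "wf_tiots P \<Longrightarrow> wf_tiots (mirror P)"
  unfolding wf_tiots_def chaotic_def by fastforce

definition functional :: "('a, 's) tiots \<Rightarrow> bool" where
  "functional P \<longleftrightarrow> (\<forall>p \<alpha> s t. (Plain p, \<alpha>, s) \<in> trans P \<longrightarrow> (Plain p, \<alpha>, t) \<in> trans P \<longrightarrow> s = t)"

definition complete :: "('a, 's) tiots \<Rightarrow> bool" where
  "complete P \<longleftrightarrow> (\<forall>p\<in>plains P. \<forall>\<alpha>\<in>tA P. \<exists>s. (Plain p, \<alpha>, s) \<in> trans P)"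

lemma functionalD:
  "functional P \<Longrightarrow> (Plain p, \<alpha>, s) \<in> trans P \<Longrightarrow> (Plain p, \<alpha>, t) \<in> trans P \<Longrightarrow> s = t"
  unfolding functional_def by blast

lemma completeE:
  assumes "complete P" "p \<in> plains P" "\<alpha> \<in> tA P"
  obtains s where "(Plain p, \<alpha>, s) \<in> trans P"
  using assms unfolding complete_def by blast

lemma functional_mirror [simp]: "functional (mirror P) \<longleftrightarrow> functional P"
proof -
  have "functional (mirror P)" if "functional P" for P :: "('a, 'b) tiots"
    using that unfolding functional_def by (metis dual.simps(3) dual_dual mirror_sel(5))
  from this[of P] this[of "mirror P"] show ?thesis by auto
qed

lemma complete_mirror [simp]: "complete (mirror P) \<longleftrightarrow> complete P"
proof -
  have "complete (mirror P)" if "complete P" for P :: "('a, 'b) tiots"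
    using that unfolding complete_def
    by (metis dual.simps(3) dual_dual mirror_sel(3,5,7))
  from this[of P] this[of "mirror P"] show ?thesis by auto
qed

lemma nonzeno_mono:
  assumes "nonzeno P"
    and "\<And>p \<alpha> q. (Plain p, \<alpha>, Plain q) \<in> trans P' \<Longrightarrow> (Plain p, \<alpha>, Plain q) \<in> trans P"
  shows "nonzeno P'"
  using assms unfolding nonzeno_def by blast

lemma nonzeno_mirror: "nonzeno P \<Longrightarrow> nonzeno (mirror P)"
  by (erule nonzeno_mono) simp

lemma time_additive_mirror: "time_additive P \<Longrightarrow> time_additive (mirror P)"
  unfolding time_additive_def mirror_sel by (metis dual_dual)

text \<open>Since \<open>N\<close> is functional, it and its mirror remain dual to each other along
  every joint run, and \<open>par_st s (dual s)\<close> is never \<open>Bot\<close>: a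
  \<open>Bot\<close> on one side meets \<open>Top\<close> on the other, and \<open>Top\<close>
  wins.\<close>

lemma no_clash_mirror:
  assumes "functional N"
  shows "clash N (mirror N) s t \<Longrightarrow> t \<noteq> dual s"
proof (induction rule: clash.induct)
  case (clash_bot s t)
  then show ?case by (auto simp: par_st_eq_Bot)
next
  case (clash_step \<alpha> p s q t)
  show ?case
  proof
    assume "Plain q = dual (Plain p)"
    then have pq: "q = p" by simp
    have a: "\<alpha> \<in> tA N" using clash_step.hyps(1) by simp
    have "(Plain p, \<alpha>, s) \<in> trans N" "(Plain p, \<alpha>, dual t) \<in> trans N"
      using clash_step.hyps(2,3) a pq by (simp_all add: moves_in)
    then have "dual t = s" using functionalD[OF assms] by blast
    then show False using clash_step.IH by auto
  qed
qed

text \<open>Being complete, \<open>N\<close> can accompany the joint run of \<open>S\<close> and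
  \<open>R\<close>. If it gets to \<open>Bot\<close> it clashes with \<open>S\<close>; if it gets to
  \<open>Top\<close> its mirror gets to \<open>Bot\<close> and clashes with \<open>R\<close>; if it
  is still plain at the end, the operand that is in \<open>Bot\<close> clashes with its own
  partner.\<close>

lemma clash_cut:
  assumes "wf_tiots N" "complete N" and tA: "tA S = tA N" "tA R = tA N"
  shows "clash S R s r \<Longrightarrow> n \<in> states N \<Longrightarrow> clash S N s n \<or> clash (mirror N) R (dual n) r"
proof (induction arbitrary: n rule: clash.induct)
  case (clash_bot s r)
  then show ?case by (cases n) (auto simp: par_st_eq_Bot clash_Bot)
next
  case (clash_step \<alpha> p s q r)
  show ?case
  proof (cases n)
    case (Plain x)
    have a: "\<alpha> \<in> tA N" using clash_step.hyps(1) tA by simp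
    obtain n' where n': "(Plain x, \<alpha>, n') \<in> trans N"
      using completeE[OF assms(2) _ a, of x] clash_step.prems Plain by auto
    then have "clash S N s n' \<or> clash (mirror N) R (dual n') r"
      using clash_step.IH wf_trans_plain(3)[OF assms(1)] by blast
    moreover have "moves N x \<alpha> n'" "moves (mirror N) x \<alpha> (dual n')"
      using n' a by (simp_all add: moves_in)
    ultimately show ?thesis
      using clash_step.hyps(1-3) clash.clash_step[of \<alpha> S N p s x n']
        clash.clash_step[of \<alpha> "mirror N" R x "dual n'" q r] Plain a by auto
  qed (auto simp: clash_Bot)
qed

section \<open>Disjunctive products\<close>

lemma prod_disj_step:
  "(s, \<alpha>, t) \<in> trans (prod_disj P Q) \<longleftrightarrow> prod_step disj_st P Q s \<alpha> t"
  by (simp add: prod_disj_def product_def)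

lemma prod_disj_sel [simp]:
  "inputs (prod_disj P Q) = inputs P" "outputs (prod_disj P Q) = outputs P"
  "actions (prod_disj P Q) = actions P" "tA (prod_disj P Q) = tA P"
  "init (prod_disj P Q) = disj_st (init P) (init Q)"
  by (auto simp: prod_disj_def product_def actions_def tA_def)

lemma prod_step_Fst:
  assumes "\<And>p q. f (Plain p) (Plain q) = Plain (Both p q)"
  shows "prod_step f P Q (Plain (Fst p)) \<alpha> x \<longleftrightarrow> (\<exists>s. (Plain p, \<alpha>, s) \<in> trans P \<and> x = map_st Fst s)"
proof
  assume "prod_step f P Q (Plain (Fst p)) \<alpha> x"
  then show "\<exists>s. (Plain p, \<alpha>, s) \<in> trans P \<and> x = map_st Fst s"
    by cases (auto simp: map_st_eq_Plain assms)
next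
  assume "\<exists>s. (Plain p, \<alpha>, s) \<in> trans P \<and> x = map_st Fst s"
  then show "prod_step f P Q (Plain (Fst p)) \<alpha> x" using prod_step.left[of "Plain p" \<alpha> _ P f Q] by auto
qed

lemma prod_step_Snd:
  assumes "\<And>p q. f (Plain p) (Plain q) = Plain (Both p q)"
  shows "prod_step f P Q (Plain (Snd q)) \<alpha> x \<longleftrightarrow> (\<exists>s. (Plain q, \<alpha>, s) \<in> trans Q \<and> x = map_st Snd s)"
proof
  assume "prod_step f P Q (Plain (Snd q)) \<alpha> x"
  then show "\<exists>s. (Plain q, \<alpha>, s) \<in> trans Q \<and> x = map_st Snd s"
    by cases (auto simp: map_st_eq_Plain assms)
next
  assume "\<exists>s. (Plain q, \<alpha>, s) \<in> trans Q \<and> x = map_st Snd s"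
  then show "prod_step f P Q (Plain (Snd q)) \<alpha> x" using prod_step.right[of "Plain q" \<alpha> _ Q f P] by auto
qed

lemma prod_disj_trans:
  assumes "wf_tiots P" "wf_tiots Q" "tA Q = tA P"
  shows "(Plain (Both p q), \<alpha>, x) \<in> trans (prod_disj P Q) \<longleftrightarrow>
      (\<exists>s t. (Plain p, \<alpha>, s) \<in> trans P \<and> (Plain q, \<alpha>, t) \<in> trans Q \<and> x = disj_st s t)"
    "(Plain (Fst p), \<alpha>, x) \<in> trans (prod_disj P Q) \<longleftrightarrow>
      (\<exists>s. (Plain p, \<alpha>, s) \<in> trans P \<and> x = map_st Fst s)"
    "(Plain (Snd q), \<alpha>, x) \<in> trans (prod_disj P Q) \<longleftrightarrow>
      (\<exists>s. (Plain q, \<alpha>, s) \<in> trans Q \<and> x = map_st Snd s)"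
  using wf_trans_plain(2)[OF assms(1), of p \<alpha>] assms(3)
  by (auto simp: prod_disj_step prod_step_Both[OF assms(1,2)] prod_step_Fst prod_step_Snd moves_def)

lemma disj_st_Top [simp]: "disj_st s Top = map_st Fst s" "disj_st Top t = map_st Snd t"
  by (cases s; simp) (cases t; simp)

lemma disj_st_eq:
  "disj_st s t = Bot \<longleftrightarrow> s = Bot \<or> t = Bot" "disj_st s t = Top \<longleftrightarrow> s = Top \<and> t = Top"
  "disj_st s t = Plain x \<longleftrightarrow> (\<exists>p q. s = Plain p \<and> t = Plain q \<and> x = Both p q) \<or>
     (\<exists>p. s = Plain p \<and> t = Top \<and> x = Fst p) \<or> (\<exists>q. s = Top \<and> t = Plain q \<and> x = Snd q)"
  by (cases s; cases t; auto)+

text \<open>An operand in \<open>Top\<close> can no longer clash, and the product then proceeds as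
  the tagged copy of the other one. As \<open>Bot\<close> in the product means \<open>Bot\<close> in
  an operand, the clash can be traced back to one of them.\<close>

lemma clash_prod_disjD:
  assumes wf: "wf_tiots A" "wf_tiots B" and tA: "tA B = tA A" "tA S = tA A"
  shows "clash (prod_disj A B) S x r \<Longrightarrow> x = disj_st a b \<Longrightarrow> clash A S a r \<or> clash B S b r"
proof (induction arbitrary: a b rule: clash.induct)
  case (clash_bot x r)
  then have "r \<noteq> Top" "x \<noteq> Top" "x = Bot \<or> r = Bot" by (auto simp: par_st_eq_Bot)
  then show ?case using clash_bot(2) by (cases a; cases b) (auto simp: clash_Bot)
next
  case (clash_step \<alpha> z x q r)
  have al: "\<alpha> \<in> tA A" "\<alpha> \<in> tA B" "\<alpha> \<in> tA S" using clash_step.hyps(1) tA by auto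
  have st: "(Plain z, \<alpha>, x) \<in> trans (prod_disj A B)"
    using clash_step.hyps(2) al(1) by (simp add: moves_in)
  consider (Both) p q where "a = Plain p" "b = Plain q" "z = Both p q"
    | (Fst) p where "a = Plain p" "b = Top" "z = Fst p"
    | (Snd) q where "a = Top" "b = Plain q" "z = Snd q"
    using clash_step.prems disj_st_eq(3)[of a b z] by metis
  then show ?case
  proof cases
    case (Both p p')
    then obtain s t where s: "(Plain p, \<alpha>, s) \<in> trans A" "(Plain p', \<alpha>, t) \<in> trans B" "x = disj_st s t"
      using st prod_disj_trans[OF wf tA(1)] by blast
    then have "clash A S s r \<or> clash B S t r" using clash_step.IH by blast
    then show ?thesis
      using clash.clash_step[of \<alpha> A S p s q r] clash.clash_step[of \<alpha> B S p' t q r]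
        s clash_step.hyps(3) al Both by (auto simp: moves_in)
  next
    case (Fst p)
    then obtain s where s: "(Plain p, \<alpha>, s) \<in> trans A" "x = disj_st s Top"
      using st prod_disj_trans[OF wf tA(1)] by auto
    then have "clash A S s r" using clash_step.IH by fastforce
    then show ?thesis
      using clash.clash_step[of \<alpha> A S p s q r] s clash_step.hyps(3) al Fst by (auto simp: moves_in)
  next
    case (Snd p)
    then obtain s where s: "(Plain p, \<alpha>, s) \<in> trans B" "x = disj_st Top s"
      using st prod_disj_trans[OF wf tA(1)] by auto
    then have "clash B S s r" using clash_step.IH by fastforce
    then show ?thesis
      using clash.clash_step[of \<alpha> B S p s q r] s clash_step.hyps(3) al Snd by (auto simp: moves_in)
  qed
qed

text \<open>Completeness of \<open>B\<close> lets it follow the run of \<open>A\<close>. On reaching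
  \<open>Bot\<close> it makes the product clash at once; on reaching \<open>Top\<close> it leaves a
  copy of \<open>A\<close> behind, which goes on with the run.\<close>

lemma clash_prod_disj_left:
  assumes wf: "wf_tiots A" "wf_tiots B" and tA: "tA B = tA A" "tA S = tA A" and B: "complete B"
  shows "clash A S a r \<Longrightarrow> b \<in> states B \<Longrightarrow> clash (prod_disj A B) S (disj_st a b) r"
proof (induction arbitrary: b rule: clash.induct)
  case (clash_bot a r)
  then show ?case by (auto simp: par_st_eq_Bot disj_st_eq intro!: clash.clash_bot)
next
  case (clash_step \<alpha> p s q r)
  have al: "\<alpha> \<in> tA A" "\<alpha> \<in> tA B" "\<alpha> \<in> tA S" using clash_step.hyps(1) tA by auto
  have s: "(Plain p, \<alpha>, s) \<in> trans A" using clash_step.hyps(2) al(1) by (simp add: moves_in)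
  show ?case
  proof (cases b)
    case Top
    have "clash (prod_disj A B) S (map_st Fst s) r" using clash_step.IH[of Top] by simp
    moreover have "(Plain (Fst p), \<alpha>, map_st Fst s) \<in> trans (prod_disj A B)"
      using prod_disj_trans[OF wf tA(1)] s by auto
    ultimately show ?thesis
      using clash.clash_step[of \<alpha> "prod_disj A B" S "Fst p" _ q r] al clash_step.hyps(3) Top
      by (simp add: moves_in)
  next
    case Bot
    then show ?thesis by (simp add: clash_Bot)
  next
    case (Plain y)
    obtain t where t: "(Plain y, \<alpha>, t) \<in> trans B"
      using completeE[OF B _ al(2), of y] clash_step.prems Plain by auto
    have "clash (prod_disj A B) S (disj_st s t) r"
      using clash_step.IH wf_trans_plain(3)[OF wf(2) t] by blast
    moreover have "(Plain (Both p y), \<alpha>, disj_st s t) \<in> trans (prod_disj A B)"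
      using prod_disj_trans[OF wf tA(1)] s t by blast
    ultimately show ?thesis
      using clash.clash_step[of \<alpha> "prod_disj A B" S "Both p y" _ q r] al clash_step.hyps(3) Plain
      by (simp add: moves_in)
  qed
qed

lemma clash_prod_disj_right:
  assumes wf: "wf_tiots A" "wf_tiots B" and tA: "tA B = tA A" "tA S = tA A" and A: "complete A"
  shows "clash B S b r \<Longrightarrow> a \<in> states A \<Longrightarrow> clash (prod_disj A B) S (disj_st a b) r"
proof (induction arbitrary: a rule: clash.induct)
  case (clash_bot b r)
  then show ?case by (auto simp: par_st_eq_Bot disj_st_eq intro!: clash.clash_bot)
next
  case (clash_step \<alpha> p s q r)
  have al: "\<alpha> \<in> tA A" "\<alpha> \<in> tA B" "\<alpha> \<in> tA S" using clash_step.hyps(1) tA by auto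
  have s: "(Plain p, \<alpha>, s) \<in> trans B" using clash_step.hyps(2) al(2) by (simp add: moves_in)
  show ?case
  proof (cases a)
    case Top
    have "clash (prod_disj A B) S (map_st Snd s) r" using clash_step.IH[of Top] by simp
    moreover have "(Plain (Snd p), \<alpha>, map_st Snd s) \<in> trans (prod_disj A B)"
      using prod_disj_trans[OF wf tA(1)] s by auto
    ultimately show ?thesis
      using clash.clash_step[of \<alpha> "prod_disj A B" S "Snd p" _ q r] al clash_step.hyps(3) Top
      by (simp add: moves_in)
  next
    case Bot
    then show ?thesis by (simp add: clash_Bot)
  next
    case (Plain y)
    obtain t where t: "(Plain y, \<alpha>, t) \<in> trans A"
      using completeE[OF A _ al(1), of y] clash_step.prems Plain by auto
    have "clash (prod_disj A B) S (disj_st t s) r"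
      using clash_step.IH wf_trans_plain(3)[OF wf(1) t] by blast
    moreover have "(Plain (Both y p), \<alpha>, disj_st t s) \<in> trans (prod_disj A B)"
      using prod_disj_trans[OF wf tA(1)] s t by blast
    ultimately show ?thesis
      using clash.clash_step[of \<alpha> "prod_disj A B" S "Both y p" _ q r] al clash_step.hyps(3) Plain
      by (simp add: moves_in)
  qed
qed

lemma clash_prod_disj:
  assumes "wf_tiots A" "wf_tiots B" "tA B = tA A" "tA S = tA A" "complete A" "complete B"
    "a \<in> states A" "b \<in> states B"
  shows "clash (prod_disj A B) S (disj_st a b) r \<longleftrightarrow> clash A S a r \<or> clash B S b r"
  using clash_prod_disjD[OF assms(1-4)] clash_prod_disj_left[OF assms(1-4,6)]
    clash_prod_disj_right[OF assms(1-4,5)] assms(7,8) by blast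

section \<open>Determinisation\<close>

lemma det_sel [simp]:
  "inputs (det P) = inputs P" "outputs (det P) = outputs P" "init (det P) = reduce {init P}"
  "actions (det P) = actions P" "tA (det P) = tA P"
  by (auto simp: det_def actions_def tA_def)

lemma det_plains: "X \<in> plains (det P) \<longleftrightarrow> (\<exists>w. after P w \<noteq> {} \<and> reduce (after P w) = Plain X)"
  by (simp add: det_def)

lemma det_trans:
  "(Plain X, \<alpha>, s) \<in> trans (det P) \<longleftrightarrow>
     X \<in> plains (det P) \<and> post P X \<alpha> \<noteq> {} \<and> s = reduce (post P X \<alpha>)"
  "(Top, \<alpha>, s) \<in> trans (det P) \<longleftrightarrow> \<alpha> \<in> tA P \<and> s = Top"
  "(Bot, \<alpha>, s) \<in> trans (det P) \<longleftrightarrow> \<alpha> \<in> tA P \<and> s = Bot"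
  by (auto simp: det_def)

lemma reduce_eq_Plain:
  "reduce X = Plain Y \<longleftrightarrow> Bot \<notin> X \<and> X \<noteq> {Top} \<and> Y = {p. Plain p \<in> X}"
  and reduce_eq_Bot: "reduce X = Bot \<longleftrightarrow> Bot \<in> X"
  by (auto simp: reduce_def)

lemma reduce_plain_nonempty:
  assumes "reduce X = Plain Y" "X \<noteq> {}"
  shows "\<exists>p\<in>Y. Plain p \<in> X"
proof -
  have "Bot \<notin> X" "X \<noteq> {Top}" "Y = {p. Plain p \<in> X}" using assms(1) by (auto simp: reduce_eq_Plain)
  moreover obtain s where "s \<in> X" "s \<noteq> Top" using calculation(2) assms(2) by blast
  ultimately show ?thesis by (cases s) auto
qed

lemma det_plain_nonempty: "X \<in> plains (det P) \<Longrightarrow> X \<noteq> {}"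
  using reduce_plain_nonempty unfolding det_plains by blast

lemma after_states: "wf_tiots P \<Longrightarrow> after P w \<subseteq> states P"
  using reachable_states unfolding after_def reachable_def by blast

lemma det_plain_subset: "wf_tiots P \<Longrightarrow> X \<in> plains (det P) \<Longrightarrow> X \<subseteq> plains P"
  using after_states[of P] unfolding det_plains reduce_eq_Plain
  by (metis (mono_tags, lifting) mem_Collect_eq plain_in_states subset_eq)

text \<open>The sets \<open>post P X \<alpha>\<close> and \<open>after P (w @ [\<alpha>])\<close>
  may differ by a \<open>Top\<close> that stems from an earlier \<open>Top\<close> dropped by
  \<open>reduce\<close>. This is harmless, since \<open>post\<close> contains a plain state and both
  sets then reduce to the same one.\<close>

lemma det_plain_post:
  assumes wf: "wf_tiots P" and X: "X \<in> plains (det P)"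
    and Y: "post P X \<alpha> \<noteq> {}" "reduce (post P X \<alpha>) = Plain Y"
  shows "Y \<in> plains (det P)"
proof -
  obtain w where w: "after P w \<noteq> {}" "reduce (after P w) = Plain X" using X by (auto simp: det_plains)
  have aft: "s \<in> after P (w @ [\<alpha>]) \<longleftrightarrow> (\<exists>m\<in>after P w. (m, \<alpha>, s) \<in> trans P)" for s
    unfolding after_def
    by (auto simp: path_Cons_iff elim!: path_appendE intro: path_append)
  have X': "Plain p \<in> after P w \<longleftrightarrow> p \<in> X" "Bot \<notin> after P w" for p
    using w(2) by (auto simp: reduce_eq_Plain)
  have "post P X \<alpha> \<subseteq> after P (w @ [\<alpha>])" using X'(1) by (auto simp: post_def aft; blast)
  moreover have "s \<in> post P X \<alpha>" if s: "s \<in> after P (w @ [\<alpha>])" "s \<noteq> Top" for s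
  proof -
    obtain m where m: "m \<in> after P w" "(m, \<alpha>, s) \<in> trans P" using s(1) aft by blast
    then show ?thesis using X' s(2) wf_trans_Top[OF wf] by (cases m) (auto simp: post_def)
  qed
  ultimately have sub: "post P X \<alpha> \<subseteq> after P (w @ [\<alpha>])"
      "\<And>s. s \<in> after P (w @ [\<alpha>]) \<Longrightarrow> s \<noteq> Top \<Longrightarrow> s \<in> post P X \<alpha>" by blast+
  obtain p where p: "Plain p \<in> post P X \<alpha>" using reduce_plain_nonempty[OF Y(2,1)] by blast
  have "reduce (after P (w @ [\<alpha>])) = Plain Y"
    using Y(2) sub p unfolding reduce_eq_Plain by blast
  moreover have "after P (w @ [\<alpha>]) \<noteq> {}" using sub(1) p by blast
  ultimately show ?thesis unfolding det_plains by blast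
qed

lemma det_init_state: "reduce {init P} \<in> states (det P)"
proof (cases "reduce {init P}")
  case (Plain X)
  moreover have "after P [] = {init P}" by (auto simp: after_def)
  ultimately have "X \<in> plains (det P)" unfolding det_plains by (metis insert_not_empty)
  then show ?thesis using Plain by simp
qed auto

lemma wf_det:
  assumes wf: "wf_tiots P"
  shows "wf_tiots (det P)"
proof -
  have "s \<in> states (det P) \<and> \<alpha> \<in> tA P \<and> t \<in> states (det P)" if st: "(s, \<alpha>, t) \<in> trans (det P)" for s \<alpha> t
  proof (cases s)
    case (Plain X)
    then have X: "X \<in> plains (det P)" "post P X \<alpha> \<noteq> {}" "t = reduce (post P X \<alpha>)"
      using st by (auto simp: det_trans)
    have "\<alpha> \<in> tA P" using X(2) wf_trans[OF wf] unfolding post_def by blast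
    moreover have "t \<in> states (det P)"
      using det_plain_post[OF wf X(1,2)] X(3) by (cases "reduce (post P X \<alpha>)") auto
    ultimately show ?thesis using Plain X by simp
  qed (use st in \<open>auto simp: det_trans\<close>)
  then show ?thesis
    using det_init_state by (auto simp: wf_tiots_def chaotic_def det_trans)
qed

lemma functional_det: "functional (det P)"
  by (auto simp: functional_def det_trans)

text \<open>The states of the run are members of the sets passed by the determinisation. A set
  reduced to \<open>Bot\<close> on account of another member only makes the clash come
  earlier.\<close>

lemma clash_det1:
  assumes wf: "wf_tiots P"
  shows "clash P R s r \<Longrightarrow> s = Plain p \<Longrightarrow> p \<in> X \<Longrightarrow> X \<in> plains (det P) \<Longrightarrow> clash (det P) R (Plain X) r"
proof (induction arbitrary: p X rule: clash.induct)
  case (clash_bot s r)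
  then show ?case by (auto simp: par_st_eq_Bot clash_Bot)
next
  case (clash_step \<alpha> q s x r)
  have "\<exists>S. moves (det P) X \<alpha> S \<and> clash (det P) R S r"
  proof (cases "\<alpha> \<in> tA P")
    case True
    have s: "(Plain p, \<alpha>, s) \<in> trans P" using clash_step.hyps(2) clash_step.prems(1) True by (simp add: moves_in)
    then have post: "s \<in> post P X \<alpha>" using clash_step.prems by (auto simp: post_def)
    have "clash (det P) R (reduce (post P X \<alpha>)) r"
    proof (cases "Bot \<in> post P X \<alpha>")
      case True
      then show ?thesis using clash_not_Top[OF clash_step.hyps(4)] by (simp add: reduce_def clash_Bot)
    next
      case False
      then obtain p' where p': "s = Plain p'"
        using clash_not_Top[OF clash_step.hyps(4)] post by (cases s) auto
      define Y where "Y = {p. Plain p \<in> post P X \<alpha>}"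
      have Y: "reduce (post P X \<alpha>) = Plain Y" using False post p' by (auto simp: reduce_eq_Plain Y_def)
      then have "Y \<in> plains (det P)" using det_plain_post[OF wf clash_step.prems(3)] post by blast
      then have "clash (det P) R (Plain Y) r" using clash_step.IH p' post by (simp add: Y_def)
      then show ?thesis by (simp add: Y)
    qed
    moreover have "moves (det P) X \<alpha> (reduce (post P X \<alpha>))"
      using True post clash_step.prems(3) by (auto simp: moves_in det_trans)
    ultimately show ?thesis by blast
  next
    case False
    then have "s = Plain p" using clash_step.hyps(2) clash_step.prems(1) by (simp add: moves_not_in)
    then have "clash (det P) R (Plain X) r" using clash_step by blast
    then show ?thesis using False clash_step.prems(3) by (auto simp: moves_not_in)
  qed
  then show ?case using clash_step.hyps(1,3) by (auto intro: clash.clash_step[of \<alpha>])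
qed

text \<open>The clashing member is found backwards: every member of the successor set, and
  \<open>Bot\<close> if the set has been reduced to it, has a predecessor in
  \<open>X\<close>.\<close>

lemma clash_det2:
  assumes wf: "wf_tiots P"
  shows "clash (det P) R S r \<Longrightarrow> S = Plain X \<Longrightarrow> X \<in> plains (det P) \<Longrightarrow> \<exists>p\<in>X. clash P R (Plain p) r"
proof (induction arbitrary: X rule: clash.induct)
  case (clash_bot S r)
  then have "r = Bot" by (auto simp: par_st_eq_Bot)
  then show ?case using det_plain_nonempty[OF clash_bot(3)] by (auto simp: clash_Bot)
next
  case (clash_step \<alpha> Z S x r)
  have Z: "Z = X" using clash_step.prems by simp
  have "\<exists>p\<in>X. \<exists>s. moves P p \<alpha> s \<and> clash P R s r"
  proof (cases "\<alpha> \<in> tA P")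
    case True
    then have S: "post P X \<alpha> \<noteq> {}" "S = reduce (post P X \<alpha>)"
      using clash_step.hyps(2) Z by (auto simp: moves_in det_trans)
    have "\<exists>s\<in>post P X \<alpha>. clash P R s r"
    proof (cases S)
      case Top
      then show ?thesis using clash_step.hyps(4) by simp
    next
      case Bot
      then have "Bot \<in> post P X \<alpha>" using S(2) by (simp add: reduce_eq_Bot)
      then show ?thesis using clash_not_Top[OF clash_step.hyps(4)] by (intro bexI[of _ Bot]) (auto simp: clash_Bot)
    next
      case (Plain Y)
      then have Y: "reduce (post P X \<alpha>) = Plain Y" using S by simp
      then have "\<exists>p\<in>Y. clash P R (Plain p) r"
        using clash_step.IH[OF Plain] det_plain_post[OF wf clash_step.prems(2) S(1)] by blast
      then show ?thesis using Y by (auto simp: reduce_eq_Plain)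
    qed
    then show ?thesis using True by (auto simp: post_def moves_in)
  next
    case False
    then have "S = Plain X" using clash_step.hyps(2) Z by (simp add: moves_not_in)
    then have "\<exists>p\<in>X. clash P R (Plain p) r" using clash_step by blast
    then show ?thesis
      using False det_plain_subset[OF wf clash_step.prems(2)] by (auto simp: moves_not_in)
  qed
  then show ?case using clash_step.hyps(1,3) Z by (auto intro: clash.clash_step[of \<alpha>])
qed

lemma clash_det:
  assumes wf: "wf_tiots P"
  shows "clash (det P) R (init (det P)) r \<longleftrightarrow> clash P R (init P) r"
proof (cases "init P")
  case (Plain p)
  then have i: "reduce {init P} = Plain {p}" by (auto simp: reduce_def)
  then have "{p} \<in> plains (det P)" using det_init_state[of P] by simp
  then show ?thesis
    using clash_det1[OF wf, of R "Plain p" r p "{p}"] clash_det2[OF wf, of R "Plain {p}" r "{p}"] i Plain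
    by auto
qed (auto simp: reduce_def clash_Bot dest: clash_not_Top; metis clash_Bot(1) clash_not_Top)+

lemma complete_top_completion_det:
  assumes wf: "wf_tiots P" and "bot_complete P"
  shows "complete (top_completion (det P))"
  unfolding complete_def
proof (intro ballI)
  fix X \<alpha> assume X: "X \<in> plains (top_completion (det P))" and a: "\<alpha> \<in> tA (top_completion (det P))"
  show "\<exists>s. (Plain X, \<alpha>, s) \<in> trans (top_completion (det P))"
  proof (cases "enabled (det P) (Plain X) \<alpha> \<or> \<alpha> \<in> tO P")
    case True
    then show ?thesis using X by (auto simp: top_completion_trans enabled_def tO_def)
  next
    case False
    then obtain b where b: "\<alpha> = Act b" "b \<in> inputs P"
      using a by (cases \<alpha>) (auto simp: actions_def)
    obtain p where p: "p \<in> X" using det_plain_nonempty X by fastforce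
    then have "p \<in> plains P" using det_plain_subset[OF wf] X by auto
    then have "enabled P (Plain p) \<alpha>" using assms(2) b by (auto simp: bot_complete_iff)
    then have "post P X \<alpha> \<noteq> {}" using p by (auto simp: post_def enabled_def)
    then have "enabled (det P) (Plain X) \<alpha>" using X by (auto simp: enabled_def det_trans)
    then show ?thesis using False by blast
  qed
qed

lemma functional_top_completion: "functional P \<Longrightarrow> functional (top_completion P)"
  unfolding functional_def top_completion_trans enabled_def by blast

lemma nonzeno_top_completion: "nonzeno P \<Longrightarrow> nonzeno (top_completion P)"
  by (erule nonzeno_mono) (auto simp: top_completion_trans)

text \<open>Functionality matters here. If one state reached after \<open>d1\<close> could delay by
  \<open>d2\<close> and another could not, the completion would lead to \<open>Top\<close> through
  the latter in two steps, but not in one step of length \<open>d1 + d2\<close>, which is enabled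
  already.\<close>

lemma time_additive_top_completion:
  assumes wf: "wf_tiots P" and f: "functional P" and ta: "time_additive P"
  shows "time_additive (top_completion P)"
  unfolding time_additive_def
proof (intro allI impI)
  fix s t and d1 d2 :: real assume d: "d1 > 0" "d2 > 0"
  have ta': "(s, Delay (d1 + d2), t) \<in> trans P \<longleftrightarrow>
      (\<exists>m. (s, Delay d1, m) \<in> trans P \<and> (m, Delay d2, t) \<in> trans P)" for s t
    using ta d unfolding time_additive_def by blast
  let ?T = "trans (top_completion P)"
  show "(s, Delay (d1 + d2), t) \<in> ?T \<longleftrightarrow> (\<exists>m. (s, Delay d1, m) \<in> ?T \<and> (m, Delay d2, t) \<in> ?T)"
  proof (cases s)
    case (Plain p)
    show ?thesis
    proof
      assume L: "(s, Delay (d1 + d2), t) \<in> ?T"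
      show "\<exists>m. (s, Delay d1, m) \<in> ?T \<and> (m, Delay d2, t) \<in> ?T"
      proof (cases "(s, Delay (d1 + d2), t) \<in> trans P")
        case True
        then show ?thesis using ta' by (auto simp: top_completion_trans)
      next
        case False
        then have n: "p \<in> plains P" "\<not> enabled P s (Delay (d1 + d2))" "t = Top"
          using L Plain by (auto simp: top_completion_trans)
        show ?thesis
        proof (cases "enabled P s (Delay d1)")
          case True
          then obtain m where m: "(s, Delay d1, m) \<in> trans P" by (auto simp: enabled_def)
          then have "\<not> enabled P m (Delay d2)" using n(2) ta' unfolding enabled_def by blast
          moreover have "\<exists>q\<in>plains P. m = Plain q"
            using calculation wf_trans_Top[OF wf] wf_trans_Bot[OF wf] d(2) wf_trans(3)[OF wf m]
            by (cases m) (auto simp: enabled_def)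
          ultimately show ?thesis using m n(3) d by (auto simp: top_completion_trans)
        next
          case False
          then show ?thesis using Plain n d wf_trans_Top[OF wf] by (auto simp: top_completion_trans)
        qed
      qed
    next
      assume "\<exists>m. (s, Delay d1, m) \<in> ?T \<and> (m, Delay d2, t) \<in> ?T"
      then obtain m where m: "(s, Delay d1, m) \<in> ?T" "(m, Delay d2, t) \<in> ?T" by blast
      show "(s, Delay (d1 + d2), t) \<in> ?T"
      proof (cases "(s, Delay d1, m) \<in> trans P")
        case True
        show ?thesis
        proof (cases "(m, Delay d2, t) \<in> trans P")
          case True
          then show ?thesis using \<open>(s, Delay d1, m) \<in> trans P\<close> ta' by (auto simp: top_completion_trans)
        next
          case False
          then have "t = Top" "\<not> enabled P m (Delay d2)" using m(2) by (auto simp: top_completion_trans)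
          then have "\<not> enabled P s (Delay (d1 + d2))"
            using ta' True functionalD[OF f] Plain unfolding enabled_def by blast
          moreover have "p \<in> plains P" using wf_trans_plain(1)[OF wf] True Plain by blast
          ultimately show ?thesis using \<open>t = Top\<close> Plain d by (simp add: top_completion_trans)
        qed
      next
        case False
        then have n: "m = Top" "\<not> enabled P s (Delay d1)" "p \<in> plains P"
          using m(1) Plain by (auto simp: top_completion_trans)
        then have "t = Top" using m(2) wf_trans_Top[OF wf] by (auto simp: top_completion_trans)
        moreover have "\<not> enabled P s (Delay (d1 + d2))" using n(2) ta' unfolding enabled_def by blast
        ultimately show ?thesis using Plain n d by (simp add: top_completion_trans)
      qed
    qed
  qed (use ta'[of s t] wf_trans_Top[OF wf] wf_trans_Bot[OF wf] in \<open>auto simp: top_completion_trans\<close>)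
qed

section \<open>Specifications as environments\<close>

text \<open>A specification keeps only its reachable states away from \<open>Top\<close>;
  \<open>safe\<close> is the form of this property that inductions over steps can carry.\<close>

definition safe :: "('a, 's) tiots \<Rightarrow> 's st \<Rightarrow> bool" where
  "safe P s \<longleftrightarrow> (\<forall>w. \<not> path P s w Top)"

lemma safe_step: "safe P s \<Longrightarrow> (s, \<alpha>, t) \<in> trans P \<Longrightarrow> safe P t"
  unfolding safe_def using path_Cons by metis

lemma safe_not_Top: "safe P s \<Longrightarrow> s \<noteq> Top"
  unfolding safe_def by (metis path_Nil)

lemma spec_safe_init: "is_spec P \<Longrightarrow> safe P (init P)"
  by (auto simp: is_spec_def reachable_def safe_def)

lemma spec_tiots: "is_spec P \<Longrightarrow> tiots P"
  and spec_wf: "is_spec P \<Longrightarrow> wf_tiots P"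
  by (auto simp: is_spec_def wf_tiotsI)

lemma spec_input: "is_spec P \<Longrightarrow> p \<in> plains P \<Longrightarrow> a \<in> inputs P \<Longrightarrow> \<exists>s. (Plain p, Act a, s) \<in> trans P"
  by (auto simp: is_spec_def bot_complete_iff enabled_def)

lemma spec_delay_split:
  assumes "tiots P" "d1 > 0" "d2 > 0" "(s, Delay (d1 + d2), t) \<in> trans P"
  obtains m where "(s, Delay d1, m) \<in> trans P" "(m, Delay d2, t) \<in> trans P"
  using assms unfolding tiots_def time_additive_def by blast

lemma spec_delay_prefix:
  assumes "tiots P" "0 < e" "e \<le> d" "(s, Delay d, t) \<in> trans P"
  obtains m where "(s, Delay e, m) \<in> trans P"
proof (cases "e = d")
  case False
  then show ?thesis using spec_delay_split[OF assms(1), of e "d - e" s t] assms that by auto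
qed (use assms that in auto)

text \<open>In this form the absence of \<open>semi_top\<close> states is used from here on: whoever
  stops time has an output on offer.\<close>

lemma spec_no_timelock:
  assumes P: "is_spec P" "p \<in> plains P" and d: "d > 0" "\<not> enabled P (Plain p) (Delay d)"
  obtains q a s where "q \<in> delay_closure P p" "a \<in> outputs P" "(Plain q, Act a, s) \<in> trans P" "s \<noteq> Top"
proof -
  have "(Plain p, Delay d, Top) \<in> trans (top_completion P)"
    using assms by (simp add: top_completion_trans)
  moreover have "\<not> semi_top (top_completion P) p" using P by (simp add: is_spec_def)
  ultimately obtain q a s where q: "q \<in> delay_closure (top_completion P) p" "a \<in> outputs P"
      "(Plain q, Act a, s) \<in> trans (top_completion P)" "s \<noteq> Top"
    using d(1) unfolding semi_top_def by auto
  moreover have "q \<in> delay_closure P p" "(Plain q, Act a, s) \<in> trans P"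
    using q by (auto simp: delay_closure_def top_completion_trans)
  ultimately show ?thesis using that by blast
qed

section \<open>Collapsing inconsistent states\<close>

text \<open>The collapse in \<open>normalise\<close> without its determinisation, so that it also
  applies to completed systems and to mirrors. The latter turns realisation into
  normalisation.\<close>

definition normal :: "('a, 's) tiots \<Rightarrow> ('a, 's) tiots" where
  "normal D = collapse Bot (collapsible special_bot Bot D) D"

text \<open>
  Delays need not add up beyond \<open>Bot\<close>: in the mirror of a quotient, time may pass from \<open>Bot\<close>
  to \<open>Top\<close>. Collapsing restores time additivity.
\<close>

locale regular =
  fixes D :: "('a, 's) tiots"
  assumes wf: "wf_tiots D" and fin: "finite (inputs D)" "finite (outputs D)"
    and disj: "inputs D \<inter> outputs D = {}"
    and functional: "functional D" and complete: "complete D" and nonzeno: "nonzeno D"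
    and delay_add: "\<And>p d1 d2 m s. 0 < d1 \<Longrightarrow> 0 < d2 \<Longrightarrow> (Plain p, Delay d1, m) \<in> trans D \<Longrightarrow> m \<noteq> Bot \<Longrightarrow>
      (m, Delay d2, s) \<in> trans D \<Longrightarrow> (Plain p, Delay (d1 + d2), s) \<in> trans D"

lemma collapse_sel2 [simp]:
  "init (collapse t C P) = redirect t C (init P)" "actions (collapse t C P) = actions P"
  "tA (collapse t C P) = tA P"
  by (auto simp: collapse_def actions_def tA_def)

lemma collapse_chaos:
  "(Top, \<alpha>, s) \<in> trans (collapse t C P) \<longleftrightarrow> \<alpha> \<in> tA P \<and> s = Top"
  "(Bot, \<alpha>, s) \<in> trans (collapse t C P) \<longleftrightarrow> \<alpha> \<in> tA P \<and> s = Bot"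
  by (auto simp: collapse_def)

lemma redirect_Bot: "redirect Bot C s = Bot \<longleftrightarrow> s = Bot \<or> (\<exists>p\<in>C. s = Plain p)"
  by (auto simp: redirect_def)

lemma passes_self: "(Plain p, Delay d, s) \<in> trans P \<Longrightarrow> 0 < d \<Longrightarrow> redirect t C s = t \<Longrightarrow> passes t C P p d"
  unfolding passes_def by auto

lemma passes_longer: "passes t C P p d \<Longrightarrow> d \<le> d' \<Longrightarrow> passes t C P p d'"
  unfolding passes_def by force

text \<open>Fixed point induction over the rounds of the collapse. It is run for
  \<open>W \<inter> plains P\<close>, because only plain states are ever collapsed.\<close>

lemma collapsible_special_bot_induct:
  assumes "\<And>C. C \<subseteq> W \<Longrightarrow> C \<subseteq> plains P \<Longrightarrow> {p \<in> plains P - C. special_bot (collapse Bot C P) p} \<subseteq> W"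
  shows "collapsible special_bot Bot P \<subseteq> W"
proof -
  have "collapsible special_bot Bot P \<subseteq> W \<inter> plains P"
    unfolding collapsible_def by (rule lfp_lowerbound) (use assms[of "W \<inter> plains P"] in auto)
  then show ?thesis by blast
qed

context regular
begin

abbreviation C where "C \<equiv> collapsible special_bot Bot D"

text \<open>Splitting follows from joining: by completeness \<open>m\<close> has some successor
  after \<open>d2\<close>, and by \<open>delay_add\<close> and functionality it can only be
  \<open>s\<close>.\<close>

lemma delay_rest:
  assumes "0 < d1" "0 < d2" "(Plain p, Delay d1, m) \<in> trans D" "m \<noteq> Bot"
    "(Plain p, Delay (d1 + d2), s) \<in> trans D"
  shows "(m, Delay d2, s) \<in> trans D"
proof -
  have "\<exists>t. (m, Delay d2, t) \<in> trans D"
  proof (cases m)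
    case (Plain q)
    then have "q \<in> plains D" using wf_trans_plain(3)[OF wf assms(3)] by simp
    then show ?thesis using complete assms(2) Plain unfolding complete_def by auto
  qed (use assms wf_trans_Top[OF wf] in auto)
  then obtain t where t: "(m, Delay d2, t) \<in> trans D" by blast
  then have "t = s" using delay_add[OF assms(1-4) t] functionalD[OF functional] assms(5) by blast
  then show ?thesis using t by simp
qed

text \<open>By determinism all delays of \<open>p\<close> beyond \<open>d1\<close> run through the
  same state \<open>m\<close>, so whatever is passed after \<open>d1\<close> is passed starting from
  \<open>m\<close>.\<close>

lemma passes_add:
  assumes "0 < d1" "0 < d2" "(Plain p, Delay d1, m) \<in> trans D" "\<not> passes Bot A D p d1"
  shows "passes Bot A D p (d1 + d2) \<longleftrightarrow> (\<exists>q. m = Plain q \<and> passes Bot A D q d2)"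
proof -
  have m: "m \<noteq> Bot" using passes_self[OF assms(3,1), of Bot A] assms(4) by (auto simp: redirect_Bot)
  show ?thesis
  proof
    assume "passes Bot A D p (d1 + d2)"
    then obtain d s where d: "0 < d" "d \<le> d1 + d2" "(Plain p, Delay d, s) \<in> trans D" "redirect Bot A s = Bot"
      unfolding passes_def by blast
    have "d1 < d" using d assms(4) unfolding passes_def by (meson not_less)
    then have ms: "(m, Delay (d - d1), s) \<in> trans D"
      using delay_rest[OF assms(1) _ assms(3) m, of "d - d1" s] d(3) by simp
    show "\<exists>q. m = Plain q \<and> passes Bot A D q d2"
    proof (cases m)
      case Top
      then show ?thesis using ms d(4) wf_trans_Top[OF wf] by (auto simp: redirect_def split: if_splits)
    next
      case (Plain q)
      then show ?thesis using ms d \<open>d1 < d\<close> unfolding passes_def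
        by (intro exI[of _ q] conjI exI[of _ "d - d1"] exI[of _ s]) auto
    qed (use m in simp)
  next
    assume "\<exists>q. m = Plain q \<and> passes Bot A D q d2"
    then obtain q d s where q: "m = Plain q" "0 < d" "d \<le> d2" "(Plain q, Delay d, s) \<in> trans D"
        "redirect Bot A s = Bot"
      unfolding passes_def by blast
    then have "(Plain p, Delay (d1 + d), s) \<in> trans D" using delay_add[OF assms(1) q(2) assms(3) m] by simp
    then show "passes Bot A D p (d1 + d2)" using q assms(1) unfolding passes_def
      by (intro exI[of _ "d1 + d"] exI[of _ s]) auto
  qed
qed

lemma normal_sel [simp]:
  "inputs (normal D) = inputs D" "outputs (normal D) = outputs D" "plains (normal D) = plains D - C"
  "actions (normal D) = actions D" "tA (normal D) = tA D"
  by (simp_all add: normal_def)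

lemma init_normal: "init (normal D) = redirect Bot C (init D)"
  by (simp add: normal_def)

lemma wf_normal: "wf_tiots (normal D)"
proof -
  have red: "s \<in> states D \<Longrightarrow> redirect Bot C s \<in> states (normal D)" for s
    by (cases s) (auto simp: redirect_def)
  have "s \<in> states (normal D) \<and> \<alpha> \<in> tA D \<and> t \<in> states (normal D)"
    if st: "(s, \<alpha>, t) \<in> trans (normal D)" for s \<alpha> t
  proof (cases s)
    case (Plain p)
    show ?thesis
    proof (cases \<alpha>)
      case (Act a)
      then obtain t' where t': "p \<in> plains D - C" "(Plain p, Act a, t') \<in> trans D" "t = redirect Bot C t'"
        using st Plain by (auto simp: normal_def collapse_act)
      then show ?thesis using wf_trans_plain[OF wf t'(2)] red Plain Act by auto
    next
      case (Delay d)
      then have t: "p \<in> plains D - C" "passes Bot C D p d \<and> t = Bot \<or>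
          \<not> passes Bot C D p d \<and> (Plain p, Delay d, t) \<in> trans D"
        using st Plain by (auto simp: normal_def collapse_delay split: if_splits)
      show ?thesis
      proof (cases "passes Bot C D p d")
        case True
        then show ?thesis using t Plain Delay unfolding passes_def by auto
      next
        case False
        then have tr: "(Plain p, Delay d, t) \<in> trans D" using t by blast
        then have "t = redirect Bot C t"
          using False passes_self[OF tr] wf_trans_plain(2)[OF wf tr] by (auto simp: redirect_def)
        then show ?thesis using wf_trans_plain[OF wf tr] red[of t] t(1) Plain Delay by auto
      qed
    qed
  qed (use st in \<open>auto simp: normal_def collapse_chaos\<close>)
  moreover have "init (normal D) \<in> states (normal D)"
    using red wf by (simp add: init_normal wf_tiots_def)
  ultimately show ?thesis
    by (auto simp: wf_tiots_def chaotic_def) (auto simp: normal_def collapse_chaos)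
qed

lemma functional_normal: "functional (normal D)"
  unfolding functional_def
proof (intro allI impI)
  fix p \<alpha> s t assume "(Plain p, \<alpha>, s) \<in> trans (normal D)" "(Plain p, \<alpha>, t) \<in> trans (normal D)"
  then show "s = t" using functionalD[OF functional, of p \<alpha>]
    by (cases \<alpha>) (auto simp: normal_def collapse_act collapse_delay split: if_splits)
qed

lemma complete_normal: "complete (normal D)"
  unfolding complete_def
proof (intro ballI)
  fix p \<alpha> assume p: "p \<in> plains (normal D)" and a: "\<alpha> \<in> tA (normal D)"
  then obtain s where "(Plain p, \<alpha>, s) \<in> trans D" using complete unfolding complete_def by fastforce
  then show "\<exists>s. (Plain p, \<alpha>, s) \<in> trans (normal D)"
    using p by (cases \<alpha>) (auto simp: normal_def collapse_act collapse_delay)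
qed

lemma normal_plain:
  assumes "(Plain p, \<alpha>, Plain q) \<in> trans (normal D)"
  shows "(Plain p, \<alpha>, Plain q) \<in> trans D"
  using assms by (cases \<alpha>)
    (auto simp: normal_def collapse_act collapse_delay redirect_def split: if_splits)

lemma nonzeno_normal: "nonzeno (normal D)"
  using nonzeno_mono[OF nonzeno normal_plain] .

text \<open>If the first part of the delay passes a collapsed state, both sides end in the chaotic
  \<open>Bot\<close>. Otherwise this part is untouched by the collapse, and
  \<open>passes_add\<close> gives the same answer for the whole delay and for its rest.\<close>

lemma time_additive_normal: "time_additive (normal D)"
  unfolding time_additive_def
proof (intro allI impI)
  fix s t and d1 d2 :: real assume d: "0 < d1" "0 < d2"
  let ?T = "trans (normal D)"
  have chaos: "(x, \<alpha>, y) \<in> ?T \<longleftrightarrow> \<alpha> \<in> tA D \<and> y = x" if "x = Top \<or> x = Bot" for x y \<alpha>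
    using that wf_trans_Top[OF wf_normal] wf_trans_Bot[OF wf_normal] by auto
  show "(s, Delay (d1 + d2), t) \<in> ?T \<longleftrightarrow> (\<exists>m. (s, Delay d1, m) \<in> ?T \<and> (m, Delay d2, t) \<in> ?T)"
  proof (cases "\<exists>p\<in>plains (normal D). s = Plain p")
    case True
    then obtain p where p: "p \<in> plains D - C" "s = Plain p" by auto
    have delay: "(Plain q, Delay e, x) \<in> ?T \<longleftrightarrow>
        (if passes Bot C D q e then x = Bot else (Plain q, Delay e, x) \<in> trans D)" if "q \<in> plains D - C" for q e x
      using that by (simp add: normal_def collapse_delay)
    show ?thesis
    proof (cases "passes Bot C D p d1")
      case True
      then have "passes Bot C D p (d1 + d2)" using passes_longer d by fastforce
      then show ?thesis using True p d by (simp add: delay chaos)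
    next
      case False
      obtain m where m: "(Plain p, Delay d1, m) \<in> trans D"
        using completeE[OF complete, of p "Delay d1"] p d(1) by auto
      have m': "m \<noteq> Bot" "\<And>q. m = Plain q \<Longrightarrow> q \<in> plains D - C"
        using passes_self[OF m d(1), of Bot C] False wf_trans_plain(3)[OF wf m]
        by (auto simp: redirect_Bot)
      have only: "(Plain p, Delay d1, x) \<in> ?T \<longleftrightarrow> x = m" for x
        using False m functionalD[OF functional m, of x] p(1) delay[of p d1 x] by auto
      have "(Plain p, Delay (d1 + d2), t) \<in> ?T \<longleftrightarrow> (m, Delay d2, t) \<in> ?T"
      proof (cases "passes Bot C D p (d1 + d2)")
        case True
        then obtain q where "m = Plain q" "passes Bot C D q d2" using passes_add[OF d m False] by blast
        then show ?thesis using True m'(2) p(1) by (simp add: delay)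
      next
        case np: False
        have "(Plain p, Delay (d1 + d2), t) \<in> trans D \<longleftrightarrow> (m, Delay d2, t) \<in> trans D"
          using delay_add[OF d m m'(1)] delay_rest[OF d m m'(1)] by blast
        moreover have "(m, Delay d2, t) \<in> ?T \<longleftrightarrow> (m, Delay d2, t) \<in> trans D"
        proof (cases m)
          case (Plain q)
          then have "\<not> passes Bot C D q d2" using passes_add[OF d m False] np by blast
          then show ?thesis using Plain m'(2) by (simp add: delay)
        qed (use m'(1) chaos wf_trans_Top[OF wf] in auto)
        ultimately show ?thesis using np p(1) by (simp add: delay)
      qed
      then show ?thesis using p(2) only by auto
    qed
  next
    case False
    show ?thesis
    proof (cases "s = Top \<or> s = Bot")
      case True
      then show ?thesis using d by (auto simp: chaos)
    next
      case no: False
      then have "(s, \<alpha>, x) \<notin> ?T" for \<alpha> x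
        using False wf_trans(1)[OF wf_normal, of s \<alpha> x] by (cases s) auto
      then show ?thesis by blast
    qed
  qed
qed

lemma regular_normal: "regular (normal D)"
proof
  fix p d1 d2 m s
  assume "0 < d1" "0 < d2" "(Plain p, Delay d1, m) \<in> trans (normal D)" "(m, Delay d2, s) \<in> trans (normal D)"
  then show "(Plain p, Delay (d1 + d2), s) \<in> trans (normal D)"
    using time_additive_normal unfolding time_additive_def by blast
qed (use fin disj wf_normal functional_normal complete_normal nonzeno_normal in auto)

lemma no_special_normal: "p \<in> plains (normal D) \<Longrightarrow> \<not> auto_bot (normal D) p \<and> \<not> semi_bot (normal D) p"
  using collapsible_unfold[of D special_bot Bot] special_bot_mono[of _ _ _ D]
  unfolding normal_def special_bot_def by blast

subsection \<open>Specifications cannot avoid collapsed states\<close>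

text \<open>Induction over the rounds of the collapse. At an \<open>auto_bot\<close> state,
  \<open>S\<close> has to accept the fatal output. At a \<open>semi_bot\<close> state, a collapsed
  state is due at some time \<open>d'\<close>. Either \<open>S\<close> lets \<open>d'\<close> pass
  and meets it, or \<open>S\<close> stops time and offers an output at an earlier time
  \<open>e\<close>; by then \<open>D\<close> has met a collapsed state already, or it is in a state
  all of whose inputs lead to collapsed states, so that the output of \<open>S\<close> is
  fatal.\<close>

lemma clash_collapsible:
  assumes S: "is_spec S" "inputs S = outputs D" "outputs S = inputs D"
  shows "p \<in> C \<Longrightarrow> r \<in> plains S \<Longrightarrow> safe S (Plain r) \<Longrightarrow> clash D S (Plain p) (Plain r)"
proof -
  define W where "W = {p. \<forall>r\<in>plains S. safe S (Plain r) \<longrightarrow> clash D S (Plain p) (Plain r)}"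
  have tA: "tA S = tA D" using S(2,3) by (auto simp: tA_def actions_def)
  have tiots: "tiots S" and wfS: "wf_tiots S" using S(1) by (auto simp: spec_tiots spec_wf)
  have "C \<subseteq> W"
  proof (rule collapsible_special_bot_induct, rule subsetI)
    fix A p assume A: "A \<subseteq> W" "A \<subseteq> plains D" and "p \<in> {p \<in> plains D - A. special_bot (collapse Bot A D) p}"
    then have p: "p \<in> plains D" "p \<notin> A" and sp: "special_bot (collapse Bot A D) p" by auto
    have hit: "clash D S x y" if "redirect Bot A x = Bot" "safe S y" "y \<in> states S" for x y
    proof -
      have "y \<noteq> Top" using safe_not_Top that by blast
      then show ?thesis using that A(1) by (cases y) (auto simp: redirect_Bot clash_Bot W_def)
    qed
    have step: "clash D S (Plain q) (Plain r)"
      if "(Plain q, \<alpha>, x) \<in> trans D" "redirect Bot A x = Bot" "(Plain r, \<alpha>, y) \<in> trans S" "safe S (Plain r)"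
      for q r \<alpha> x y
    proof -
      have "clash D S x y"
        using hit[OF that(2)] safe_step[OF that(4,3)] wf_trans_plain(3)[OF wfS that(3)] by blast
      then show ?thesis
        using clash_step[of \<alpha> D S q x r y] that wf_trans_plain(2)[OF wf that(1)] tA by (simp add: moves_in)
    qed
    show "p \<in> W" unfolding W_def
    proof (intro CollectI ballI impI)
      fix r assume r: "r \<in> plains S" "safe S (Plain r)"
      from sp consider "auto_bot (collapse Bot A D) p" | "semi_bot (collapse Bot A D) p"
        unfolding special_bot_def by blast
      then show "clash D S (Plain p) (Plain r)"
      proof cases
        case 1
        then obtain a s where a: "a \<in> outputs D" "(Plain p, Act a, s) \<in> trans D" "redirect Bot A s = Bot"
          unfolding auto_bot_def by (auto simp: collapse_act)
        then obtain y where "(Plain r, Act a, y) \<in> trans S" using spec_input[OF S(1) r(1)] S(2) by auto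
        then show ?thesis using step a r by blast
      next
        case 2
        then obtain d where d: "0 < d" "(Plain p, Delay d, Bot) \<in> trans (collapse Bot A D)"
          unfolding semi_bot_def by blast
        have "passes Bot A D p d"
          using d passes_self[of p d Bot D Bot A] by (auto simp: collapse_delay redirect_Bot split: if_splits)
        then obtain d' x where d': "0 < d'" "(Plain p, Delay d', x) \<in> trans D" "redirect Bot A x = Bot"
          unfolding passes_def by blast
        show ?thesis
        proof (cases "enabled S (Plain r) (Delay d')")
          case True
          then show ?thesis using step d' r unfolding enabled_def by blast
        next
          case False
          then obtain q a s where q: "q \<in> delay_closure S r" "a \<in> outputs S" "(Plain q, Act a, s) \<in> trans S"
            using spec_no_timelock[OF S(1) r(1) d'(1)] by metis
          have inp: "clash D S (Plain p') (Plain q)"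
            if p': "p' \<in> delay_closure (collapse Bot A D) p" "p' \<in> plains D - A" and q': "safe S (Plain q)" for p'
          proof -
            have "Act a \<in> tA D" using q(2) S(3) by (auto simp: actions_def)
            then obtain y where y: "(Plain p', Act a, y) \<in> trans D"
              using completeE[OF complete] p'(2) by blast
            then have "(Plain p', Act a, redirect Bot A y) \<in> trans (collapse Bot A D)"
              using p'(2) by (auto simp: collapse_act)
            then have "redirect Bot A y = Bot"
              using 2 p'(1) q(2) S(3) unfolding semi_bot_def by auto
            then show ?thesis using step[OF y _ q(3) q'] by blast
          qed
          show ?thesis
          proof (cases "q = r")
            case True
            then show ?thesis using inp[of p] p r by (simp add: delay_closure_def)
          next
            case False
            then obtain e where e: "(Plain r, Delay e, Plain q) \<in> trans S"
              using q(1) by (auto simp: delay_closure_def)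
            then have e0: "0 < e" using wf_trans_plain(2)[OF wfS] by fastforce
            have "e < d'"
            proof (rule ccontr)
              assume "\<not> e < d'"
              then obtain m where "(Plain r, Delay d', m) \<in> trans S"
                using spec_delay_prefix[OF tiots d'(1) _ e] by force
              then show False using \<open>\<not> enabled S (Plain r) (Delay d')\<close> by (auto simp: enabled_def)
            qed
            show ?thesis
            proof (cases "passes Bot A D p e")
              case True
              then obtain e' z where e': "0 < e'" "e' \<le> e" "(Plain p, Delay e', z) \<in> trans D" "redirect Bot A z = Bot"
                unfolding passes_def by blast
              obtain m where "(Plain r, Delay e', m) \<in> trans S"
                using spec_delay_prefix[OF tiots e'(1,2) e] .
              then show ?thesis using step e'(3,4) r by blast
            next
              case False
              obtain z where z: "(Plain p, Delay e, z) \<in> trans D"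
                using completeE[OF complete p(1)] e0 by (metis delay_in_tA)
              \<comment> \<open>The collapsed state due at \<open>d'\<close> lies beyond
                \<open>e\<close>, so \<open>p\<close> is in a plain state at time
                \<open>e\<close>.\<close>
              have "passes Bot A D p (e + (d' - e))" using passes_self[OF d'(2,1,3)] by simp
              then obtain p' where p': "z = Plain p'"
                using passes_add[OF e0 _ z False, of "d' - e"] \<open>e < d'\<close> by auto
              have "p' \<in> plains D" using wf_trans_plain(3)[OF wf z] p' by simp
              moreover have "p' \<notin> A"
                using False passes_self[OF z e0, of Bot A] p' by (auto simp: redirect_Bot)
              moreover have "p' \<in> delay_closure (collapse Bot A D) p"
                using z p' False p unfolding delay_closure_def by (auto simp: collapse_delay)
              ultimately have "clash D S (Plain p') (Plain q)" using inp safe_step[OF r(2) e] by blast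
              then show ?thesis
                using clash_step[of "Delay e" D S p z r "Plain q"] e0 z e p' by (simp add: moves_in)
            qed
          qed
        qed
      qed
    qed
  qed
  then show "p \<in> C \<Longrightarrow> r \<in> plains S \<Longrightarrow> safe S (Plain r) \<Longrightarrow> clash D S (Plain p) (Plain r)"
    unfolding W_def by blast
qed

text \<open>Collapsing only brings \<open>Bot\<close> closer: the old run is followed until it
  enters a collapsed state, which is \<open>Bot\<close> now.\<close>

lemma clash_normalI:
  assumes tA: "tA S = tA D"
  shows "clash D S s r \<Longrightarrow> clash (normal D) S (redirect Bot C s) r"
proof (induction rule: clash.induct)
  case (clash_bot s r)
  then show ?case by (auto simp: par_st_eq_Bot clash_Bot redirect_def)
next
  case (clash_step \<alpha> p s q r)
  have al: "\<alpha> \<in> tA D" "\<alpha> \<in> tA S" using clash_step.hyps(1) tA by auto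
  have s: "(Plain p, \<alpha>, s) \<in> trans D" using clash_step.hyps(2) al(1) by (simp add: moves_in)
  show ?case
  proof (cases "p \<in> C")
    case True
    then show ?thesis by (simp add: redirect_def clash_Bot)
  next
    case False
    have p: "p \<in> plains D - C" using False wf_trans_plain(1)[OF wf s] by blast
    have "\<exists>s'. (Plain p, \<alpha>, s') \<in> trans (normal D) \<and> clash (normal D) S s' r"
    proof (cases \<alpha>)
      case (Act a)
      then show ?thesis using p s clash_step.IH by (auto simp: normal_def collapse_act)
    next
      case (Delay d)
      show ?thesis
      proof (cases "passes Bot C D p d")
        case True
        then show ?thesis using p Delay clash_not_Top[OF clash_step.IH]
          by (auto simp: normal_def collapse_delay clash_Bot)
      next
        case False
        then have "redirect Bot C s = s"
          using s passes_self[of p d s D Bot C] Delay al(1) by (auto simp: redirect_def)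
        then show ?thesis using False p s Delay clash_step.IH by (auto simp: normal_def collapse_delay)
      qed
    qed
    then show ?thesis
      using clash.clash_step[of \<alpha> "normal D" S p _ q r] clash_step.hyps(3) al False
      by (auto simp: redirect_def moves_in)
  qed
qed

text \<open>A transition redirected to \<open>Bot\<close> originally led to, or delayed past,
  \<open>Bot\<close> or a collapsed state. There \<open>S\<close> clashes anyway, by
  \<open>clash_collapsible\<close>; in the case of a delay, \<open>S\<close> can be stopped at the
  moment when that state is met.\<close>

lemma clash_normalD:
  assumes S: "is_spec S" "inputs S = outputs D" "outputs S = inputs D"
  shows "clash (normal D) S s r \<Longrightarrow> safe S r \<Longrightarrow> clash D S s r"
proof (induction rule: clash.induct)
  case (clash_bot s r)
  then show ?case by (simp add: clash.clash_bot)
next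
  case (clash_step \<alpha> p s q r)
  have tA: "tA S = tA D" using S(2,3) by (auto simp: tA_def actions_def)
  have al: "\<alpha> \<in> tA D" "\<alpha> \<in> tA S" using clash_step.hyps(1) tA by auto
  have s: "(Plain p, \<alpha>, s) \<in> trans (normal D)" and r: "(Plain q, \<alpha>, r) \<in> trans S"
    using clash_step.hyps(2,3) al by (simp_all add: moves_in)
  have safe: "safe S r" using safe_step[OF clash_step.prems r] .
  have IH: "clash D S s r" using clash_step.IH safe .
  have hit: "clash D S x y" if "redirect Bot C x = Bot" "safe S y" "y \<in> states S" for x y
  proof -
    have "y \<noteq> Top" using safe_not_Top that by blast
    then show ?thesis using that clash_collapsible[OF S] by (cases y) (auto simp: redirect_Bot clash_Bot)
  qed
  have "\<exists>\<beta> x y. (Plain p, \<beta>, x) \<in> trans D \<and> (Plain q, \<beta>, y) \<in> trans S \<and> clash D S x y"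
  proof (cases \<alpha>)
    case (Act a)
    then obtain x where x: "(Plain p, Act a, x) \<in> trans D" "s = redirect Bot C x"
      using s by (auto simp: normal_def collapse_act)
    have "clash D S x r"
      using IH hit[OF _ safe, of x] wf_trans(3)[OF spec_wf[OF S(1)] r] x(2)
      by (cases "s = Bot") (auto simp: redirect_def split: if_splits)
    then show ?thesis using x r Act by blast
  next
    case (Delay d)
    show ?thesis
    proof (cases "passes Bot C D p d")
      case True
      then obtain e x where e: "0 < e" "e \<le> d" "(Plain p, Delay e, x) \<in> trans D" "redirect Bot C x = Bot"
        unfolding passes_def by blast
      obtain y where y: "(Plain q, Delay e, y) \<in> trans S"
        using spec_delay_prefix[OF spec_tiots[OF S(1)] e(1,2)] r Delay by blast
      then have "clash D S x y"
        using hit[OF e(4)] safe_step[OF clash_step.prems] wf_trans(3)[OF spec_wf[OF S(1)]] by blast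
      then show ?thesis using e y by blast
    next
      case False
      then have "(Plain p, \<alpha>, s) \<in> trans D" using s Delay by (simp add: normal_def collapse_delay)
      then show ?thesis using r IH by blast
    qed
  qed
  then obtain \<beta> x y where *: "(Plain p, \<beta>, x) \<in> trans D" "(Plain q, \<beta>, y) \<in> trans S" "clash D S x y"
    by blast
  then show ?case
    using clash.clash_step[of \<beta> D S p x q y] wf_trans_plain(2)[OF wf *(1)] tA by (simp add: moves_in)
qed

lemma clash_normal:
  assumes S: "is_spec S" "inputs S = outputs D" "outputs S = inputs D"
  shows "clash (normal D) S (init (normal D)) (init S) \<longleftrightarrow> clash D S (init D) (init S)"
proof
  have "tA S = tA D" using S(2,3) by (auto simp: tA_def actions_def)
  then show "clash D S (init D) (init S) \<Longrightarrow> clash (normal D) S (init (normal D)) (init S)"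
    using clash_normalI by (simp add: init_normal)
next
  assume *: "clash (normal D) S (init (normal D)) (init S)"
  have safe: "safe S (init S)" using spec_safe_init[OF S(1)] .
  have "init S \<in> states S" using spec_wf[OF S(1)] by (simp add: wf_tiots_def)
  show "clash D S (init D) (init S)"
  proof (cases "\<exists>p\<in>C. init D = Plain p")
    case True
    then show ?thesis
      using clash_collapsible[OF S] safe \<open>init S \<in> states S\<close> safe_not_Top[OF safe]
      by (cases "init S") (auto simp: clash_Bot)
  next
    case False
    then have "init (normal D) = init D" by (auto simp: init_normal redirect_def)
    then show ?thesis using clash_normalD[OF S] * safe by auto
  qed
qed

subsection \<open>The mirror of a normal form is a specification\<close>

text \<open>The conditions on a specification translate one by one. Completeness provides all
  inputs. The mirror could reach \<open>Top\<close> by an input only where the normal form has an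
  \<open>auto_bot\<close> state, while outputs and delays to \<open>Top\<close> are removed. A
  \<open>semi_top\<close> state of the completed mirror would be a \<open>semi_bot\<close> state of
  the normal form. The start in \<open>Bot\<close> is excluded as the mirror would start in
  \<open>Top\<close>.\<close>

lemma spec_mirror_normal:
  assumes i: "init (normal D) \<noteq> Bot"
  shows "is_spec (top_removal (mirror (normal D)))"
proof -
  let ?N = "normal D" and ?A = "mirror (normal D)"
  let ?M = "top_removal ?A"
  have wfA: "wf_tiots ?A" using wf_mirror[OF wf_normal] .
  have wfM: "wf_tiots ?M" using wf_top_removal[OF wfA] .
  have Mtr: "(Plain p, \<alpha>, s) \<in> trans ?M \<longleftrightarrow>
      (Plain p, \<alpha>, dual s) \<in> trans ?N \<and> \<not> (\<alpha> \<in> tO ?A \<and> s = Top)" for p \<alpha> s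
    by (auto simp: top_removal_trans)
  have "time_additive ?M"
    unfolding time_additive_def
  proof (intro allI impI)
    fix s t and d1 d2 :: real assume d: "0 < d1" "0 < d2"
    have ta: "(s, Delay (d1 + d2), t) \<in> trans ?A \<longleftrightarrow>
        (\<exists>m. (s, Delay d1, m) \<in> trans ?A \<and> (m, Delay d2, t) \<in> trans ?A)"
      using time_additive_mirror[OF time_additive_normal] d unfolding time_additive_def by blast
    \<comment> \<open>A delay that does not end in \<open>Top\<close> has not gone through
      \<open>Top\<close> either, so the delays that survive the removal remain additive.\<close>
    have M: "(x, Delay e, y) \<in> trans ?M \<longleftrightarrow> (x, Delay e, y) \<in> trans ?A \<and> (x = Top \<or> y \<noteq> Top)"
      if "0 < e" for x y e
      using that wf_trans_Bot[OF wfA] by (cases x) (auto simp: top_removal_trans)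
    show "(s, Delay (d1 + d2), t) \<in> trans ?M \<longleftrightarrow>
        (\<exists>m. (s, Delay d1, m) \<in> trans ?M \<and> (m, Delay d2, t) \<in> trans ?M)"
      using ta d wf_trans_Top[OF wfA] by (auto simp: M)
  qed
  moreover have "nonzeno ?M"
    by (rule nonzeno_mono[OF nonzeno_normal]) (simp add: Mtr)
  ultimately have "tiots ?M"
    using wfM fin disj by (auto simp: tiots_def wf_tiots_def)
  moreover have "bot_complete ?M"
    unfolding bot_complete_iff
  proof (intro ballI)
    fix p a assume p: "p \<in> plains ?M" and a: "a \<in> inputs ?M"
    then obtain s where "(Plain p, Act a, s) \<in> trans ?N"
      using completeE[OF complete_normal, of p "Act a"] by (auto simp: actions_def)
    moreover have "Act a \<notin> tO ?A" using a disj by auto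
    ultimately have "(Plain p, Act a, dual s) \<in> trans ?M" by (simp add: Mtr)
    then show "enabled ?M (Plain p) (Act a)" by (auto simp: enabled_def)
  qed
  moreover have "\<not> reachable ?M Top"
  proof -
    have step: "t \<noteq> Top" if st: "(s, \<alpha>, t) \<in> trans ?M" "s \<noteq> Top" for s \<alpha> t
    proof
      assume t: "t = Top"
      then obtain p where p: "s = Plain p" using st wf_trans_Bot[OF wfM] by (cases s) auto
      have N: "(Plain p, \<alpha>, Bot) \<in> trans ?N" "\<alpha> \<notin> tO ?A" using st(1) by (auto simp: Mtr p t)
      have "p \<in> plains ?N" "\<alpha> \<in> tA ?N" using wf_trans_plain[OF wf_normal N(1)] by auto
      then obtain a where "\<alpha> = Act a" "a \<in> outputs ?N"
        using N(2) by (cases \<alpha>) (auto simp: actions_def)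
      then have "auto_bot ?N p" using N(1) by (auto simp: auto_bot_def)
      then show False using no_special_normal \<open>p \<in> plains ?N\<close> by blast
    qed
    have "path ?M s w t \<Longrightarrow> s \<noteq> Top \<Longrightarrow> t \<noteq> Top" for s w t
      by (induction rule: path.induct) (auto dest: step)
    moreover have "init ?M \<noteq> Top" using i by simp
    ultimately show ?thesis unfolding reachable_def by blast
  qed
  moreover have "\<not> semi_top (top_completion ?M) p" if p: "p \<in> plains ?M" for p
  proof
    assume st: "semi_top (top_completion ?M) p"
    have cl: "delay_closure (top_completion ?M) p = delay_closure ?N p"
      by (auto simp: delay_closure_def top_completion_trans Mtr)
    obtain d where d: "d > 0" "(Plain p, Delay d, Top) \<in> trans (top_completion ?M)"
      using st by (auto simp: semi_top_def)
    obtain s where s: "(Plain p, Delay d, s) \<in> trans ?N"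
      using completeE[OF complete_normal, of p "Delay d"] p d(1) by auto
    have "s = Bot"
    proof (rule ccontr)
      assume "s \<noteq> Bot"
      then have "(Plain p, Delay d, dual s) \<in> trans ?M" using s by (simp add: Mtr)
      then have "enabled ?M (Plain p) (Delay d)" unfolding enabled_def by blast
      then show False using d by (auto simp: top_completion_trans Mtr)
    qed
    moreover have "x = Bot" if "q \<in> delay_closure ?N p" "a \<in> inputs ?N" "(Plain q, Act a, x) \<in> trans ?N" for q a x
    proof (rule ccontr)
      assume "x \<noteq> Bot"
      then have "(Plain q, Act a, dual x) \<in> trans (top_completion ?M)"
        using that(3) by (simp add: Mtr top_completion_trans)
      then show False using st that(1,2) cl \<open>x \<noteq> Bot\<close> unfolding semi_top_def by fastforce
    qed
    ultimately have "semi_bot ?N p" using s d(1) unfolding semi_bot_def by blast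
    then show False using no_special_normal p by simp
  qed
  ultimately show ?thesis by (simp add: is_spec_def)
qed

lemma no_clash_mirror_normal:
  "\<not> clash (normal D) (top_removal (mirror (normal D))) (init (normal D)) (dual (init (normal D)))"
  using no_clash_mirror[OF functional_normal] by auto

end

section \<open>Non-zenoness\<close>

lemma nonzenoD:
  assumes "nonzeno P" "\<And>n. (Plain (p n), \<alpha> n, Plain (p (Suc n))) \<in> trans P"
    "infinite {n. \<exists>a. \<alpha> n = Act a}" "summable (\<lambda>n. duration (\<alpha> n))"
  shows False
  using assms unfolding nonzeno_def by blast

lemma infinite_shift: "infinite {n. A (n + k)}" if "infinite {n :: nat. A n}"
proof
  assume "finite {n. A (n + k)}"
  then have "finite ((\<lambda>n. n + k) ` {n. A (n + k)} \<union> {..<k})" by simp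
  moreover have "{n. A n} \<subseteq> (\<lambda>n. n + k) ` {n. A (n + k)} \<union> {..<k}"
  proof
    fix n assume "n \<in> {n. A n}"
    then show "n \<in> (\<lambda>n. n + k) ` {n. A (n + k)} \<union> {..<k}"
      by (cases "k \<le> n") (auto simp: image_iff intro!: exI[of _ "n - k"])
  qed
  ultimately show False using that finite_subset by blast
qed

lemma nonzeno_tailD:
  assumes "nonzeno P" "\<And>n. (Plain (p n), \<alpha> (n + k), Plain (p (Suc n))) \<in> trans P"
    "infinite {n. \<exists>a. \<alpha> n = Act a}" "summable (\<lambda>n. duration (\<alpha> n))"
  shows False
proof (rule nonzenoD[of P p "\<lambda>n. \<alpha> (n + k)"])
  show "infinite {n. \<exists>a. \<alpha> (n + k) = Act a}"
    using infinite_shift[OF assms(3)] .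
  show "summable (\<lambda>n. duration (\<alpha> (n + k)))"
    using summable_iff_shift[of "\<lambda>n. duration (\<alpha> n)" k] assms(4) by blast
qed (use assms in auto)

text \<open>A run that has entered the tagged copy of an operand never leaves it, so from time index
  \<open>k\<close> on it is a run of that operand.\<close>

lemma nonzeno_embeddedD:
  assumes "nonzeno P" "inj f"
    and tr: "\<And>p \<alpha> x. (Plain (f p), \<alpha>, x) \<in> trans R \<Longrightarrow> \<exists>s. (Plain p, \<alpha>, s) \<in> trans P \<and> x = map_st f s"
    and st: "\<forall>n. (Plain (z n), \<alpha> n, Plain (z (Suc n))) \<in> trans R" and k: "z k = f p"
    and inf: "infinite {n. \<exists>a. \<alpha> n = Act a}" and sum: "summable (\<lambda>n. duration (\<alpha> n))"
  shows False
proof -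
  have "\<exists>p. z (n + k) = f p" for n
  proof (induction n)
    case (Suc n)
    then obtain p where "z (n + k) = f p" by blast
    then show ?case using st[rule_format, of "n + k"] tr by (fastforce simp: map_st_eq_Plain)
  qed (use k in auto)
  then obtain p where p: "\<And>n. z (n + k) = f (p n)" by metis
  have "(Plain (p n), \<alpha> (n + k), Plain (p (Suc n))) \<in> trans P" for n
  proof -
    have "(Plain (f (p n)), \<alpha> (n + k), Plain (f (p (Suc n)))) \<in> trans R"
      using st[rule_format, of "n + k"] p[of n] p[of "Suc n"] by simp
    then show ?thesis using tr injD[OF assms(2)] by (fastforce simp: map_st_eq_Plain)
  qed
  then show False using nonzeno_tailD[OF assms(1) _ inf sum] by blast
qed

lemma spec_par_trans_single:
  "(Plain (Fst p), \<alpha>, x) \<in> trans (spec_par P Q) \<longleftrightarrow> (\<exists>s. (Plain p, \<alpha>, s) \<in> trans P \<and> x = map_st Fst s)"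
  "(Plain (Snd q), \<alpha>, x) \<in> trans (spec_par P Q) \<longleftrightarrow> (\<exists>s. (Plain q, \<alpha>, s) \<in> trans Q \<and> x = map_st Snd s)"
  by (simp_all add: par_trans prod_step_Fst prod_step_Snd)

text \<open>Since every action of \<open>Q\<close> is one of \<open>P\<close>, the operand
  \<open>P\<close> takes part in each step, and the projection of a run of pairs to \<open>P\<close>
  is a run with the same labels.\<close>

lemma nonzeno_spec_par:
  assumes wf: "wf_tiots P" "wf_tiots Q" and nz: "nonzeno P" "nonzeno Q" and sub: "actions Q \<subseteq> actions P"
  shows "nonzeno (spec_par P Q)"
  unfolding nonzeno_def
proof (rule notI, elim exE conjE)
  fix z \<alpha>
  assume st: "\<forall>n. (Plain (z n), \<alpha> n, Plain (z (Suc n))) \<in> trans (spec_par P Q)"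
    and inf: "infinite {n. \<exists>a. \<alpha> n = Act a}" and sum: "summable (\<lambda>n. duration (\<alpha> n))"
  have tA: "tA Q \<subseteq> tA P" using sub by (auto simp: tA_def)
  show False
  proof (cases "z 0")
    case (Both p q)
    have "\<exists>p q. z n = Both p q" for n
    proof (induction n)
      case (Suc n)
      then show ?case using st spec_par_step[OF wf] by (metis par_st_eq_Plain)
    qed (use Both in auto)
    then obtain p q where pq: "\<And>n. z n = Both (p n) (q n)" by metis
    have "(Plain (p n), \<alpha> n, Plain (p (Suc n))) \<in> trans P" for n
    proof -
      have "(Plain (Both (p n) (q n)), \<alpha> n, Plain (Both (p (Suc n)) (q (Suc n)))) \<in> trans (spec_par P Q)"
        using st pq by metis
      from spec_par_step[OF wf, THEN iffD1, OF this]
      obtain s t where st: "\<alpha> n \<in> tA P \<union> tA Q" "moves P (p n) (\<alpha> n) s"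
          "Plain (Both (p (Suc n)) (q (Suc n))) = par_st s t" by blast
      have "s = Plain (p (Suc n))" using st(3)[symmetric] unfolding par_st_eq_Plain by auto
      then show ?thesis using st(1,2) tA by (auto simp: moves_in)
    qed
    then show False using nonzenoD[OF nz(1) _ inf sum] by blast
  next
    case (Fst p)
    show False by (rule nonzeno_embeddedD[of P Fst _ z, OF nz(1) _ _ st Fst inf sum]) (auto simp: spec_par_trans_single inj_def)
  next
    case (Snd q)
    show False by (rule nonzeno_embeddedD[of Q Snd _ z, OF nz(2) _ _ st Snd inf sum]) (auto simp: spec_par_trans_single inj_def)
  qed
qed

lemma nonzeno_prod_disj:
  assumes wf: "wf_tiots P" "wf_tiots Q" and nz: "nonzeno P" "nonzeno Q" and tA: "tA Q = tA P"
  shows "nonzeno (prod_disj P Q)"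
  unfolding nonzeno_def
proof (rule notI, elim exE conjE)
  fix z \<alpha>
  assume st: "\<forall>n. (Plain (z n), \<alpha> n, Plain (z (Suc n))) \<in> trans (prod_disj P Q)"
    and inf: "infinite {n. \<exists>a. \<alpha> n = Act a}" and sum: "summable (\<lambda>n. duration (\<alpha> n))"
  note tr = prod_disj_trans[OF wf tA]
  consider (Both) "\<forall>n. \<exists>p q. z n = Both p q" | (Fst) k p where "z k = Fst p" | (Snd) k p where "z k = Snd p"
    by (metis pstate.exhaust)
  then show False
  proof cases
    case Both
    then obtain p q where pq: "\<And>n. z n = Both (p n) (q n)" by metis
    have "(Plain (p n), \<alpha> n, Plain (p (Suc n))) \<in> trans P" for n
    proof -
      have "(Plain (Both (p n) (q n)), \<alpha> n, Plain (Both (p (Suc n)) (q (Suc n)))) \<in> trans (prod_disj P Q)"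
        using st pq by metis
      then obtain s t where "(Plain (p n), \<alpha> n, s) \<in> trans P"
          "disj_st s t = Plain (Both (p (Suc n)) (q (Suc n)))"
        using tr(1) by metis
      then show ?thesis by (auto simp: disj_st_eq)
    qed
    then show False using nonzenoD[OF nz(1) _ inf sum] by blast
  next
    case (Fst k p)
    show False by (rule nonzeno_embeddedD[of P Fst _ z, OF nz(1) _ _ st Fst inf sum]) (auto simp: tr inj_def)
  next
    case (Snd k q)
    show False by (rule nonzeno_embeddedD[of Q Snd _ z, OF nz(2) _ _ st Snd inf sum]) (auto simp: tr inj_def)
  qed
qed

section \<open>Durations of words and concatenation of runs\<close>

definition dur :: "'a label list \<Rightarrow> real" where
  "dur w = sum_list (map duration w)"

lemma dur_simps [simp]: "dur [] = 0" "dur (\<alpha> # w) = duration \<alpha> + dur w" "dur (u @ v) = dur u + dur v"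
  by (auto simp: dur_def)

lemma dur_nonneg: "set w \<subseteq> Act ` A \<union> delays \<Longrightarrow> 0 \<le> dur w"
  by (induction w) (auto simp: delays_def)

lemma dur_Act: "set w \<subseteq> Act ` A \<Longrightarrow> dur w = 0"
  by (induction w) auto

lemma dur_0_Act: "set w \<subseteq> Act ` A \<union> delays \<Longrightarrow> dur w = 0 \<Longrightarrow> set w \<subseteq> Act ` A"
proof (induction w)
  case (Cons \<alpha> w)
  then have "0 \<le> dur w" "0 \<le> duration \<alpha>" using dur_nonneg[of w A] by (auto simp: delays_def)
  then have "dur w = 0" "duration \<alpha> = 0" using Cons.prems(2) by auto
  then show ?case using Cons by (auto simp: delays_def)
qed simp

text \<open>A path through plain states that records the transitions taken, so that infinitely many
  finite pieces can be strung together and indexed.\<close>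

fun run :: "('a, 's) tiots \<Rightarrow> 's \<Rightarrow> ('s \<times> 'a label \<times> 's) list \<Rightarrow> 's \<Rightarrow> bool" where
  "run G p [] q \<longleftrightarrow> p = q"
| "run G p ((a, \<alpha>, b) # r) q \<longleftrightarrow> a = p \<and> (Plain a, \<alpha>, Plain b) \<in> trans G \<and> run G b r q"

lemma run_append: "run G p (r @ r') q \<longleftrightarrow> (\<exists>m. run G p r m \<and> run G m r' q)"
  by (induction r arbitrary: p) auto

lemma run_nth:
  "run G p r q \<Longrightarrow> i < length r \<Longrightarrow>
     (Plain (fst (r ! i)), fst (snd (r ! i)), Plain (snd (snd (r ! i)))) \<in> trans G \<and>
     (Suc i < length r \<longrightarrow> fst (r ! Suc i) = snd (snd (r ! i)))"
proof (induction r arbitrary: p i)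
  case (Cons x r)
  obtain a \<alpha> b where x: "x = (a, \<alpha>, b)" by (cases x) auto
  show ?case
  proof (cases i)
    case 0
    then show ?thesis using Cons.prems x by (cases r) auto
  next
    case (Suc j)
    then show ?thesis using Cons.IH[of b j] Cons.prems x by auto
  qed
qed simp

lemma path_run:
  assumes wf: "wf_tiots G"
  shows "path G s w t \<Longrightarrow> s = Plain p \<Longrightarrow> t = Plain q \<Longrightarrow> \<exists>r. map (fst \<circ> snd) r = w \<and> run G p r q"
proof (induction arbitrary: p rule: path.induct)
  case (path_Nil s)
  then show ?case by (intro exI[of _ "[]"]) auto
next
  case (path_Cons s \<alpha> s' w t)
  obtain x where x: "s' = Plain x"
    using path_from_Top[OF wf path_Cons.hyps(2)] path_from_Bot[OF wf path_Cons.hyps(2)] path_Cons.prems(2)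
    by (cases s') auto
  obtain r where "map (fst \<circ> snd) r = w" "run G x r q" using path_Cons.IH x path_Cons.prems by blast
  then show ?case using path_Cons x by (intro exI[of _ "(p, \<alpha>, x) # r"]) auto
qed

text \<open>Non-zenoness for steps that are words. The runs of the words are concatenated to
  prefixes \<open>W n\<close> of a single infinite run, whose durations have bounded partial sums
  and are therefore summable.\<close>

lemma nonzeno_words:
  assumes nz: "nonzeno G" and wf: "wf_tiots G"
    and path: "\<And>n. path G (Plain (p n)) (w n) (Plain (p (Suc n)))" and ne: "\<And>n. w n \<noteq> []"
    and inf: "infinite {n. \<exists>a. Act a \<in> set (w n)}" and bound: "\<And>n. (\<Sum>i<n. dur (w i)) \<le> B"
  shows False
proof -
  have "\<exists>r. map (fst \<circ> snd) r = w n \<and> run G (p n) r (p (Suc n))" for n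
    using path_run[OF wf path] by blast
  then obtain r where r: "\<And>n. map (fst \<circ> snd) (r n) = w n" "\<And>n. run G (p n) (r n) (p (Suc n))" by metis
  define W where "W n = concat (map r [0..<n])" for n
  have WS: "W (Suc n) = W n @ r n" for n by (simp add: W_def)
  have runW: "run G (p 0) (W n) (p n)" for n
  proof (induction n)
    case 0 then show ?case by (simp add: W_def)
  next
    case (Suc n) then show ?case using r(2) by (auto simp: WS run_append)
  qed
  have rne: "r n \<noteq> []" for n using r(1)[of n] ne[of n] by auto
  have len: "n \<le> length (W n)" for n
  proof (induction n)
    case (Suc n)
    have "0 < length (r n)" using rne by simp
    then show ?case using Suc unfolding WS length_append by linarith
  qed simp
  have nth_mono: "W m ! j = W n ! j" if "n \<le> m" "j < length (W n)" for n m j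
    using that
  proof (induction m rule: dec_induct)
    case (step k)
    have "length (W n) \<le> length (W k)" using step.hyps(1)
      by (induction k rule: dec_induct) (auto simp: WS)
    then show ?case using step by (simp add: WS nth_append)
  qed simp
  \<comment> \<open>No word is empty, so \<open>W (Suc j)\<close> has an entry at position
    \<open>j\<close>, and later words do not change it.\<close>
  define tr where "tr j = W (Suc j) ! j" for j
  have tr: "tr j = W n ! j" if "j < length (W n)" for j n
    using that nth_mono[of n "Suc j" j] nth_mono[of "Suc j" n j] len[of "Suc j"]
    by (cases "n \<le> Suc j") (auto simp: tr_def)
  define \<beta> where "\<beta> j = fst (snd (tr j))" for j
  have step: "(Plain (fst (tr j)), \<beta> j, Plain (fst (tr (Suc j)))) \<in> trans G" for j
  proof -
    have l: "j < length (W (Suc (Suc j)))" "Suc j < length (W (Suc (Suc j)))"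
      using len[of "Suc (Suc j)"] by auto
    show ?thesis using run_nth[OF runW l(1)] l unfolding \<beta>_def tr[OF l(1)] tr[OF l(2)] by simp
  qed
  have nonneg: "0 \<le> duration (\<beta> j)" for j
    using wf_trans(2)[OF wf step[of j]] by (cases "\<beta> j") auto
  have durW: "(\<Sum>i<n. dur (w i)) = sum_list (map (\<lambda>x. duration (fst (snd x))) (W n))" for n
  proof (induction n)
    case 0 then show ?case by (simp add: W_def)
  next
    case (Suc n)
    have "dur (w n) = sum_list (map (\<lambda>x. duration (fst (snd x))) (r n))"
      unfolding dur_def r(1)[symmetric] by (simp add: comp_def)
    then show ?case using Suc by (simp add: WS)
  qed
  have part: "(\<Sum>j<n. duration (\<beta> j)) \<le> B" for n
  proof -
    have "(\<Sum>j<n. duration (\<beta> j)) \<le> (\<Sum>j<length (W n). duration (\<beta> j))"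
      using len[of n] nonneg by (intro sum_mono2) auto
    also have "\<dots> = (\<Sum>j<length (W n). duration (fst (snd (W n ! j))))"
      by (intro sum.cong) (auto simp: \<beta>_def tr)
    also have "\<dots> = sum_list (map (\<lambda>x. duration (fst (snd x))) (W n))"
      by (simp add: sum_list_sum_nth atLeast0LessThan)
    also have "\<dots> \<le> B" using durW[of n] bound[of n] by simp
    finally show ?thesis .
  qed
  have "infinite {j. \<exists>a. \<beta> j = Act a}"
    unfolding infinite_nat_iff_unbounded_le
  proof
    fix m
    obtain n a where n: "m \<le> n" "Act a \<in> set (w n)"
      using inf unfolding infinite_nat_iff_unbounded_le by blast
    then obtain i where i: "i < length (w n)" "w n ! i = Act a" by (auto simp: in_set_conv_nth)
    have li: "length (r n) = length (w n)" using r(1)[of n] by (metis length_map)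
    have l: "length (W n) + i < length (W (Suc n))" using i(1) li by (simp add: WS)
    have "\<beta> (length (W n) + i) = fst (snd (r n ! i))" unfolding \<beta>_def tr[OF l] by (simp add: WS)
    also have "\<dots> = w n ! i" using r(1)[of n] i(1) li by (metis comp_apply nth_map)
    finally have "\<beta> (length (W n) + i) = Act a" using i(2) by simp
    moreover have "m \<le> length (W n) + i" using n(1) len[of n] by simp
    ultimately show "\<exists>j\<ge>m. j \<in> {j. \<exists>a. \<beta> j = Act a}" by blast
  qed
  moreover have "summable (\<lambda>j. duration (\<beta> j))"
    using summableI_nonneg_bounded[OF nonneg part] .
  ultimately show False using nonzenoD[of G "\<lambda>j. fst (tr j)" \<beta>, OF nz step] by blast
qed

section \<open>Hiding outputs of an environment\<close>

text \<open>
  Products of specifications have all properties of specifications that matter below, though only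
  in their reachable states; besides, a product may be unable to let time pass although it can do
  so in two steps via \<open>Bot\<close>.
\<close>

locale live =
  fixes G :: "('a, 's) tiots"
  assumes wf: "wf_tiots G" and fin: "finite (inputs G)" "finite (outputs G)"
    and disj: "inputs G \<inter> outputs G = {}"
    and nonzeno: "nonzeno G" and no_Top: "\<not> reachable G Top"
    and input: "\<And>p a. reachable G (Plain p) \<Longrightarrow> a \<in> inputs G \<Longrightarrow> enabled G (Plain p) (Act a)"
    and split: "\<And>p d1 d2 t. reachable G (Plain p) \<Longrightarrow> 0 < d1 \<Longrightarrow> 0 < d2 \<Longrightarrow>
      (Plain p, Delay (d1 + d2), t) \<in> trans G \<Longrightarrow>
      \<exists>m. (Plain p, Delay d1, m) \<in> trans G \<and> (m, Delay d2, t) \<in> trans G"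
    and no_timelock: "\<And>p d. reachable G (Plain p) \<Longrightarrow> 0 < d \<Longrightarrow> \<not> enabled G (Plain p) (Delay d) \<Longrightarrow>
      (\<exists>q\<in>delay_closure G p. \<exists>a\<in>outputs G. enabled G (Plain q) (Act a)) \<or>
      (\<exists>e. 0 < e \<and> e < d \<and> (Plain p, Delay e, Bot) \<in> trans G)"

text \<open>The words that show as one label when the actions in \<open>A\<close> are hidden. Hidden
  actions may precede a visible action but not follow it; those that follow count towards the next
  step. A delay may be interrupted by hidden actions anywhere, so weak delays compose by
  concatenation.\<close>

fun obs :: "'a set \<Rightarrow> 'a label \<Rightarrow> 'a label list \<Rightarrow> bool" where
  "obs A (Act a) w \<longleftrightarrow> (\<exists>u. set u \<subseteq> Act ` A \<and> w = u @ [Act a])"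
| "obs A (Delay d) w \<longleftrightarrow> set w \<subseteq> Act ` A \<union> delays \<and> dur w = d"

lemma obs_single: "\<alpha> \<in> tA G \<Longrightarrow> obs A \<alpha> [\<alpha>]"
  by (cases \<alpha>) (auto simp: delays_def)

lemma obs_Cons: "h \<in> A \<Longrightarrow> obs A \<alpha> w \<Longrightarrow> obs A \<alpha> (Act h # w)"
proof (cases \<alpha>)
  case (Act a)
  assume "h \<in> A" "obs A \<alpha> w"
  then obtain u where "set u \<subseteq> Act ` A" "w = u @ [Act a]" using Act by auto
  then show ?thesis using \<open>h \<in> A\<close> Act by (auto intro!: exI[of _ "Act h # u"])
qed auto

lemma dur_obs: "obs A \<alpha> w \<Longrightarrow> dur w = duration \<alpha>"
  by (cases \<alpha>) (auto simp: dur_Act)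

text \<open>Weak transitions with every output outside \<open>Out\<close> hidden. Only reachable
  states are kept, as the inputs, delays and timelocks of the others are under no control.\<close>

definition hide :: "'a set \<Rightarrow> ('a, 's) tiots \<Rightarrow> ('a, 's) tiots" where
  "hide Out G = \<lparr>inputs = inputs G, outputs = Out, plains = {p. reachable G (Plain p)}, init = init G,
     trans = {(s, \<alpha>, s) | s \<alpha>. s \<in> {Top, Bot} \<and> \<alpha> \<in> Act ` (inputs G \<union> Out) \<union> delays} \<union>
       {(Plain p, \<alpha>, t) | p \<alpha> t. reachable G (Plain p) \<and> \<alpha> \<in> Act ` (inputs G \<union> Out) \<union> delays \<and>
          (\<exists>w. obs (outputs G - Out) \<alpha> w \<and> path G (Plain p) w t)}\<rparr>"

lemma hide_sel [simp]:
  "inputs (hide Out G) = inputs G" "outputs (hide Out G) = Out"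
  "plains (hide Out G) = {p. reachable G (Plain p)}" "init (hide Out G) = init G"
  "actions (hide Out G) = inputs G \<union> Out" "tA (hide Out G) = Act ` (inputs G \<union> Out) \<union> delays"
  by (auto simp: hide_def actions_def tA_def)

lemma hide_trans:
  "(Plain p, \<alpha>, t) \<in> trans (hide Out G) \<longleftrightarrow> reachable G (Plain p) \<and> \<alpha> \<in> tA (hide Out G) \<and>
     (\<exists>w. obs (outputs G - Out) \<alpha> w \<and> path G (Plain p) w t)"
  "(Top, \<alpha>, t) \<in> trans (hide Out G) \<longleftrightarrow> \<alpha> \<in> tA (hide Out G) \<and> t = Top"
  "(Bot, \<alpha>, t) \<in> trans (hide Out G) \<longleftrightarrow> \<alpha> \<in> tA (hide Out G) \<and> t = Bot"
  unfolding hide_sel by (auto simp: hide_def)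

context live
begin

lemma split_state:
  assumes "reachable G s" "0 < d1" "0 < d2" "(s, Delay (d1 + d2), t) \<in> trans G"
  obtains m where "(s, Delay d1, m) \<in> trans G" "(m, Delay d2, t) \<in> trans G"
proof (cases s)
  case (Plain p)
  then show ?thesis using split assms that by blast
qed (use assms that wf_trans_Top[OF wf] wf_trans_Bot[OF wf] in auto)

text \<open>The cut may fall inside a delay, which \<open>split_state\<close> divides. Hidden
  actions that take place exactly at time \<open>d1\<close> go to the first part; as
  \<open>0 < d2\<close>, the word does not end before the cut is found.\<close>

lemma path_split:
  assumes "0 < d2"
  shows "path G s w t \<Longrightarrow> reachable G s \<Longrightarrow> set w \<subseteq> Act ` A \<union> delays \<Longrightarrow> 0 \<le> d1 \<Longrightarrow> dur w = d1 + d2 \<Longrightarrow>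
    \<exists>u v m. path G s u m \<and> path G m v t \<and> set u \<subseteq> Act ` A \<union> delays \<and> set v \<subseteq> Act ` A \<union> delays \<and>
      dur u = d1 \<and> dur v = d2"
proof (induction arbitrary: d1 rule: path.induct)
  case (path_Nil s)
  then show ?case using assms by simp
next
  case (path_Cons s \<alpha> s' w t)
  have rs': "reachable G s'" using reachable_step path_Cons by blast
  have sw: "set w \<subseteq> Act ` A \<union> delays" using path_Cons.prems by simp
  show ?case
  proof (cases "d1 < duration \<alpha>")
    case True
    then obtain e where e: "\<alpha> = Delay e" "d1 < e" using path_Cons.prems(3) by (cases \<alpha>) auto
    show ?thesis
    proof (cases "d1 = 0")
      case True
      then show ?thesis using path_Cons path.path_Cons[OF path_Cons.hyps(1,2)]
        by (intro exI[of _ "[]"] exI[of _ "\<alpha> # w"] exI[of _ s]) auto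
    next
      case False
      then have d1: "0 < d1" "0 < e - d1" using path_Cons.prems(3) e by auto
      obtain m where "(s, Delay d1, m) \<in> trans G" "(m, Delay (e - d1), s') \<in> trans G"
        using split_state[OF path_Cons.prems(1) d1, of s'] path_Cons.hyps(1) e by auto
      then show ?thesis using path_Cons.hyps(2) path_Cons.prems(4) sw e d1
        by (intro exI[of _ "[Delay d1]"] exI[of _ "Delay (e - d1) # w"] exI[of _ m])
          (auto simp: path_Cons_iff delays_def)
    qed
  next
    case False
    then obtain u v m where "path G s' u m" "path G m v t" "set u \<subseteq> Act ` A \<union> delays"
        "set v \<subseteq> Act ` A \<union> delays" "dur u = d1 - duration \<alpha>" "dur v = d2"
      using path_Cons.IH[OF rs' sw, of "d1 - duration \<alpha>"] path_Cons.prems(4) by force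
    then show ?thesis using path_Cons
      by (intro exI[of _ "\<alpha> # u"] exI[of _ v] exI[of _ m]) (auto simp: path_Cons_iff)
  qed
qed

context
  fixes Out assumes Out: "Out \<subseteq> outputs G"
begin

abbreviation "H \<equiv> hide Out G"
abbreviation "hidden \<equiv> outputs G - Out"

lemma hide_reachable:
  assumes "(s, \<alpha>, t) \<in> trans H" "reachable G s"
  shows "reachable G t"
  using assms reachable_path by (cases s) (auto simp: hide_trans)

lemma hide_states: "s \<in> states H \<longleftrightarrow> s = Top \<or> s = Bot \<or> reachable G s"
  by (cases s) auto

lemma wf_hide: "wf_tiots H"
proof -
  have "s \<in> states H \<and> \<alpha> \<in> tA H \<and> t \<in> states H" if st: "(s, \<alpha>, t) \<in> trans H" for s \<alpha> t
  proof (cases s)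
    case (Plain p)
    then have "reachable G s" "\<alpha> \<in> tA H" using st by (auto simp: hide_trans simp del: hide_sel)
    then show ?thesis using hide_reachable[OF st] by (auto simp: hide_states simp del: hide_sel)
  qed (use st in \<open>auto simp: hide_trans simp del: hide_sel\<close>)
  then show ?thesis using reachable_init[of G]
    by (auto simp: wf_tiots_def chaotic_def hide_trans hide_states simp del: hide_sel(6))
qed

lemma hide_additive: "time_additive H"
  unfolding time_additive_def
proof (intro allI impI)
  fix s t and d1 d2 :: real assume d: "0 < d1" "0 < d2"
  then have del: "Delay (d1 + d2) \<in> tA H" "Delay d1 \<in> tA H" "Delay d2 \<in> tA H" by (auto simp: delays_def)
  show "(s, Delay (d1 + d2), t) \<in> trans H \<longleftrightarrow>
      (\<exists>m. (s, Delay d1, m) \<in> trans H \<and> (m, Delay d2, t) \<in> trans H)"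
  proof (cases s)
    case (Plain p)
    show ?thesis
    proof
      assume "(s, Delay (d1 + d2), t) \<in> trans H"
      then obtain w where w: "reachable G s" "set w \<subseteq> Act ` hidden \<union> delays" "dur w = d1 + d2" "path G s w t"
        using Plain by (auto simp: hide_trans)
      obtain u v m where uv: "path G s u m" "path G m v t" "set u \<subseteq> Act ` hidden \<union> delays"
          "set v \<subseteq> Act ` hidden \<union> delays" "dur u = d1" "dur v = d2"
        using path_split[OF d(2) w(4,1,2)] d(1) w(3) by force
      have "(s, Delay d1, m) \<in> trans H" using w(1) uv Plain del by (auto simp: hide_trans simp del: hide_sel)
      moreover have "(m, Delay d2, t) \<in> trans H"
      proof (cases m)
        case (Plain q)
        then show ?thesis using reachable_path[OF w(1) uv(1)] uv del
          by (auto simp: hide_trans simp del: hide_sel)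
      qed (use path_from_Top[OF wf uv(2)] path_from_Bot[OF wf uv(2)] del in
          \<open>auto simp: hide_trans simp del: hide_sel\<close>)
      ultimately show "\<exists>m. (s, Delay d1, m) \<in> trans H \<and> (m, Delay d2, t) \<in> trans H" by blast
    next
      assume "\<exists>m. (s, Delay d1, m) \<in> trans H \<and> (m, Delay d2, t) \<in> trans H"
      then obtain m where m: "(s, Delay d1, m) \<in> trans H" "(m, Delay d2, t) \<in> trans H" by blast
      obtain u where u: "reachable G s" "set u \<subseteq> Act ` hidden \<union> delays" "dur u = d1" "path G s u m"
        using m(1) Plain by (auto simp: hide_trans)
      have "\<exists>v. set v \<subseteq> Act ` hidden \<union> delays \<and> dur v = d2 \<and> path G m v t"
      proof (cases m)
        case (Plain q)
        then show ?thesis using m(2) by (auto simp: hide_trans)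
      qed (use m(2) wf_trans_Top[OF wf] wf_trans_Bot[OF wf] d in
          \<open>auto simp: hide_trans path_Cons_iff delays_def intro!: exI[of _ "[Delay d2]"]\<close>)
      then obtain v where v: "set v \<subseteq> Act ` hidden \<union> delays" "dur v = d2" "path G m v t" by blast
      have "obs hidden (Delay (d1 + d2)) (u @ v)" using u v by simp
      moreover have "path G s (u @ v) t" using path_append u v by blast
      ultimately show "(s, Delay (d1 + d2), t) \<in> trans H"
        using u(1) Plain del unfolding Plain hide_trans by blast
    qed
  qed (use del in \<open>auto simp: hide_trans simp del: hide_sel\<close>)
qed

lemma hide_nonzeno: "nonzeno H"
  unfolding nonzeno_def
proof (rule notI, elim exE conjE)
  fix p \<alpha>
  assume st: "\<forall>n. (Plain (p n), \<alpha> n, Plain (p (Suc n))) \<in> trans H"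
    and inf: "infinite {n. \<exists>a. \<alpha> n = Act a}" and sum: "summable (\<lambda>n. duration (\<alpha> n))"
  have "\<exists>w. obs hidden (\<alpha> n) w \<and> path G (Plain (p n)) w (Plain (p (Suc n)))" for n
    using st unfolding hide_trans by blast
  then obtain w where w: "\<And>n. obs hidden (\<alpha> n) (w n)" "\<And>n. path G (Plain (p n)) (w n) (Plain (p (Suc n)))"
    by metis
  have tA: "\<alpha> n \<in> tA H" for n using st unfolding hide_trans by blast
  have ne: "w n \<noteq> []" for n using w(1)[of n] tA[of n] by (cases "\<alpha> n") (auto simp: delays_def)
  have "{n. \<exists>a. \<alpha> n = Act a} \<subseteq> {n. \<exists>a. Act a \<in> set (w n)}"
  proof
    fix n assume "n \<in> {n. \<exists>a. \<alpha> n = Act a}"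
    then obtain a where "\<alpha> n = Act a" by blast
    then have "Act a \<in> set (w n)" using w(1)[of n] by auto
    then show "n \<in> {n. \<exists>a. Act a \<in> set (w n)}" by blast
  qed
  then have inf': "infinite {n. \<exists>a. Act a \<in> set (w n)}" using inf finite_subset by blast
  have "0 \<le> duration (\<alpha> n)" for n using tA[of n] by (cases "\<alpha> n") (auto simp: delays_def)
  then have "(\<Sum>i<n. dur (w i)) \<le> (\<Sum>i. duration (\<alpha> i))" for n
    using sum_le_suminf[OF sum, of "{..<n}"] dur_obs[OF w(1)] by simp
  then show False using nonzeno_words[OF nonzeno wf w(2) ne inf'] by blast
qed

text \<open>Suppose that \<open>d\<close> cannot pass and no visible output is on offer. Every state
  reached by a hidden run before time \<open>d\<close> is then unable to let the remaining time
  pass, so by \<open>no_timelock\<close> it has an output on offer in time, and this output is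
  hidden. Taking it leads to another such state. By dependent choice infinitely many actions happen
  before time \<open>d\<close>, which non-zenoness forbids.\<close>

lemma hide_no_timelock:
  assumes p: "reachable G (Plain p)" and d: "0 < d" "\<not> enabled H (Plain p) (Delay d)"
  shows "\<exists>q\<in>delay_closure H p. \<exists>a\<in>Out. enabled H (Plain q) (Act a)"
proof (rule ccontr)
  assume no: "\<not> ?thesis"
  \<comment> \<open>\<open>K (x, e)\<close> says that a hidden run from \<open>p\<close> is in
    \<open>x\<close> at time \<open>e\<close>, still before \<open>d\<close>; \<open>T\<close> is
    progress by a run that contains at least one action.\<close>
  define K where "K = (\<lambda>(x, e). e < d \<and>
    (\<exists>w. path G (Plain p) w (Plain x) \<and> set w \<subseteq> Act ` hidden \<union> delays \<and> dur w = e))"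
  define T where "T = (\<lambda>(x, e) (x', e'). \<exists>u a. path G (Plain x) u (Plain x') \<and> Act a \<in> set u \<and> dur u = e' - e)"
  have not_d: "\<not> (path G (Plain p) w t \<and> set w \<subseteq> Act ` hidden \<union> delays \<and> dur w = d)" for w t
    using p d by (auto simp: enabled_def hide_trans delays_def)
  have "\<exists>y. K y \<and> T x y" if Kx: "K x" for x
  proof -
    obtain z e where x: "x = (z, e)" by (cases x)
    then obtain w where w: "e < d" "path G (Plain p) w (Plain z)" "set w \<subseteq> Act ` hidden \<union> delays" "dur w = e"
      using Kx by (auto simp: K_def)
    have z: "reachable G (Plain z)" using reachable_path p w by blast
    have snoc: "path G (Plain p) (w @ u) t \<and> set (w @ u) \<subseteq> Act ` hidden \<union> delays"
      if "path G (Plain z) u t" "set u \<subseteq> Act ` hidden \<union> delays" for u t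
      using path_append[OF w(2) that(1)] that(2) w(3) by simp
    have dead: "\<not> (path G (Plain z) u t \<and> set u \<subseteq> Act ` hidden \<union> delays \<and> dur u = d - e)" for u t
      using snoc[of u t] not_d[of "w @ u" t] w(4) by auto
    have lt: "g < d - e" if g: "(Plain z, Delay g, t) \<in> trans G" for g t
    proof (rule ccontr)
      assume "\<not> g < d - e"
      moreover have "g \<noteq> d - e" using dead[of "[Delay g]" t] g w(1) by (auto simp: path_Cons_iff delays_def)
      ultimately obtain m where "(Plain z, Delay (d - e), m) \<in> trans G"
        using split[OF z, of "d - e" "g - (d - e)" t] g w(1) by auto
      then show False using dead[of "[Delay (d - e)]" m] w(1) by (auto simp: path_Cons_iff delays_def)
    qed
    \<comment> \<open>From \<open>Bot\<close> the missing time could still elapse, giving a weak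
      delay of exactly \<open>d\<close>.\<close>
    have noBot: "\<not> (path G (Plain z) u Bot \<and> set u \<subseteq> Act ` hidden \<union> delays \<and> dur u < d - e)" for u
    proof
      assume u: "path G (Plain z) u Bot \<and> set u \<subseteq> Act ` hidden \<union> delays \<and> dur u < d - e"
      then have "path G (Plain z) (u @ [Delay (d - e - dur u)]) Bot"
        using wf_trans_Bot[OF wf] by (intro path_append) (auto simp: path_Cons_iff)
      then show False using dead[of "u @ [Delay (d - e - dur u)]" Bot] u by (auto simp: delays_def)
    qed
    have "\<not> enabled G (Plain z) (Delay (d - e))" using lt by (auto simp: enabled_def)
    then consider (out) q a s where "q \<in> delay_closure G z" "a \<in> outputs G" "(Plain q, Act a, s) \<in> trans G"
      | (Bot) g where "0 < g" "g < d - e" "(Plain z, Delay g, Bot) \<in> trans G"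
      using no_timelock[OF z, of "d - e"] w(1) by (auto simp: enabled_def)
    then show ?thesis
    proof cases
      case Bot
      then show ?thesis using noBot[of "[Delay g]"] by (auto simp: path_Cons_iff delays_def)
    next
      case out
      obtain u where u: "path G (Plain z) u (Plain q)" "set u \<subseteq> delays" "dur u < d - e"
      proof (cases "q = z")
        case True
        then show ?thesis using that[of "[]"] w(1) by simp
      next
        case False
        then obtain g where g: "(Plain z, Delay g, Plain q) \<in> trans G"
          using out(1) by (auto simp: delay_closure_def)
        then have "0 < g" using wf_trans_plain(2)[OF wf] by fastforce
        then show ?thesis using that[of "[Delay g]"] g lt[OF g] by (auto simp: path_Cons_iff delays_def)
      qed
      have pq: "path G (Plain p) (w @ u) (Plain q)" "set (w @ u) \<subseteq> Act ` hidden \<union> delays"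
        using snoc[OF u(1)] u(2) by auto
      have q: "reachable G (Plain q)" using reachable_path[OF p pq(1)] .
      have "a \<notin> Out"
      proof
        assume a: "a \<in> Out"
        show False
        \<comment> \<open>If no time has passed, the hidden actions belong to the weak step
          \<open>a\<close> of \<open>p\<close> itself. Otherwise they are part of a weak delay from
          \<open>p\<close> to \<open>q\<close>, and \<open>a\<close> is on offer there.\<close>
        proof (cases "dur (w @ u) = 0")
          case True
          then have "set (w @ u) \<subseteq> Act ` hidden" using dur_0_Act[OF pq(2)] by blast
          then have "obs hidden (Act a) ((w @ u) @ [Act a])" by fastforce
          moreover have "path G (Plain p) ((w @ u) @ [Act a]) s"
            using path_append[OF pq(1)] out(3) by (simp add: path_Cons_iff)
          ultimately have "(Plain p, Act a, s) \<in> trans H"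
            using p a unfolding hide_trans by (auto simp del: obs.simps)
          then show False using no a by (auto simp: delay_closure_def enabled_def)
        next
          case False
          then have "0 < dur (w @ u)" using dur_nonneg[OF pq(2)] by linarith
          then have "Delay (dur (w @ u)) \<in> tA H" "obs hidden (Delay (dur (w @ u))) (w @ u)"
            using pq(2) by (auto simp: delays_def)
          then have "(Plain p, Delay (dur (w @ u)), Plain q) \<in> trans H"
            using pq(1) p unfolding hide_trans by blast
          moreover have "path G (Plain q) [Act a] s" "obs hidden (Act a) [Act a]" "Act a \<in> tA H"
            using a out(3) by (auto simp: path_Cons_iff)
          then have "(Plain q, Act a, s) \<in> trans H" using q unfolding hide_trans by blast
          ultimately show False using no a unfolding delay_closure_def enabled_def by blast
        qed
      qed
      then have a: "a \<in> hidden" using out(2) by blast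
      have zs: "path G (Plain z) (u @ [Act a]) s" "set (u @ [Act a]) \<subseteq> Act ` hidden \<union> delays"
        using path_append[OF u(1)] out(3) u(2) a by (auto simp: path_Cons_iff)
      have "reachable G s" using reachable_step[OF q out(3)] .
      then obtain y where y: "s = Plain y"
        using no_Top noBot[of "u @ [Act a]"] zs u(3) by (cases s) auto
      have "K (y, e + dur u)"
        using snoc[OF zs] u(3) y w(4) by (auto simp: K_def intro!: exI[of _ "w @ u @ [Act a]"])
      moreover have "T x (y, e + dur u)"
        using zs(1) y by (auto simp: T_def x intro!: exI[of _ "u @ [Act a]"])
      ultimately show ?thesis by blast
    qed
  qed
  moreover have "K (p, 0)" using d(1) by (auto simp: K_def intro!: exI[of _ "[]"])
  ultimately obtain f where f: "\<And>n. K (f n)" "\<And>n. T (f n) (f (Suc n))"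
    using dependent_nat_choice[of "\<lambda>_. K" "\<lambda>_. T"] by blast
  have "\<exists>u. path G (Plain (fst (f n))) u (Plain (fst (f (Suc n)))) \<and> (\<exists>a. Act a \<in> set u) \<and>
      dur u = snd (f (Suc n)) - snd (f n)" for n
    using f(2)[of n] by (auto simp: T_def split: prod.splits)
  then obtain u where u: "\<And>n. path G (Plain (fst (f n))) (u n) (Plain (fst (f (Suc n))))"
      "\<And>n. \<exists>a. Act a \<in> set (u n)" "\<And>n. dur (u n) = snd (f (Suc n)) - snd (f n)"
    by metis
  have "(\<Sum>i<n. dur (u i)) = snd (f n) - snd (f 0)" for n
    by (induction n) (auto simp: u(3))
  moreover have "snd (f n) \<le> d" "0 \<le> snd (f n)" for n
    using f(1)[of n] dur_nonneg by (auto simp: K_def split: prod.splits)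
  ultimately have "(\<Sum>i<n. dur (u i)) \<le> d" for n using add_mono[of "snd (f n)" d 0 "snd (f 0)"] by simp
  moreover have "u n \<noteq> []" for n using u(2)[of n] by auto
  ultimately show False using nonzeno_words[of G "\<lambda>n. fst (f n)" u d, OF nonzeno wf u(1)] u(2) by simp
qed

lemma hide_spec: "is_spec H"
proof -
  have "\<not> reachable H Top"
  proof -
    have "path H s w t \<Longrightarrow> reachable G s \<Longrightarrow> reachable G t" for s w t
      by (induction rule: path.induct) (auto dest: hide_reachable)
    then show ?thesis using no_Top reachable_init[of G] unfolding reachable_def[of H] by auto
  qed
  moreover have "tiots H"
    using wf_hide hide_additive hide_nonzeno fin disj Out finite_subset[OF Out]
    by (auto simp: tiots_def wf_tiots_def simp del: hide_sel(6))
  moreover have "bot_complete H"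
    unfolding bot_complete_iff
  proof (intro ballI)
    fix p a assume p: "p \<in> plains H" and a: "a \<in> inputs H"
    then obtain s where "(Plain p, Act a, s) \<in> trans G" using input[of p a] by (auto simp: enabled_def)
    then have "path G (Plain p) [Act a] s" "obs hidden (Act a) [Act a]" "Act a \<in> tA H"
        "reachable G (Plain p)"
      using a p by (auto simp: path_Cons_iff)
    then have "(Plain p, Act a, s) \<in> trans H" using p unfolding hide_trans by blast
    then show "enabled H (Plain p) (Act a)" by (auto simp: enabled_def)
  qed
  moreover have "\<not> semi_top (top_completion H) p" if p: "p \<in> plains H" for p
  proof
    assume st: "semi_top (top_completion H) p"
    then obtain d where d: "0 < d" "(Plain p, Delay d, Top) \<in> trans (top_completion H)"
      by (auto simp: semi_top_def)
    have rp: "reachable G (Plain p)" using p by simp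
    have "(Plain p, Delay d, Top) \<notin> trans H" using hide_reachable rp no_Top by blast
    then have "\<not> enabled H (Plain p) (Delay d)" using d by (auto simp: top_completion_trans)
    then obtain q a s where q: "q \<in> delay_closure H p" "a \<in> Out" "(Plain q, Act a, s) \<in> trans H"
      using hide_no_timelock[OF rp d(1)] by (auto simp: enabled_def)
    have "s \<noteq> Top" using hide_reachable[OF q(3)] q(3) no_Top by (auto simp: hide_trans)
    moreover have "q \<in> delay_closure (top_completion H) p"
      using q(1) by (auto simp: delay_closure_def top_completion_trans)
    ultimately show False using st q unfolding semi_top_def by (auto simp: top_completion_trans)
  qed
  ultimately show ?thesis by (simp add: is_spec_def)
qed

context
  fixes P :: "('a, 'p) tiots" assumes P: "is_spec P" "inputs P = Out" "outputs P = inputs G"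
begin

lemma hide_tA: "tA H = tA P" "tA P \<subseteq> tA G" "\<alpha> \<in> tA G - tA P \<Longrightarrow> \<exists>h\<in>hidden. \<alpha> = Act h"
  "h \<in> hidden \<Longrightarrow> Act h \<notin> tA P \<and> Act h \<in> tA G"
  using P Out disj by (auto simp: tA_def actions_def delays_def)

text \<open>A word of hidden actions and delays is replayed step by step: \<open>P\<close> stays put
  during hidden actions, which are foreign to it, and splits its own delay along the delays of the
  word. The case distinction is due to the lack of transitions with delay 0.\<close>

lemma clash_absorb:
  "path G x w t \<Longrightarrow> set w \<subseteq> Act ` hidden \<union> delays \<Longrightarrow>
     (if dur w = 0 then s0 = s else (s0, Delay (dur w), s) \<in> trans P) \<Longrightarrow> clash P G s t \<Longrightarrow>
     s0 \<in> states P \<Longrightarrow> clash P G s0 x"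
proof (induction arbitrary: s0 rule: path.induct)
  case (path_Nil x)
  then show ?case by simp
next
  case (path_Cons x \<alpha> x' w t)
  have wfP: "wf_tiots P" using spec_wf[OF P(1)] .
  have ends: "t \<noteq> Top" "s \<noteq> Top" using clash_not_Top[OF path_Cons.prems(3)] by auto
  have x: "x \<noteq> Top"
    using path_from_Top[OF wf path.path_Cons[OF path_Cons.hyps(1,2)]] ends by blast
  have s0: "s0 \<noteq> Top"
    using path_Cons.prems(2) ends wf_trans_Top[OF wfP] by (auto split: if_splits)
  show ?case
  proof (cases "s0 = Bot \<or> x = Bot")
    case True
    then show ?thesis using x s0 by (auto simp: clash_Bot)
  next
    case False
    then obtain p q where pq: "s0 = Plain p" "x = Plain q" using x s0 by (cases s0; cases x) auto
    have sw: "set w \<subseteq> Act ` hidden \<union> delays" using path_Cons.prems(1) by simp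
    show ?thesis
    proof (cases \<alpha>)
      case (Act h)
      then have h: "h \<in> hidden" using path_Cons.prems(1) by (auto simp: delays_def)
      have "clash P G s0 x'" using path_Cons.IH[OF sw _ path_Cons.prems(3,4)] path_Cons.prems(2)
        unfolding Act dur_simps duration.simps add_0 by blast
      moreover have "moves P p \<alpha> s0" "moves G q \<alpha> x'" "\<alpha> \<in> tA G"
        using hide_tA(4)[OF h] path_Cons.prems(4) path_Cons.hyps(1) Act pq by (auto simp: moves_def)
      ultimately show ?thesis using clash.clash_step[of \<alpha> P G p s0 q x'] pq by simp
    next
      case (Delay e)
      then have e: "0 < e" using path_Cons.prems(1) by (auto simp: delays_def)
      then have "dur (\<alpha> # w) \<noteq> 0" using dur_nonneg[OF sw] Delay by simp
      then have s: "(s0, Delay (e + dur w), s) \<in> trans P" using path_Cons.prems(2) Delay by simp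
      have "\<exists>m. (s0, Delay e, m) \<in> trans P \<and> (if dur w = 0 then m = s else (m, Delay (dur w), s) \<in> trans P)"
      proof (cases "dur w = 0")
        case False
        then have "0 < dur w" using dur_nonneg[OF sw] by linarith
        then show ?thesis using spec_delay_split[OF spec_tiots[OF P(1)] e _ s] False by auto
      qed (use s in auto)
      then obtain m where m: "(s0, Delay e, m) \<in> trans P"
          "if dur w = 0 then m = s else (m, Delay (dur w), s) \<in> trans P" by blast
      have "clash P G m x'"
        using path_Cons.IH[OF sw m(2) path_Cons.prems(3)] wf_trans(3)[OF wfP m(1)] by blast
      then show ?thesis
        using clash.clash_step[of \<alpha> P G p m q x'] m(1) path_Cons.hyps(1) pq Delay e by (simp add: moves_def)
    qed
  qed
qed

lemma clash_hideD: "clash P H s t \<Longrightarrow> clash P G s t"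
proof (induction rule: clash.induct)
  case (clash_bot s t)
  then show ?case by (rule clash.clash_bot)
next
  case (clash_step \<alpha> p s q t)
  have wfP: "wf_tiots P" using spec_wf[OF P(1)] .
  have al: "\<alpha> \<in> tA P" "\<alpha> \<in> tA G" using clash_step.hyps(1) hide_tA(1,2) by auto
  have s: "(Plain p, \<alpha>, s) \<in> trans P" using clash_step.hyps(2) al by (simp add: moves_in)
  have p: "Plain p \<in> states P" using wf_trans_plain(1)[OF wfP s] by simp
  have "(Plain q, \<alpha>, t) \<in> trans H" using clash_step.hyps(3) al hide_tA(1) by (simp add: moves_def del: hide_sel)
  then obtain w where w: "obs hidden \<alpha> w" "path G (Plain q) w t" by (auto simp: hide_trans)
  show ?case
  proof (cases \<alpha>)
    case (Delay d)
    then have "0 < d" "set w \<subseteq> Act ` hidden \<union> delays" "dur w = d" using w(1) al by auto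
    then show ?thesis using clash_absorb[OF w(2) _ _ clash_step.IH p] s Delay by simp
  next
    case (Act a)
    then obtain u where u: "set u \<subseteq> Act ` hidden" "w = u @ [Act a]" using w(1) by auto
    obtain m where m: "path G (Plain q) u m" "path G m [Act a] t" using w(2) u(2) by (auto elim: path_appendE)
    have mt: "(m, \<alpha>, t) \<in> trans G" using m(2) Act by (simp add: path_Cons_iff)
    have "clash P G (Plain p) m"
    proof (cases m)
      case Top
      then show ?thesis using mt wf_trans_Top[OF wf] clash_not_Top[OF clash_step.IH] by auto
    next
      case Bot
      then show ?thesis by (simp add: clash_Bot)
    next
      case (Plain y)
      then show ?thesis using clash.clash_step[of \<alpha> P G p s y t] mt s al clash_step.IH by (simp add: moves_in)
    qed
    then show ?thesis using clash_absorb[OF m(1) _ _ _ p] u(1) dur_Act[OF u(1)] by auto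
  qed
qed

text \<open>A hidden action has no transition of its own in the hidden system; it needs a later step
  of \<open>P\<close> into which it can be absorbed.\<close>

lemma spec_not_stuck:
  assumes "p \<in> plains P"
  obtains \<alpha> s where "\<alpha> \<in> tA P" "(Plain p, \<alpha>, s) \<in> trans P"
proof (cases "enabled P (Plain p) (Delay 1)")
  case True
  then obtain s where s: "(Plain p, Delay 1, s) \<in> trans P" by (auto simp: enabled_def)
  then show ?thesis using that wf_trans_plain(2)[OF spec_wf[OF P(1)] s] by blast
next
  case False
  then obtain q a s where q: "q \<in> delay_closure P p" "a \<in> outputs P" "(Plain q, Act a, s) \<in> trans P"
    using spec_no_timelock[OF P(1) assms zero_less_one] by metis
  then show ?thesis using that wf_trans_plain(2)[OF spec_wf[OF P(1)]]
    by (auto simp: delay_closure_def)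
qed

text \<open>A hidden action in the joint run is prefixed to the weak step that comes next.\<close>

lemma clash_hideI: "clash P G s t \<Longrightarrow> safe P s \<Longrightarrow> reachable G t \<Longrightarrow> clash P H s t"
proof (induction rule: clash.induct)
  case (clash_bot s t)
  then show ?case by (blast intro: clash.clash_bot)
next
  case (clash_step \<alpha> p s q t)
  have HI: "(Plain q, \<beta>, y) \<in> trans H" if "\<beta> \<in> tA P" "obs hidden \<beta> w" "path G (Plain q) w y" for \<beta> w y
    using that clash_step.prems(2) hide_tA(1) unfolding hide_trans by blast
  show ?case
  proof (cases "\<alpha> \<in> tA P")
    case True
    then have st: "(Plain p, \<alpha>, s) \<in> trans P" "(Plain q, \<alpha>, t) \<in> trans G"
      using clash_step.hyps(2,3) hide_tA(2) by (auto simp: moves_in)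
    then have "clash P H s t"
      using clash_step.IH safe_step[OF clash_step.prems(1)] reachable_step[OF clash_step.prems(2)] by blast
    moreover have "(Plain q, \<alpha>, t) \<in> trans H"
      using HI[OF True obs_single[OF True]] st(2) by (simp add: path_Cons_iff)
    ultimately show ?thesis
      using clash.clash_step[of \<alpha> P H p s q t] st(1) True hide_tA(1) by (simp add: moves_def del: hide_sel)
  next
    case False
    then obtain h where h: "h \<in> hidden" "\<alpha> = Act h" using clash_step.hyps(1) hide_tA(3) by blast
    have s: "s = Plain p" "p \<in> plains P" using clash_step.hyps(2) False by (auto simp: moves_not_in)
    have t: "(Plain q, Act h, t) \<in> trans G" using clash_step.hyps(3) hide_tA(4)[OF h(1)] h(2) by (simp add: moves_in)
    have IH: "clash P H (Plain p) t"
      using clash_step.IH clash_step.prems s reachable_step t by blast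
    have "\<exists>\<beta> s' w t'. \<beta> \<in> tA P \<and> (Plain p, \<beta>, s') \<in> trans P \<and> obs hidden \<beta> w \<and> path G t w t' \<and> clash P H s' t'"
    proof (cases t)
      case Top
      then show ?thesis using IH by simp
    next
      \<comment> \<open>The run ends with the hidden action. Any step of \<open>P\<close> prolongs
        it, as \<open>Bot\<close> has loops for all labels and \<open>P\<close>, being safe, does
        not move to \<open>Top\<close>.\<close>
      case Bot
      obtain \<beta> s' where b: "\<beta> \<in> tA P" "(Plain p, \<beta>, s') \<in> trans P" using spec_not_stuck[OF s(2)] .
      then have "s' \<noteq> Top" using safe_step[OF clash_step.prems(1)] safe_not_Top by blast
      moreover have "path G t [\<beta>] Bot" using Bot wf_trans_Bot[OF wf] b(1) hide_tA(2) by (auto simp: path_Cons_iff)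
      ultimately show ?thesis using b obs_single[OF b(1)] clash_Bot by blast
    next
      case (Plain y)
      from IH[unfolded Plain] show ?thesis
      proof cases
        case clash_bot
        then show ?thesis by simp
      next
        case (clash_step \<beta> s' t')
        then have "\<beta> \<in> tA P" "(Plain p, \<beta>, s') \<in> trans P" "(Plain y, \<beta>, t') \<in> trans H"
          using hide_tA(1) by (auto simp: moves_def simp del: hide_sel)
        then show ?thesis using clash_step(4) Plain unfolding hide_trans by blast
      qed
    qed
    then obtain \<beta> s' w t' where *: "\<beta> \<in> tA P" "(Plain p, \<beta>, s') \<in> trans P" "obs hidden \<beta> w"
        "path G t w t'" "clash P H s' t'" by blast
    have "(Plain q, \<beta>, t') \<in> trans H"
      using HI[OF *(1) obs_Cons[OF h(1) *(3)]] t *(4) path.path_Cons by blast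
    then show ?thesis
      using clash.clash_step[of \<beta> P H p s' q t'] * hide_tA(1) by (simp add: moves_def del: hide_sel)
  qed
qed

lemma clash_hide: "clash P H (init P) (init G) \<longleftrightarrow> clash P G (init P) (init G)"
  using clash_hideD clash_hideI spec_safe_init[OF P(1)] reachable_init by blast

end

end

end

section \<open>Parallel composition\<close>

text \<open>Delays including 0, for which there are no transitions.\<close>

definition waits :: "('a, 's) tiots \<Rightarrow> 's \<Rightarrow> real \<Rightarrow> 's st \<Rightarrow> bool" where
  "waits P p e s \<longleftrightarrow> (if e = 0 then s = Plain p else (Plain p, Delay e, s) \<in> trans P)"

text \<open>The output provided by \<open>spec_no_timelock\<close> comes strictly before
  \<open>d\<close>: if its state were reached at \<open>d\<close> or later, time additivity would
  let \<open>d\<close> pass.\<close>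

lemma spec_stop:
  assumes P: "is_spec P" "p \<in> plains P" and d: "0 < d" "\<not> enabled P (Plain p) (Delay d)"
  obtains e q b s where "0 \<le> e" "e < d" "waits P p e (Plain q)" "b \<in> outputs P" "(Plain q, Act b, s) \<in> trans P"
proof -
  obtain q b s where q: "q \<in> delay_closure P p" "b \<in> outputs P" "(Plain q, Act b, s) \<in> trans P"
    using spec_no_timelock[OF P d] by metis
  show ?thesis
  proof (cases "q = p")
    case True
    then show ?thesis using that[of 0 p b s] q d by (simp add: waits_def)
  next
    case False
    then obtain e where e: "(Plain p, Delay e, Plain q) \<in> trans P" using q(1) by (auto simp: delay_closure_def)
    then have e0: "0 < e" using wf_trans_plain(2)[OF spec_wf[OF P(1)]] by fastforce
    have "e < d"
    proof (rule ccontr)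
      assume "\<not> e < d"
      then obtain m where "(Plain p, Delay d, m) \<in> trans P"
        using spec_delay_prefix[OF spec_tiots[OF P(1)] d(1) _ e] by force
      then show False using d(2) by (auto simp: enabled_def)
    qed
    then show ?thesis using that[of e q b s] q e e0 by (simp add: waits_def)
  qed
qed

lemma spec_moves:
  assumes "is_spec P" "p \<in> plains P" "b \<notin> outputs P"
  shows "\<exists>s. moves P p (Act b) s"
  using spec_input[OF assms(1,2), of b] assms(2,3) by (auto simp: moves_def actions_def)

text \<open>If \<open>X\<close> stops time, it has an output at some \<open>e\<close> before
  \<open>d\<close>. When \<open>Y\<close> can wait for \<open>e\<close>, it accepts this output or
  ignores it as foreign, since the outputs are disjoint. When it cannot, \<open>Y\<close> itself has
  an output at a time \<open>e'\<close> before \<open>e\<close>; then \<open>X\<close> can wait for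
  \<open>e'\<close>, and the roles are exchanged.\<close>

lemma par_stop:
  assumes X: "is_spec X" "x \<in> plains X" and Y: "is_spec Y" "y \<in> plains Y" "safe Y (Plain y)"
    and disj: "outputs X \<inter> outputs Y = {}" and d: "0 < d" "\<not> enabled X (Plain x) (Delay d)"
  shows "\<exists>e x'. 0 \<le> e \<and> e < d \<and> waits X x e (Plain x') \<and>
    (waits Y y e Bot \<or> (\<exists>y' b s t. waits Y y e (Plain y') \<and> b \<in> outputs X \<union> outputs Y \<and>
       moves X x' (Act b) s \<and> moves Y y' (Act b) t))"
proof -
  have stX: "s \<in> states X" if "waits X x e s" for e s
    using that X(2) wf_trans_plain(3)[OF spec_wf[OF X(1)]] by (auto simp: waits_def split: if_splits)
  have stY: "s \<in> states Y" if "waits Y y e s" for e s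
    using that Y(2) wf_trans_plain(3)[OF spec_wf[OF Y(1)]] by (auto simp: waits_def split: if_splits)
  have mv: "moves P p (Act b) s" if "b \<in> outputs P" "(Plain p, Act b, s) \<in> trans P"
    for P :: "('x, 'y) tiots" and p b s using that by (simp add: moves_def actions_def)
  obtain e x' b s where e: "0 \<le> e" "e < d" "waits X x e (Plain x')" "b \<in> outputs X" "(Plain x', Act b, s) \<in> trans X"
    using spec_stop[OF X d] .
  show ?thesis
  proof (cases "\<exists>t. waits Y y e t")
    case True
    then obtain t where t: "waits Y y e t" by blast
    show ?thesis
    proof (cases t)
      case Top
      then have "(Plain y, Delay e, Top) \<in> trans Y" using t by (auto simp: waits_def split: if_splits)
      then show ?thesis using safe_not_Top[OF safe_step[OF Y(3)]] by blast
    next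
      case Bot
      then show ?thesis using t e by blast
    next
      case (Plain y')
      have "\<exists>t. moves Y y' (Act b) t" using spec_moves[OF Y(1)] stY[OF t] Plain e(4) disj by auto
      then show ?thesis using t Plain e mv[OF e(4,5)] by blast
    qed
  next
    case False
    then have "e \<noteq> 0" by (auto simp: waits_def)
    then have e0: "0 < e" "\<not> enabled Y (Plain y) (Delay e)" using False e(1) by (auto simp: waits_def enabled_def)
    obtain e' y' b' t where e': "0 \<le> e'" "e' < e" "waits Y y e' (Plain y')" "b' \<in> outputs Y" "(Plain y', Act b', t) \<in> trans Y"
      using spec_stop[OF Y(1,2) e0] .
    obtain m where m: "waits X x e' (Plain m)"
    proof (cases "e' = 0")
      case True
      then show ?thesis using that by (simp add: waits_def)
    next
      \<comment> \<open>On its way to the plain state \<open>x'\<close> at time \<open>e\<close>,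
        \<open>X\<close> is in a plain state at time \<open>e'\<close>, because \<open>Top\<close>
        and \<open>Bot\<close> cannot be left.\<close>
      case False
      have "(Plain x, Delay (e' + (e - e')), Plain x') \<in> trans X" using e(3) e0 by (simp add: waits_def)
      then obtain m where m: "(Plain x, Delay e', m) \<in> trans X" "(m, Delay (e - e'), Plain x') \<in> trans X"
        using spec_delay_split[OF spec_tiots[OF X(1)], of e' "e - e'"] False e' by force
      then show ?thesis
        using that[of "case m of Plain q \<Rightarrow> q"] False wf_trans_Top[OF spec_wf[OF X(1)]] wf_trans_Bot[OF spec_wf[OF X(1)]]
        by (cases m) (auto simp: waits_def)
    qed
    have "\<exists>s. moves X m (Act b') s" using spec_moves[OF X(1)] stX[OF m] e'(4) disj by auto
    then show ?thesis using e e' m mv[OF e'(4,5)]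
      by (intro exI[of _ e'] exI[of _ m]) (auto 4 4)
  qed
qed

text \<open>This makes the invariants of the operands available in the product and rules out the
  tagged copies.\<close>

lemma reachable_spec_par:
  assumes P: "is_spec P" and Q: "is_spec Q" and r: "reachable (spec_par P Q) x"
  shows "\<exists>s t. x = par_st s t \<and> reachable P s \<and> reachable Q t"
proof -
  note wf = spec_wf[OF P] spec_wf[OF Q]
  have no_Top: "\<not> reachable P Top" "\<not> reachable Q Top" using P Q by (auto simp: is_spec_def)
  have "path (spec_par P Q) x w y \<Longrightarrow> x = par_st s t \<Longrightarrow> reachable P s \<Longrightarrow> reachable Q t \<Longrightarrow>
      \<exists>s t. y = par_st s t \<and> reachable P s \<and> reachable Q t" for x w y s t
  proof (induction arbitrary: s t rule: path.induct)
    case (path_Nil x)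
    then show ?case by blast
  next
    case (path_Cons x \<alpha> x' w y)
    have "\<exists>s t. x' = par_st s t \<and> reachable P s \<and> reachable Q t"
    proof (cases x)
      case Top
      then show ?thesis using path_Cons.prems no_Top par_st_eq_Top by metis
    next
      case Bot
      then have "x' = Bot" using path_Cons.hyps(1) wf_trans_Bot[OF wf_spec_par[OF wf]] by blast
      then show ?thesis using Bot path_Cons.prems by blast
    next
      case (Plain z)
      then obtain p q where pq: "s = Plain p" "t = Plain q" "z = Both p q"
        using path_Cons.prems(1) by (metis par_st_eq_Plain)
      then obtain s' t' where st: "moves P p \<alpha> s'" "moves Q q \<alpha> t'" "x' = par_st s' t'"
        using path_Cons.hyps(1) Plain spec_par_step[OF wf] by blast
      have "reachable P s'" "reachable Q t'"
        using st(1,2) path_Cons.prems(2,3) reachable_step pq by (auto simp: moves_def split: if_splits)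
      then show ?thesis using st(3) by blast
    qed
    then show ?case using path_Cons.IH by blast
  qed
  moreover obtain w where "path (spec_par P Q) (par_st (init P) (init Q)) w x"
    using r by (auto simp: reachable_def spec_par_sel)
  ultimately show ?thesis using reachable_init[of P] reachable_init[of Q] by blast
qed

lemma reachable_safe: "is_spec P \<Longrightarrow> reachable P s \<Longrightarrow> safe P s"
  using reachable_path by (auto simp: is_spec_def safe_def)

lemma live_spec_par:
  assumes P: "is_spec P" and Q: "is_spec Q" and disj: "outputs P \<inter> outputs Q = {}"
    and sub: "actions Q \<subseteq> actions P"
  shows "live (spec_par P Q)"
proof
  let ?G = "spec_par P Q"
  note wf = spec_wf[OF P] spec_wf[OF Q]
  have no_Top: "\<not> reachable P Top" "\<not> reachable Q Top" using P Q by (auto simp: is_spec_def)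
  show "wf_tiots ?G" using wf_spec_par[OF wf] .
  show "finite (inputs ?G)" "finite (outputs ?G)" "inputs ?G \<inter> outputs ?G = {}"
    using P Q by (auto simp: spec_par_sel is_spec_def tiots_def)
  show "nonzeno ?G"
    using nonzeno_spec_par[OF wf _ _ sub] P Q by (auto simp: is_spec_def tiots_def)
  show "\<not> reachable ?G Top"
    using reachable_spec_par[OF P Q] no_Top by (metis par_st_eq_Top)
  have Both: "\<exists>p q. z = Both p q \<and> reachable P (Plain p) \<and> reachable Q (Plain q) \<and> p \<in> plains P \<and> q \<in> plains Q"
    if "reachable ?G (Plain z)" for z
    using reachable_spec_par[OF P Q that] reachable_states[OF wf(1)] reachable_states[OF wf(2)]
    by (metis par_st_eq_Plain plain_in_states)
  have step: "(Plain (Both p q), \<alpha>, par_st s t) \<in> trans ?G"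
    if "\<alpha> \<in> tA P" "moves P p \<alpha> s" "moves Q q \<alpha> t" for p q \<alpha> s t
    using that spec_par_step[OF wf] by blast
  {
    fix z a assume z: "reachable ?G (Plain z)" and a: "a \<in> inputs ?G"
    obtain p q where pq: "z = Both p q" "p \<in> plains P" "q \<in> plains Q" using Both[OF z] by blast
    have "a \<notin> outputs P" "a \<notin> outputs Q" "Act a \<in> tA P" using a sub by (auto simp: spec_par_sel actions_def)
    then show "enabled ?G (Plain z) (Act a)"
      using step spec_moves[OF P pq(2)] spec_moves[OF Q pq(3)] pq(1) unfolding enabled_def by blast
  next
    fix z d1 d2 x
    assume z: "reachable ?G (Plain z)" and d: "0 < d1" "0 < (d2::real)"
      and x: "(Plain z, Delay (d1 + d2), x) \<in> trans ?G"
    obtain p q where pq: "z = Both p q" "reachable P (Plain p)" "reachable Q (Plain q)" using Both[OF z] by blast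
    obtain s t where st: "(Plain p, Delay (d1 + d2), s) \<in> trans P" "(Plain q, Delay (d1 + d2), t) \<in> trans Q"
        "x = par_st s t"
      using x d spec_par_step[OF wf, of p q] pq(1) by (auto simp: moves_def)
    obtain m where m: "(Plain p, Delay d1, m) \<in> trans P" "(m, Delay d2, s) \<in> trans P"
      using spec_delay_split[OF spec_tiots[OF P] d st(1)] .
    obtain n where n: "(Plain q, Delay d1, n) \<in> trans Q" "(n, Delay d2, t) \<in> trans Q"
      using spec_delay_split[OF spec_tiots[OF Q] d st(2)] .
    have nT: "m \<noteq> Top" "s \<noteq> Top" "n \<noteq> Top" "t \<noteq> Top"
      using reachable_step pq(2,3) m(1) n(1) st(1,2) no_Top by blast+
    have "(Plain z, Delay d1, par_st m n) \<in> trans ?G"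
      using step[of "Delay d1" p m q n] m(1) n(1) d pq(1) by (simp add: moves_def)
    moreover have "(par_st m n, Delay d2, x) \<in> trans ?G"
    \<comment> \<open>An operand that is in \<open>Bot\<close> after \<open>d1\<close> remains
      there, so the product is in \<open>Bot\<close> both at \<open>d1\<close> and at the
      end.\<close>
    proof (cases "m = Bot \<or> n = Bot")
      case True
      then have "x = Bot" "par_st m n = Bot"
        using nT m(2) n(2) st(3) wf_trans_Bot[OF wf(1)] wf_trans_Bot[OF wf(2)] by (auto simp: par_st_eq_Bot)
      then show ?thesis using wf_trans_Bot[OF wf_spec_par[OF wf]] d(2) by simp
    next
      case False
      then obtain p' q' where "m = Plain p'" "n = Plain q'" using nT by (cases m; cases n) auto
      then show ?thesis using step[of "Delay d2" p' s q' t] m(2) n(2) st(3) d(2) by (simp add: moves_def)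
    qed
    ultimately show "\<exists>m. (Plain z, Delay d1, m) \<in> trans ?G \<and> (m, Delay d2, x) \<in> trans ?G" by blast
  next
    fix z d assume z: "reachable ?G (Plain z)" and d: "0 < (d::real)" "\<not> enabled ?G (Plain z) (Delay d)"
    obtain p q where pq: "z = Both p q" "reachable P (Plain p)" "reachable Q (Plain q)" "p \<in> plains P" "q \<in> plains Q"
      using Both[OF z] by blast
    have safe: "safe P (Plain p)" "safe Q (Plain q)" using reachable_safe P Q pq by blast+
    have wstep: "(Plain (Both p q), Delay e, par_st s t) \<in> trans ?G" if "waits P p e s" "waits Q q e t" "0 < e" for e s t
      using that step[of "Delay e" p s q t] by (simp add: waits_def moves_def)
    have w0: "waits P p 0 s \<longleftrightarrow> s = Plain p" "waits Q q 0 t \<longleftrightarrow> t = Plain q" for s t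
      by (auto simp: waits_def)
    have disj': "outputs Q \<inter> outputs P = {}" using disj by blast
    have "\<not> enabled P (Plain p) (Delay d) \<or> \<not> enabled Q (Plain q) (Delay d)"
      using d step[of "Delay d" p _ q] pq(1) by (auto simp: enabled_def moves_def)
    then obtain e s t where e: "0 \<le> e" "e < d" "waits P p e s" "waits Q q e t" and
      cases: "(s = Bot \<and> t \<noteq> Top) \<or> (s \<noteq> Top \<and> t = Bot) \<or> (\<exists>p' q' b u v. s = Plain p' \<and> t = Plain q' \<and> b \<in> outputs P \<union> outputs Q \<and>
        moves P p' (Act b) u \<and> moves Q q' (Act b) v)"
    proof
      assume "\<not> enabled P (Plain p) (Delay d)"
      from par_stop[OF P pq(4) Q pq(5) safe(2) disj d(1) this] show ?thesis using that by blast
    next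
      assume "\<not> enabled Q (Plain q) (Delay d)"
      from par_stop[OF Q pq(5) P pq(4) safe(1) disj' d(1) this] show ?thesis using that by (metis Un_iff st.distinct(3))
    qed
    show "(\<exists>y\<in>delay_closure ?G z. \<exists>a\<in>outputs ?G. enabled ?G (Plain y) (Act a)) \<or>
      (\<exists>e. 0 < e \<and> e < d \<and> (Plain z, Delay e, Bot) \<in> trans ?G)"
    proof (cases "par_st s t = Bot")
      case True
      \<comment> \<open>At time 0 both operands are still plain, and so is their product.\<close>
      then have "0 < e" using e(1,3,4) w0 by (cases "e = 0") auto
      then show ?thesis using wstep[OF e(3,4)] e(2) True pq(1) by auto
    next
      case False
      then obtain p' q' b u v where b: "s = Plain p'" "t = Plain q'" "b \<in> outputs P \<union> outputs Q"
          "moves P p' (Act b) u" "moves Q q' (Act b) v"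
        using cases unfolding par_st_eq_Bot by blast
      have "Both p' q' \<in> delay_closure ?G z"
        using wstep[OF e(3,4)] e(1,3,4) w0 b(1,2) pq(1) by (cases "e = 0") (auto simp: delay_closure_def)
      moreover have "Act b \<in> tA P" using b(3) sub by (auto simp: actions_def)
      then have "enabled ?G (Plain (Both p' q')) (Act b)"
        using step b(4,5) unfolding enabled_def by blast
      ultimately show ?thesis using b(3) by (auto simp: spec_par_sel)
    qed
  }
qed

section \<open>Monotonicity of the parallel product\<close>

lemma refines_trans: "refines A B \<Longrightarrow> refines B C \<Longrightarrow> refines A C"
  unfolding refines_def by (auto simp: same_alphabet_def environment_def)

lemma bot_free_par_commute:
  assumes "wf_tiots P" "wf_tiots Q" "wf_tiots R"
  shows "bot_free (spec_par (spec_par P Q) R) \<longleftrightarrow> bot_free (spec_par (spec_par Q P) R)"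
  using clash_par_swap[OF assms(1,2), of R "init P" "init Q" "init R"] assms
  by (simp add: bot_free_iff_clash wf_spec_par spec_par_sel)

lemma refines_par_commute:
  assumes "wf_tiots P" "wf_tiots Q"
  shows "refines (spec_par P Q) (spec_par Q P)"
  unfolding refines_def
  using bot_free_par_commute[OF assms spec_wf] by (auto simp: same_alphabet_def spec_par_sel)

text \<open>The environment \<open>R\<close> of the product provides every input of \<open>P\<close>
  and \<open>Q\<close> that neither of them outputs. Hence \<open>spec_par R Q\<close> has no inputs
  but the outputs of \<open>P\<close>, and among its outputs are all inputs of \<open>P\<close>; the
  other outputs get hidden. \<open>R\<close> is put first because its alphabet includes that of
  \<open>Q\<close>, as \<open>live_spec_par\<close> demands.\<close>

lemma par_environment:
  assumes P: "is_spec P" and Q: "is_spec Q" and comp: "par_composable P Q"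
    and R: "is_spec R" "environment R (spec_par P Q)"
  defines "E \<equiv> hide (inputs P) (spec_par R Q)"
  shows "is_spec E" "environment E P"
    and "bot_free (spec_par (spec_par P Q) R) \<longleftrightarrow> bot_free (spec_par P E)"
proof -
  let ?G = "spec_par R Q"
  note wfs = spec_wf[OF P] spec_wf[OF Q] spec_wf[OF R(1)]
  have io: "inputs P \<inter> outputs P = {}" using P by (simp add: is_spec_def tiots_def)
  have alph: "inputs R = outputs P \<union> outputs Q" "outputs R = (inputs P \<union> inputs Q) - (outputs P \<union> outputs Q)"
    using R(2) by (auto simp: environment_def spec_par_sel)
  have G: "inputs ?G = outputs P" "inputs P \<subseteq> outputs ?G"
    using comp io by (auto simp: spec_par_sel alph par_composable_def)
  interpret live ?G
    using alph by (intro live_spec_par[OF R(1) Q]) (auto simp: actions_def)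
  show E: "is_spec E" unfolding E_def by (rule hide_spec[OF G(2)])
  show "environment E P" using spec_tiots[OF E] G(1) by (simp add: environment_def E_def)
  have "clash (spec_par P Q) R (par_st (init P) (init Q)) (init R) \<longleftrightarrow>
      clash P (spec_par Q R) (init P) (par_st (init Q) (init R))"
    by (rule clash_par_assoc[OF wfs])
  also have "\<dots> \<longleftrightarrow> clash (spec_par Q R) P (par_st (init Q) (init R)) (init P)" by (rule clash_commute_iff)
  also have "\<dots> \<longleftrightarrow> clash ?G P (par_st (init R) (init Q)) (init P)" by (rule clash_par_swap[OF wfs(2,3)])
  also have "\<dots> \<longleftrightarrow> clash P ?G (init P) (init ?G)" by (simp add: clash_commute_iff[of P] spec_par_sel)
  also have "\<dots> \<longleftrightarrow> clash P E (init P) (init E)"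
    using clash_hide[OF G(2) P refl] G(1) by (simp add: E_def)
  finally show "bot_free (spec_par (spec_par P Q) R) \<longleftrightarrow> bot_free (spec_par P E)"
    using wfs spec_wf[OF E] by (simp add: bot_free_iff_clash wf_spec_par spec_par_sel)
qed

text \<open>The environment obtained by hiding depends on \<open>P\<close> only through its inputs,
  so the same one serves for \<open>P'\<close>. Its states are not real numbers, which is why
  \<open>refines_environment\<close> is called for.\<close>

lemma refines_par_left:
  assumes P: "is_spec P" "is_spec P'" and Q: "is_spec Q" and comp: "par_composable P Q" and ref: "refines P P'"
  shows "refines (spec_par P Q) (spec_par P' Q)"
  unfolding refines_def
proof (intro conjI allI impI)
  have same: "inputs P' = inputs P" "outputs P' = outputs P"
    using ref by (auto simp: refines_def same_alphabet_def)
  then show "same_alphabet (spec_par P Q) (spec_par P' Q)" by (simp add: same_alphabet_def spec_par_sel)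
  fix R :: "('a, real) tiots"
  assume R: "is_spec R" "environment R (spec_par P Q)" and free: "bot_free (spec_par (spec_par P Q) R)"
  have comp': "par_composable P' Q" and R': "environment R (spec_par P' Q)"
    using comp R(2) same by (auto simp: par_composable_def environment_def spec_par_sel)
  note E = par_environment[OF P(1) Q comp R]
  have "bot_free (spec_par P' (hide (inputs P) (spec_par R Q)))"
    using refines_environment[OF ref E(1,2)] E(3) free by blast
  then show "bot_free (spec_par (spec_par P' Q) R)"
    using par_environment(3)[OF P(2) Q comp' R(1) R'] same(1) by simp
qed

lemma refines_par:
  assumes P: "is_spec P" "is_spec P'" and Q: "is_spec Q" "is_spec Q'" and comp: "par_composable P Q"
    and ref: "refines P P'" "refines Q Q'"
  shows "refines (spec_par P Q) (spec_par P' Q')"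
proof -
  have comp': "par_composable Q P'"
    using comp ref by (auto simp: par_composable_def refines_def same_alphabet_def)
  note wf = spec_wf[OF P(2)] spec_wf[OF Q(1)] spec_wf[OF Q(2)]
  have "refines (spec_par P' Q) (spec_par P' Q')"
    using refines_trans[OF refines_trans[OF refines_par_commute[OF wf(1,2)]
          refines_par_left[OF Q P(2) comp' ref(2)]] refines_par_commute[OF wf(3,1)]] .
  then show ?thesis using refines_trans[OF refines_par_left[OF P Q(1) comp ref(1)]] by blast
qed

section \<open>Disjunction\<close>

lemma complete_top_completion:
  assumes "wf_tiots P" "bot_complete P"
  shows "complete (top_completion P)"
  unfolding complete_def
proof (intro ballI)
  fix p \<alpha> assume p: "p \<in> plains (top_completion P)" and a: "\<alpha> \<in> tA (top_completion P)"
  show "\<exists>s. (Plain p, \<alpha>, s) \<in> trans (top_completion P)"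
  proof (cases "\<alpha> \<in> tO P")
    case True
    then show ?thesis using p by (auto simp: top_completion_trans enabled_def)
  next
    case False
    then obtain b where "\<alpha> = Act b" "b \<in> inputs P" using a by (cases \<alpha>) (auto simp: actions_def)
    then show ?thesis using assms(2) p by (auto simp: bot_complete_iff enabled_def top_completion_trans)
  qed
qed

lemma bot_free_disj:
  assumes P: "is_spec P" and Q: "is_spec Q" and same: "same_alphabet P Q" and R: "is_spec R" "environment R P"
  shows "bot_free (spec_par (spec_disj P Q) R) \<longleftrightarrow> bot_free (spec_par P R) \<and> bot_free (spec_par Q R)"
proof -
  note wf = spec_wf[OF P] spec_wf[OF Q] spec_wf[OF R(1)]
  have tA: "tA Q = tA P" "tA R = tA P"
    using same R(2) by (auto simp: same_alphabet_def environment_def tA_def actions_def)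
  have c: "complete (top_completion P)" "complete (top_completion Q)"
    using complete_top_completion wf P Q by (auto simp: is_spec_def)
  have "wf_tiots (spec_disj P Q)"
    unfolding spec_disj_def using wf same
    by (intro wf_top_removal wf_prod_disj wf_top_completion) (auto simp: same_alphabet_def)
  moreover have "clash (spec_disj P Q) R (disj_st (init P) (init Q)) (init R) \<longleftrightarrow>
      clash P R (init P) (init R) \<or> clash Q R (init Q) (init R)"
    using clash_prod_disj[OF wf_top_completion[OF wf(1)] wf_top_completion[OF wf(2)] _ _ c,
        of R "init P" "init Q" "init R"] tA wf by (simp add: spec_disj_def wf_tiots_def)
  moreover have "init (spec_disj P Q) = disj_st (init P) (init Q)" by (simp add: spec_disj_def)
  ultimately show ?thesis using wf by (simp add: bot_free_iff_clash)
qed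

lemma refines_disj:
  assumes P: "is_spec P" "is_spec P'" and Q: "is_spec Q" "is_spec Q'" and same: "same_alphabet P Q"
    and ref: "refines P P'" "refines Q Q'"
  shows "refines (spec_disj P Q) (spec_disj P' Q')"
  unfolding refines_def
proof (intro conjI allI impI)
  have alph: "same_alphabet P P'" "same_alphabet Q Q'" using ref by (auto simp: refines_def)
  then show "same_alphabet (spec_disj P Q) (spec_disj P' Q')"
    by (simp add: same_alphabet_def spec_disj_def)
  fix R :: "('a, real) tiots"
  assume R: "is_spec R" "environment R (spec_disj P Q)" and free: "bot_free (spec_par (spec_disj P Q) R)"
  have env: "environment R P" "environment R Q" "environment R P'" and same': "same_alphabet P' Q'"
    using R(2) same alph by (auto simp: environment_def spec_disj_def same_alphabet_def)
  show "bot_free (spec_par (spec_disj P' Q') R)"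
    using free ref R(1) env
    unfolding bot_free_disj[OF P(1) Q(1) same R(1) env(1)] bot_free_disj[OF P(2) Q(2) same' R(1) env(3)]
    by (auto simp: refines_def)
qed

section \<open>Normal forms characterise refinement\<close>

lemma special_bot_top_completion:
  assumes disj: "inputs P \<inter> outputs P = {}"
  shows "special_bot (top_completion P) p \<longleftrightarrow> special_bot P p"
proof -
  have Bot: "(Plain q, \<alpha>, Bot) \<in> trans (top_completion P) \<longleftrightarrow> (Plain q, \<alpha>, Bot) \<in> trans P" for q \<alpha>
    by (auto simp: top_completion_trans)
  have cl: "delay_closure (top_completion P) p = delay_closure P p"
    by (auto simp: delay_closure_def top_completion_trans)
  have inp: "(Plain q, Act a, s) \<in> trans (top_completion P) \<longleftrightarrow> (Plain q, Act a, s) \<in> trans P"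
    if "a \<in> inputs P" for q a s
    using that disj by (auto simp: top_completion_trans)
  show ?thesis
    unfolding special_bot_def auto_bot_def semi_bot_def top_completion_sel Bot cl
    by (simp add: inp cong: ball_cong)
qed

lemma collapse_top_completion:
  "collapse Bot C (top_completion D) = top_completion (collapse Bot C D)"
proof -
  have passes: "passes Bot C (top_completion D) p d \<longleftrightarrow> passes Bot C D p d" for p d
    by (auto simp: passes_def top_completion_trans redirect_def)
  have en: "enabled (collapse Bot C D) (Plain p) (Act a) \<longleftrightarrow> p \<in> plains D - C \<and> enabled D (Plain p) (Act a)"
    "enabled (collapse Bot C D) (Plain p) (Delay d) \<longleftrightarrow>
       p \<in> plains D - C \<and> (passes Bot C D p d \<or> enabled D (Plain p) (Delay d))" for p a d
    by (auto simp: enabled_def collapse_act collapse_delay)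
  have red: "redirect Bot C Top = Top" by (simp add: redirect_def image_iff)
  have tO: "tO (collapse Bot C D) = tO D" by (simp add: tO_def)
  have "(s, \<alpha>, t) \<in> trans (collapse Bot C (top_completion D)) \<longleftrightarrow>
      (s, \<alpha>, t) \<in> trans (top_completion (collapse Bot C D))" for s \<alpha> t
  proof (cases s)
    case (Plain p)
    show ?thesis
    proof (cases \<alpha>)
      case (Act a)
      then show ?thesis unfolding Plain
        by (auto simp: collapse_act top_completion_trans en tO red)
    next
      case (Delay d)
      then show ?thesis unfolding Plain
        by (auto simp: collapse_delay top_completion_trans en tO passes)
    qed
  qed (simp_all add: collapse_chaos top_completion_trans)
  then have "trans (collapse Bot C (top_completion D)) = trans (top_completion (collapse Bot C D))"
    by (auto simp: set_eq_iff)
  then show ?thesis by (intro tiots.equality) (simp_all add: collapse_def top_completion_def)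
qed

text \<open>The operators complete after collapsing, while \<open>regular\<close> asks for
  completeness beforehand; the order turns out to be irrelevant.\<close>

lemma normal_top_completion:
  assumes "inputs D \<inter> outputs D = {}"
  shows "normal (top_completion D) = top_completion (normal D)"
proof -
  have "collapsible special_bot Bot (top_completion D) = collapsible special_bot Bot D"
    unfolding collapsible_def collapse_top_completion
    using assms by (subst special_bot_top_completion) auto
  then show ?thesis by (simp add: normal_def collapse_top_completion)
qed

lemma normalise_normal: "normalise P = normal (det P)"
  by (simp add: normalise_def normal_def)

text \<open>Here \<open>tiots (det P)\<close> enters: it supplies the non-zenoness and the time
  additivity of the determinisation.\<close>

lemma regular_det:
  assumes P: "is_spec P" and det: "tiots (det P)"
  shows "regular (top_completion (det P))" "time_additive (top_completion (det P))"
proof -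
  have wf: "wf_tiots (det P)" using wf_tiotsI[OF det] .
  show ta: "time_additive (top_completion (det P))"
    using time_additive_top_completion[OF wf functional_det] det by (simp add: tiots_def)
  show "regular (top_completion (det P))"
  proof
    show "complete (top_completion (det P))"
      using P by (intro complete_top_completion_det spec_wf) (auto simp: is_spec_def)
    show "nonzeno (top_completion (det P))"
      using det by (intro nonzeno_top_completion) (simp add: tiots_def)
    fix p d1 d2 m s
    assume "0 < d1" "0 < d2" "(Plain p, Delay d1, m) \<in> trans (top_completion (det P))"
      "(m, Delay d2, s) \<in> trans (top_completion (det P))"
    then show "(Plain p, Delay (d1 + d2), s) \<in> trans (top_completion (det P))"
      using ta unfolding time_additive_def by blast
  qed (use det in \<open>auto simp: tiots_def wf_top_completion[OF wf]
      functional_top_completion functional_det\<close>)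
qed

text \<open>The exception for \<open>Bot\<close> in \<open>delay_add\<close> is not symmetric in
  \<open>Top\<close> and \<open>Bot\<close>. Full time additivity is, hence the second
  assumption.\<close>

lemma regular_mirror:
  assumes "regular N" "time_additive N"
  shows "regular (mirror N)"
proof -
  interpret regular N by fact
  have ta: "time_additive (mirror N)" by (rule time_additive_mirror[OF assms(2)])
  show ?thesis
  proof
    fix p d1 d2 m s
    assume "0 < d1" "0 < d2" "(Plain p, Delay d1, m) \<in> trans (mirror N)" "(m, Delay d2, s) \<in> trans (mirror N)"
    then show "(Plain p, Delay (d1 + d2), s) \<in> trans (mirror N)"
      using ta unfolding time_additive_def by blast
  qed (use fin disj functional complete wf_mirror[OF wf] nonzeno_mirror[OF nonzeno] in auto)
qed

definition normal_form :: "('a, 's) tiots \<Rightarrow> ('a, 's set) tiots" where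
  "normal_form P = top_completion (normalise P)"

lemma normal_form_eq:
  assumes "is_spec P"
  shows "normal_form P = normal (top_completion (det P))"
  using assms by (subst normal_top_completion)
    (auto simp: normal_form_def normalise_normal is_spec_def tiots_def)

lemma normal_form_regular:
  assumes "is_spec P" "tiots (det P)"
  shows "regular (normal_form P)" "time_additive (normal_form P)"
  using regular.regular_normal regular.time_additive_normal regular_det[OF assms]
  by (auto simp: normal_form_eq[OF assms(1)])

lemma normal_form_sel:
  "inputs (normal_form P) = inputs P" "outputs (normal_form P) = outputs P"
  "actions (normal_form P) = actions P" "tA (normal_form P) = tA P"
  by (auto simp: normal_form_def normalise_def)

text \<open>From left to right the mirror itself is used as an environment; its states are sets, so
  \<open>refines_environment\<close> is needed. If the normal form starts in \<open>Bot\<close>, no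
  environment is safe for \<open>P\<close>, and the mirror starts in \<open>Top\<close> and clashes
  with nothing. From right to left, a clash of \<open>S\<close> with an environment of
  \<open>P\<close> is cut at the mirror.\<close>

lemma refines_iff_normal_form:
  assumes P: "is_spec P" and det: "tiots (det P)" and S: "wf_tiots S" "same_alphabet P S"
  shows "refines P S \<longleftrightarrow> \<not> clash S (mirror (normal_form P)) (init S) (init (mirror (normal_form P)))"
proof -
  let ?D = "top_completion (det P)" and ?N = "normal_form P"
  interpret D: regular ?D by (rule regular_det[OF P det])
  have N: "?N = normal ?D" by (rule normal_form_eq[OF P])
  have wfP: "wf_tiots P" and wfN: "wf_tiots ?N" using spec_wf[OF P] D.wf_normal by (simp_all add: N)
  have free: "bot_free (spec_par P R) \<longleftrightarrow> \<not> clash ?N R (init ?N) (init R)"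
    if R: "is_spec R" "environment R P" for R :: "('a, 'r) tiots"
  proof -
    have "clash ?N R (init ?N) (init R) \<longleftrightarrow> clash ?D R (init ?D) (init R)"
      unfolding N using R by (intro D.clash_normal) (auto simp: environment_def)
    also have "\<dots> \<longleftrightarrow> clash P R (init P) (init R)" using clash_det[OF wfP] by simp
    finally show ?thesis using bot_free_iff_clash[OF wfP spec_wf[OF R(1)]] by simp
  qed
  show ?thesis
  proof
    assume ref: "refines P S"
    show "\<not> clash S (mirror ?N) (init S) (init (mirror ?N))"
    proof (cases "init ?N = Bot")
      case True
      then show ?thesis by simp
    next
      case False
      let ?M = "top_removal (mirror ?N)"
      have M: "is_spec ?M" using D.spec_mirror_normal False by (simp add: N)
      have env: "environment ?M P" using spec_tiots[OF M] by (simp add: environment_def normal_form_sel)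
      have "bot_free (spec_par P ?M)" using free[OF M env] D.no_clash_mirror_normal by (simp add: N)
      then have "bot_free (spec_par S ?M)" using refines_environment[OF ref M env] by blast
      then show ?thesis using bot_free_iff_clash[OF S(1) spec_wf[OF M]] by simp
    qed
  next
    assume nc: "\<not> clash S (mirror ?N) (init S) (init (mirror ?N))"
    have "bot_free (spec_par S R)" if R: "is_spec R" "environment R P" and fr: "bot_free (spec_par P R)"
      for R :: "('a, real) tiots"
    proof -
      have tA: "tA S = tA (mirror ?N)" "tA R = tA (mirror ?N)"
        using S(2) R(2) by (auto simp: same_alphabet_def environment_def normal_form_sel tA_def actions_def)
      have "complete (mirror ?N)" using D.complete_normal by (simp add: N)
      moreover have "init (mirror ?N) \<in> states (mirror ?N)" using wfN by (simp add: wf_tiots_def)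
      \<comment> \<open>The cut is made at \<open>mirror ?N\<close>, whose mirror is
        \<open>?N\<close> again; so the second alternative is a clash of the normal form with
        \<open>R\<close>.\<close>
      ultimately have "\<not> clash S R (init S) (init R)"
        using clash_cut[OF wf_mirror[OF wfN] _ tA, of "init S" "init R" "init (mirror ?N)"]
          nc fr free[OF R] by auto
      then show ?thesis using bot_free_iff_clash[OF S(1) spec_wf[OF R(1)]] by blast
    qed
    then show "refines P S" using S(2) unfolding refines_def by blast
  qed
qed

section \<open>Realisation\<close>

lemma special_top_mirror: "special_top (mirror P) p \<longleftrightarrow> special_bot P p"
proof -
  have all: "(\<forall>s. (Plain q, \<alpha>, s) \<in> trans (mirror P) \<longrightarrow> s = Top) \<longleftrightarrow>
      (\<forall>s. (Plain q, \<alpha>, s) \<in> trans P \<longrightarrow> s = Bot)" for q \<alpha>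
    by (metis dual.simps(2,3) dual_dual mirror_sel(5))
  have cl: "delay_closure (mirror P) p = delay_closure P p" by (simp add: delay_closure_def)
  show ?thesis
    unfolding special_top_def special_bot_def auto_top_def auto_bot_def semi_top_def semi_bot_def cl all
    by simp
qed

lemma collapse_mirror: "collapse Top C (mirror D) = mirror (collapse Bot C D)"
proof -
  have red: "redirect Top C (dual s) = dual (redirect Bot C s)" for s
    by (cases s) (auto simp: redirect_def)
  have red': "dual (redirect Top C s) = redirect Bot C (dual s)" for s
    by (cases s) (auto simp: redirect_def)
  have passes: "passes Top C (mirror D) p d \<longleftrightarrow> passes Bot C D p d" for p d
  proof -
    have "(Plain p, Delay e, s) \<in> trans (mirror D) \<and> redirect Top C s = Top \<longleftrightarrow>
        (Plain p, Delay e, dual s) \<in> trans D \<and> redirect Bot C (dual s) = Bot" for e s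
      by (simp flip: red')
    then have "(\<exists>s. (Plain p, Delay e, s) \<in> trans (mirror D) \<and> redirect Top C s = Top) \<longleftrightarrow>
        (\<exists>s. (Plain p, Delay e, s) \<in> trans D \<and> redirect Bot C s = Bot)" for e
      by (metis dual_dual)
    then show ?thesis unfolding passes_def by blast
  qed
  have "(s, \<alpha>, t) \<in> trans (collapse Top C (mirror D)) \<longleftrightarrow> (s, \<alpha>, t) \<in> trans (mirror (collapse Bot C D))"
    for s \<alpha> t
  proof (cases s)
    case (Plain p)
    show ?thesis
    proof (cases \<alpha>)
      case (Act a)
      have "(\<exists>s'. (Plain p, Act a, dual s') \<in> trans D \<and> t = redirect Top C s') \<longleftrightarrow>
          (\<exists>s'. (Plain p, Act a, s') \<in> trans D \<and> dual t = redirect Bot C s')"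
        by (metis dual_dual red red')
      then show ?thesis unfolding Plain Act by (simp add: collapse_act)
    next
      case (Delay d)
      have "t = Top \<longleftrightarrow> dual t = Bot" by simp
      then show ?thesis unfolding Plain Delay by (simp add: collapse_delay passes)
    qed
  next
    case Top
    then show ?thesis by (cases t) (simp_all add: collapse_chaos)
  next
    case Bot
    then show ?thesis by (cases t) (simp_all add: collapse_chaos)
  qed
  then have tr: "trans (collapse Top C (mirror D)) = trans (mirror (collapse Bot C D))"
    by (auto simp: set_eq_iff)
  have "init (collapse Top C (mirror D)) = init (mirror (collapse Bot C D))" by (simp add: red)
  with tr show ?thesis by (intro tiots.equality) (simp_all add: collapse_def)
qed

text \<open>Mirroring exchanges \<open>special_top\<close> with \<open>special_bot\<close> and a
  collapse into \<open>Top\<close> with one into \<open>Bot\<close>. Realisation is therefore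
  normalisation seen in the mirror, and the results on \<open>normal\<close> apply to it.\<close>

lemma realise_eq:
  "realise Y = (let N = normal (mirror (det Y)) in
     if init N = Bot then mirror N else top_removal (mirror N))"
proof -
  have "collapsible special_top Top (mirror (mirror (det Y))) = collapsible special_bot Bot (mirror (det Y))"
    unfolding collapsible_def collapse_mirror special_top_mirror by simp
  then have "collapse Top (collapsible special_top Top (det Y)) (det Y) = mirror (normal (mirror (det Y)))"
    unfolding normal_def by (metis collapse_mirror mirror_sel(10))
  then show ?thesis by (simp add: realise_def Let_def)
qed

text \<open>
  Only the reachable states of \<open>Y\<close>, all in \<open>K\<close>, matter for its determinisation. Outside \<open>K\<close>, a
  parallel product is not complete and differs from the mirror of the quotient.
\<close>

locale realisation =
  fixes D Y :: "('a, 's) tiots" and K :: "'s set"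
  assumes wf: "wf_tiots D" and fin: "finite (inputs D)" "finite (outputs D)"
    and disj: "inputs D \<inter> outputs D = {}" and nonzeno: "nonzeno D"
    and functional: "\<And>p \<alpha> s t. p \<in> K \<Longrightarrow> (Plain p, \<alpha>, s) \<in> trans D \<Longrightarrow> (Plain p, \<alpha>, t) \<in> trans D \<Longrightarrow> s = t"
    and complete: "\<And>p \<alpha>. p \<in> K \<Longrightarrow> \<alpha> \<in> tA D \<Longrightarrow> \<exists>s. (Plain p, \<alpha>, s) \<in> trans D"
    and delay_add: "\<And>p d1 d2 m s. p \<in> K \<Longrightarrow> 0 < d1 \<Longrightarrow> 0 < d2 \<Longrightarrow> (Plain p, Delay d1, m) \<in> trans D \<Longrightarrow>
      m \<noteq> Bot \<Longrightarrow> (m, Delay d2, s) \<in> trans D \<Longrightarrow> (Plain p, Delay (d1 + d2), s) \<in> trans D"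
    and wfY: "wf_tiots Y" and alph: "inputs Y = outputs D" "outputs Y = inputs D"
    and init: "init Y = dual (init D)" "\<And>p. init D = Plain p \<Longrightarrow> p \<in> K"
    and K: "K \<subseteq> plains D" "\<And>p \<alpha> q. p \<in> K \<Longrightarrow> (Plain p, \<alpha>, Plain q) \<in> trans D \<Longrightarrow> q \<in> K"
    and agree: "\<And>p \<alpha> s. p \<in> K \<Longrightarrow> (Plain p, \<alpha>, s) \<in> trans Y \<longleftrightarrow> (Plain p, \<alpha>, dual s) \<in> trans D"
begin

abbreviation "D' \<equiv> mirror (det Y)"
abbreviation sing :: "'s st \<Rightarrow> 's set st" where "sing \<equiv> map_st (\<lambda>p. {p})"

lemma tA_Y: "tA Y = tA D"
  using alph by (auto simp: tA_def actions_def)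

text \<open>Inside \<open>K\<close> the system \<open>Y\<close> is deterministic, because it agrees
  there with the mirror of \<open>D\<close>. Hence its determinisation does nothing but wrap states
  in singletons.\<close>

lemma path_K:
  "path Y s w t \<Longrightarrow> set_st s \<subseteq> K \<Longrightarrow> set_st t \<subseteq> K \<and> (path Y s w t' \<longrightarrow> t' = t)"
proof (induction rule: path.induct)
  case (path_Cons s \<alpha> s' w t)
  have step: "set_st m \<subseteq> K \<and> m = s'" if "(s, \<alpha>, m) \<in> trans Y" for m
  proof (cases s)
    case (Plain p)
    then have p: "p \<in> K" using path_Cons.prems by simp
    then have D: "(Plain p, \<alpha>, dual m) \<in> trans D" "(Plain p, \<alpha>, dual s') \<in> trans D"
      using agree that path_Cons.hyps(1) Plain by auto
    have "set_st m \<subseteq> K" using K(2)[OF p] D(1) by (cases m) auto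
    moreover have "m = s'" using functional[OF p D] by (metis dual_dual)
    ultimately show ?thesis by blast
  qed (use that path_Cons.hyps(1) wf_trans_Top[OF wfY] wf_trans_Bot[OF wfY] in auto)
  have IH: "set_st t \<subseteq> K" "path Y s' w t' \<Longrightarrow> t' = t"
    using path_Cons.IH step[OF path_Cons.hyps(1)] by blast+
  show ?case
  proof (intro conjI impI)
    assume "path Y s (\<alpha> # w) t'"
    then obtain m where "(s, \<alpha>, m) \<in> trans Y" "path Y m w t'" by (auto simp: path_Cons_iff)
    then show "t' = t" using IH(2) step by blast
  qed (rule IH(1))
qed auto

lemma det_plains_K: "X \<in> plains (det Y) \<Longrightarrow> \<exists>p\<in>K. X = {p}"
proof -
  assume "X \<in> plains (det Y)"
  then obtain w where w: "after Y w \<noteq> {}" "reduce (after Y w) = Plain X" by (auto simp: det_plains)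
  have "set_st (init Y) \<subseteq> K" using init by (cases "init D") auto
  then have one: "s \<in> after Y w \<Longrightarrow> set_st s \<subseteq> K \<and> after Y w = {s}" for s
    using path_K unfolding after_def by blast
  then obtain p where "p \<in> X" "Plain p \<in> after Y w" using reduce_plain_nonempty[OF w(2,1)] by blast
  then show ?thesis using one[of "Plain p"] w(2) by (auto simp: reduce_eq_Plain)
qed

text \<open>\<open>sing\<close> identifies the part of \<open>D\<close> inside \<open>K\<close> that
  is reached by runs of \<open>Y\<close> with the mirror of the determinisation; it is along
  \<open>sing\<close> that regularity and clashes are transported.\<close>

lemma det_step:
  assumes "{p} \<in> plains (det Y)"
  shows "(Plain {p}, \<alpha>, S) \<in> trans D' \<longleftrightarrow> (\<exists>s. (Plain p, \<alpha>, s) \<in> trans D \<and> S = sing s)"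
proof -
  have p: "p \<in> K" using det_plains_K[OF assms] by auto
  have Y: "(Plain p, \<alpha>, dual s) \<in> trans Y \<longleftrightarrow> (Plain p, \<alpha>, s) \<in> trans D" for s
    using agree[OF p] by simp
  have red: "reduce {s} = sing s" for s by (cases s) (auto simp: reduce_def)
  have ds: "dual (sing s) = sing (dual s)" for s by (cases s) auto
  have post: "post Y {p} \<alpha> = {dual s}" if "(Plain p, \<alpha>, s) \<in> trans D" for s
  proof -
    have "t = dual s" if "(Plain p, \<alpha>, t) \<in> trans Y" for t
      using functional[OF p \<open>(Plain p, \<alpha>, s) \<in> trans D\<close>, of "dual t"] that agree[OF p] by simp
    then show ?thesis using that Y by (auto simp: post_def)
  qed
  show ?thesis
  proof
    assume "(Plain {p}, \<alpha>, S) \<in> trans D'"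
    then have S: "post Y {p} \<alpha> \<noteq> {}" "dual S = reduce (post Y {p} \<alpha>)" by (auto simp: det_trans)
    then obtain t where "(Plain p, \<alpha>, t) \<in> trans Y" by (auto simp: post_def)
    then have t: "(Plain p, \<alpha>, dual t) \<in> trans D" using agree[OF p] by simp
    have "dual S = sing t" using S(2) post[OF t] red by simp
    then have "S = sing (dual t)" by (metis ds dual_dual)
    then show "\<exists>s. (Plain p, \<alpha>, s) \<in> trans D \<and> S = sing s" using t by blast
  next
    assume "\<exists>s. (Plain p, \<alpha>, s) \<in> trans D \<and> S = sing s"
    then obtain s where s: "(Plain p, \<alpha>, s) \<in> trans D" "S = sing s" by blast
    then show "(Plain {p}, \<alpha>, S) \<in> trans D'"
      using assms post[OF s(1)] by (simp add: det_trans red ds)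
  qed
qed

lemma det_plain_step:
  assumes "{p} \<in> plains (det Y)" "(Plain p, \<alpha>, Plain q) \<in> trans D"
  shows "{q} \<in> plains (det Y)"
proof -
  have "(Plain {p}, \<alpha>, Plain {q}) \<in> trans D'" using det_step[OF assms(1), THEN iffD2] assms(2) by force
  then show ?thesis using wf_trans_plain(3)[OF wf_mirror[OF wf_det[OF wfY]]] by fastforce
qed

lemma regular_det_mirror: "regular D'"
proof
  have wf': "wf_tiots D'" using wf_mirror[OF wf_det[OF wfY]] .
  show "wf_tiots D'" by fact
  show "finite (inputs D')" "finite (outputs D')" "inputs D' \<inter> outputs D' = {}"
    using fin disj alph by auto
  show "functional D'" using functional_det by simp
  have sing: "\<exists>p\<in>K. X = {p}" if "X \<in> plains D'" for X using det_plains_K that by simp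
  show "complete D'"
    unfolding complete_def
  proof (intro ballI)
    fix X \<alpha> assume X: "X \<in> plains D'" and a: "\<alpha> \<in> tA D'"
    obtain p where p: "p \<in> K" "X = {p}" using sing[OF X] by blast
    then obtain s where "(Plain p, \<alpha>, s) \<in> trans D"
      using complete[OF p(1), of \<alpha>] a tA_Y by auto
    then show "\<exists>S. (Plain X, \<alpha>, S) \<in> trans D'" using det_step[of p] X p by auto
  qed
  show "nonzeno D'"
    unfolding nonzeno_def
  proof (rule notI, elim exE conjE)
    fix X \<alpha>
    assume st: "\<forall>n. (Plain (X n), \<alpha> n, Plain (X (Suc n))) \<in> trans D'"
      and inf: "infinite {n. \<exists>a. \<alpha> n = Act a}" and sum: "summable (\<lambda>n. duration (\<alpha> n))"
    have X: "X n \<in> plains D'" for n using wf_trans_plain(1)[OF wf'] st by blast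
    then have "\<forall>n. \<exists>p. X n = {p}" using sing by blast
    then obtain p where p: "\<And>n. X n = {p n}" by metis
    have "(Plain (p n), \<alpha> n, Plain (p (Suc n))) \<in> trans D" for n
    proof -
      have "(Plain {p n}, \<alpha> n, Plain {p (Suc n)}) \<in> trans D'" using st p by metis
      moreover have "{p n} \<in> plains (det Y)" using X[of n] p by simp
      ultimately obtain s where "(Plain (p n), \<alpha> n, s) \<in> trans D" "Plain {p (Suc n)} = sing s"
        using det_step[THEN iffD1] by blast
      then show ?thesis by (auto simp: map_st_eq_Plain)
    qed
    then show False using nonzenoD[OF nonzeno _ inf sum] by blast
  qed
  fix X d1 d2 M S
  assume d: "0 < d1" "0 < d2" and M: "(Plain X, Delay d1, M) \<in> trans D'" "M \<noteq> Bot" "(M, Delay d2, S) \<in> trans D'"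
  have X: "X \<in> plains D'" using wf_trans_plain(1)[OF wf' M(1)] .
  obtain p where p: "X = {p}" "p \<in> K" using sing[OF X] by blast
  obtain m where m: "(Plain p, Delay d1, m) \<in> trans D" "M = sing m" using M(1) det_step[of p] X p by auto
  have "\<exists>s. (m, Delay d2, s) \<in> trans D \<and> S = sing s"
  proof (cases m)
    case (Plain q)
    then have "{q} \<in> plains (det Y)" using det_plain_step[of p _ q] m(1) X p by auto
    then show ?thesis using M(3) m(2) det_step[of q] Plain by auto
  qed (use M m d wf_trans_Top[OF wf'] wf_trans_Top[OF wf] in auto)
  then obtain s where "(m, Delay d2, s) \<in> trans D" "S = sing s" by blast
  then have "(Plain p, Delay (d1 + d2), s) \<in> trans D" "S = sing s"
    using delay_add[OF p(2) d m(1)] M(2) m(2) by auto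
  then show "(Plain X, Delay (d1 + d2), S) \<in> trans D'" using det_step[of p] X p by auto
qed

lemma clash_det_mirror1:
  "clash D R s r \<Longrightarrow> (\<forall>p. s = Plain p \<longrightarrow> {p} \<in> plains (det Y)) \<Longrightarrow> clash D' R (sing s) r"
proof (induction rule: clash.induct)
  case (clash_bot s r)
  then show ?case by (auto simp: par_st_eq_Bot clash_Bot)
next
  case (clash_step \<alpha> p s q r)
  have p: "{p} \<in> plains (det Y)" using clash_step.prems by simp
  have "moves D' {p} \<alpha> (sing s) \<and> clash D' R (sing s) r"
  proof (cases "\<alpha> \<in> tA D")
    case True
    then have s: "(Plain p, \<alpha>, s) \<in> trans D" using clash_step.hyps(2) by (simp add: moves_in)
    then have "clash D' R (sing s) r" using clash_step.IH det_plain_step[OF p] by blast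
    then show ?thesis using s det_step[OF p] True tA_Y by (auto simp: moves_in)
  next
    case False
    then have s: "s = Plain p" using clash_step.hyps(2) by (simp add: moves_not_in)
    then show ?thesis using clash_step.IH p False tA_Y by (simp add: moves_not_in)
  qed
  then show ?case using clash.clash_step[of \<alpha> D' R "{p}" "sing s" q r] clash_step.hyps(1,3) tA_Y by simp
qed

lemma clash_det_mirror2:
  "clash D' R S r \<Longrightarrow> S = sing s \<Longrightarrow> (\<forall>p. s = Plain p \<longrightarrow> {p} \<in> plains (det Y)) \<Longrightarrow> clash D R s r"
proof (induction arbitrary: s rule: clash.induct)
  case (clash_bot S r)
  then show ?case by (auto simp: par_st_eq_Bot clash_Bot)
next
  case (clash_step \<alpha> X S q r)
  obtain p where p: "s = Plain p" "X = {p}" "{p} \<in> plains (det Y)"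
    using clash_step.prems by (cases s) auto
  have "\<exists>t. moves D p \<alpha> t \<and> clash D R t r"
  proof (cases "\<alpha> \<in> tA D")
    case True
    then obtain t where t: "(Plain p, \<alpha>, t) \<in> trans D" "S = sing t"
      using clash_step.hyps(2) det_step[OF p(3)] p(2) tA_Y by (auto simp: moves_in)
    then have "clash D R t r" using clash_step.IH det_plain_step[OF p(3)] by blast
    then show ?thesis using t(1) True by (auto simp: moves_in)
  next
    case False
    then have "S = Plain {p}" using clash_step.hyps(2) p(2) tA_Y by (simp add: moves_not_in)
    then have "clash D R (Plain p) r" using clash_step.IH[of "Plain p"] p(3) by simp
    moreover have "p \<in> plains D" using det_plains_K[OF p(3)] K(1) by auto
    ultimately show ?thesis using False by (auto simp: moves_not_in)
  qed
  then show ?case using clash_step.hyps(1,3) tA_Y p(1) by (auto intro: clash.clash_step[of \<alpha>])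
qed

lemma clash_det_mirror: "clash D' R (init D') r \<longleftrightarrow> clash D R (init D) r"
proof -
  have i: "init D' = sing (init D)" using init(1) by (cases "init D") (auto simp: reduce_def)
  have "{p} \<in> plains (det Y)" if "init D = Plain p" for p
    using det_init_state[of Y] init(1) that by (auto simp: reduce_def)
  then show ?thesis using clash_det_mirror1[of R "init D" r] clash_det_mirror2[of R "init D'" r "init D"] i
    by auto
qed

sublocale det: regular D' by (rule regular_det_mirror)

lemma realise_sel:
  "inputs (realise Y) = outputs D" "outputs (realise Y) = inputs D" "tA (realise Y) = tA D"
  "init (realise Y) = dual (init (normal D'))"
  using alph tA_Y by (simp_all add: realise_eq Let_def)

lemma wf_realise: "wf_tiots (realise Y)"
  using wf_mirror[OF det.wf_normal] by (simp add: realise_eq Let_def wf_top_removal)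

lemma clash_realise: "clash (realise Y) R s r \<longleftrightarrow> clash (mirror (normal D')) R s r"
  by (simp add: realise_eq Let_def)

lemma spec_realise:
  assumes "init (realise Y) \<noteq> Top"
  shows "is_spec (realise Y)"
  using assms det.spec_mirror_normal unfolding realise_sel by (simp add: realise_eq Let_def)

lemma realise_sound:
  assumes "init (realise Y) \<noteq> Top"
  shows "\<not> clash D (realise Y) (init D) (init (realise Y))"
proof -
  have "\<not> clash (normal D') (realise Y) (init (normal D')) (init (realise Y))"
    using det.no_clash_mirror_normal unfolding realise_sel
    by (simp add: clash_commute_iff[of "normal D'"] clash_realise)
  then show ?thesis
    using det.clash_normal[OF spec_realise[OF assms]] clash_det_mirror[of "realise Y" "init (realise Y)"] alph
    by (simp add: realise_sel)
qed

text \<open>A cut at \<open>normal D'\<close>: by \<open>clash_normal\<close> the specification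
  \<open>S\<close> is as safe with it as with \<open>D\<close>, and its mirror is
  \<open>realise Y\<close> up to transitions to \<open>Top\<close>, which do not affect
  clashes.\<close>

lemma realise_greatest:
  assumes S: "is_spec S" "inputs S = outputs D" "outputs S = inputs D" and R: "tA R = tA D"
    and sound: "\<not> clash D S (init D) (init S)"
    and free: "\<not> clash (realise Y) R (init (realise Y)) r"
  shows "\<not> clash S R (init S) r"
proof -
  have tA: "tA S = tA (normal D')" "tA R = tA (normal D')"
    using S R alph tA_Y by (simp_all add: tA_def actions_def Un_commute)
  have "\<not> clash (normal D') S (init (normal D')) (init S)"
    using det.clash_normal[OF S(1)] S(2,3) alph clash_det_mirror[of S "init S"] sound by simp
  then have "\<not> clash S (normal D') (init S) (init (normal D'))" by (simp add: clash_commute_iff[of S])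
  moreover have "\<not> clash (mirror (normal D')) R (dual (init (normal D'))) r"
    using free by (simp add: clash_realise realise_sel)
  moreover have "init (normal D') \<in> states (normal D')" using det.wf_normal by (simp add: wf_tiots_def)
  ultimately show ?thesis
    using clash_cut[OF det.wf_normal det.complete_normal tA] by blast
qed

end

section \<open>Conjunction and quotient\<close>

lemma complete_states:
  assumes "wf_tiots P" "complete P" "s \<in> states P" "\<alpha> \<in> tA P"
  shows "\<exists>t. (s, \<alpha>, t) \<in> trans P"
  using assms wf_trans_Top[OF assms(1)] wf_trans_Bot[OF assms(1)] by (cases s) (auto simp: complete_def)

lemma moves_functional: "functional P \<Longrightarrow> moves P p \<alpha> s \<Longrightarrow> moves P p \<alpha> t \<Longrightarrow> s = t"
  using functionalD[of P p \<alpha>] by (auto simp: moves_def split: if_splits)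

lemma moves_complete: "complete P \<Longrightarrow> p \<in> plains P \<Longrightarrow> \<exists>s. moves P p \<alpha> s"
  using completeE[of P p \<alpha>] by (auto simp: moves_def)

lemma moves_mirror: "moves (mirror P) p \<alpha> s \<longleftrightarrow> moves P p \<alpha> (dual s)"
  by (auto simp: moves_def)

lemma dual_map_st: "dual (map_st f s) = map_st f (dual s)"
  by (cases s) auto

lemma dual_conj_st: "dual (conj_st s t) = disj_st (dual s) (dual t)"
  by (cases s; cases t) auto

lemma dual_quot_st: "dual (quot_st s t) = par_st (dual s) t"
  by (cases s; cases t) auto

lemma dual_swap: "x = dual y \<longleftrightarrow> dual x = y"
  by auto

text \<open>Here \<open>K\<close> can be the set of all plain states: with equal alphabets and
  complete operands, the tagged copies are complete and deterministic as well.\<close>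

lemma realisation_conj:
  assumes A: "regular A" "time_additive A" and B: "regular B" "time_additive B"
    and same: "same_alphabet A B"
  defines "D \<equiv> prod_disj (mirror A) (mirror B)"
  shows "realisation D (prod_conj A B) (plains D)"
proof -
  interpret A: regular A by (rule A(1))
  interpret B: regular B by (rule B(1))
  interpret A': regular "mirror A" by (rule regular_mirror[OF A])
  interpret B': regular "mirror B" by (rule regular_mirror[OF B])
  note wfs = A'.wf B'.wf
  have io: "inputs B = inputs A" "outputs B = outputs A" using same by (auto simp: same_alphabet_def)
  have tA: "tA B = tA A" using io by (simp add: tA_def actions_def)
  have tA': "tA (mirror B) = tA (mirror A)" by (simp add: tA)
  have wfD: "wf_tiots D" unfolding D_def using io by (intro wf_prod_disj wfs) (simp add: same_alphabet_def)
  note tr = prod_disj_trans[OF wfs tA', folded D_def]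
  have pl: "Both p q \<in> plains D \<longleftrightarrow> p \<in> plains A \<and> q \<in> plains B" "Fst p \<in> plains D \<longleftrightarrow> p \<in> plains A"
    "Snd q \<in> plains D \<longleftrightarrow> q \<in> plains B" for p q by (auto simp: D_def prod_disj_def product_def)
  have sel: "inputs D = outputs A" "outputs D = inputs A" "tA D = tA A"
    "init D = disj_st (dual (init A)) (dual (init B))" by (simp_all add: D_def)
  \<comment> \<open>Unless the product is in \<open>Bot\<close>, its step is a joint step of the
    operand states even when one of them is \<open>Top\<close>, whose loop then accounts for the
    tagged copy. Delays can thus be added operand by operand.\<close>
  have rest: "\<exists>s' t'. (s, \<alpha>, s') \<in> trans (mirror A) \<and> (t, \<alpha>, t') \<in> trans (mirror B) \<and> x = disj_st s' t'"
    if st: "s \<in> states A" "t \<in> states B" "disj_st s t \<noteq> Bot" "(disj_st s t, \<alpha>, x) \<in> trans D" for s t \<alpha> x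
  proof -
    have a: "\<alpha> \<in> tA (mirror A)" "\<alpha> \<in> tA (mirror B)" using wf_trans(2)[OF wfD st(4)] sel tA by auto
    have TA: "(Top, \<alpha>, y) \<in> trans (mirror A) \<longleftrightarrow> y = Top" for y using wf_trans_Top[OF wfs(1)] a by simp
    have TB: "(Top, \<alpha>, y) \<in> trans (mirror B) \<longleftrightarrow> y = Top" for y using wf_trans_Top[OF wfs(2)] a by simp
    show ?thesis
    proof (cases s)
      case Bot
      then show ?thesis using st(3) by (simp add: disj_st_eq)
    next
      case sT: Top
      show ?thesis
      proof (cases t)
        case Top
        then have "x = Top" using sT st(4) wf_trans_Top[OF wfD] by simp
        then show ?thesis using sT Top TA[of Top] TB[of Top] by (intro exI[of _ Top]) simp
      next
        case Bot
        then show ?thesis using st(3) by (simp add: disj_st_eq)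
      next
        case (Plain q)
        then obtain t' where "(t, \<alpha>, t') \<in> trans (mirror B)" "x = disj_st Top t'" using sT st(4) tr(3) by auto
        moreover have "(s, \<alpha>, Top) \<in> trans (mirror A)" using sT TA by blast
        ultimately show ?thesis by blast
      qed
    next
      case (Plain p)
      show ?thesis
      proof (cases t)
        case Top
        then obtain s' where "(s, \<alpha>, s') \<in> trans (mirror A)" "x = disj_st s' Top" using Plain st(4) tr(2) by auto
        moreover have "(t, \<alpha>, Top) \<in> trans (mirror B)" using Top TB by blast
        ultimately show ?thesis by blast
      next
        case Bot
        then show ?thesis using st(3) by (simp add: disj_st_eq)
      next
        case (Plain q)
        then show ?thesis using \<open>s = Plain p\<close> st(4) tr(1) by auto
      qed
    qed
  qed
  show ?thesis
  proof
    show "wf_tiots D" by fact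
    show "finite (inputs D)" "finite (outputs D)" "inputs D \<inter> outputs D = {}"
      using A.fin A.disj by (auto simp: sel)
    show "nonzeno D" unfolding D_def by (rule nonzeno_prod_disj[OF wfs A'.nonzeno B'.nonzeno tA'])
    show "wf_tiots (prod_conj A B)"
      unfolding prod_conj_def
    proof (rule product_wf[OF A.wf B.wf])
      fix s t x assume "conj_st s t = Plain x"
      then show "case x of Both p q \<Rightarrow> s = Plain p \<and> t = Plain q | Fst p \<Rightarrow> s = Plain p | Snd q \<Rightarrow> t = Plain q"
        by (cases s; cases t) auto
    qed (auto simp: actions_def io)
    show "inputs (prod_conj A B) = outputs D" "outputs (prod_conj A B) = inputs D"
      by (simp_all add: prod_conj_def product_def sel)
    show "init (prod_conj A B) = dual (init D)"
      by (simp add: prod_conj_def product_def sel dual_swap dual_conj_st)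
    show "p \<in> plains D" if "init D = Plain p" for p
      using wfD that unfolding wf_tiots_def by (metis plain_in_states)
    show "plains D \<subseteq> plains D" ..
    show "q \<in> plains D" if "(Plain p, \<alpha>, Plain q) \<in> trans D" for p \<alpha> q
      using wf_trans_plain(3)[OF wfD that] by simp
    show "s = t" if "(Plain z, \<alpha>, s) \<in> trans D" "(Plain z, \<alpha>, t) \<in> trans D" for z \<alpha> s t
      using that functionalD[OF A'.functional] functionalD[OF B'.functional]
      by (cases z) (simp_all only: tr, blast+)
    show "\<exists>s. (Plain z, \<alpha>, s) \<in> trans D" if "z \<in> plains D" "\<alpha> \<in> tA D" for z \<alpha>
    proof -
      have a: "\<alpha> \<in> tA (mirror A)" "\<alpha> \<in> tA (mirror B)" using that sel tA by auto
      have "\<exists>s. (Plain p, \<alpha>, s) \<in> trans (mirror A)" if "p \<in> plains A" for p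
        using completeE[OF A'.complete _ a(1), of p] that by auto
      moreover have "\<exists>s. (Plain q, \<alpha>, s) \<in> trans (mirror B)" if "q \<in> plains B" for q
        using completeE[OF B'.complete _ a(2), of q] that by auto
      ultimately show ?thesis using that(1) by (cases z) (auto simp only: tr pl; blast)+
    qed
    show "(Plain z, Delay (d1 + d2), x) \<in> trans D"
      if d: "0 < d1" "0 < d2" and m: "(Plain z, Delay d1, m) \<in> trans D" "m \<noteq> Bot" "(m, Delay d2, x) \<in> trans D"
      for z d1 d2 m x
    proof (cases z)
      case (Both p q)
      then obtain s t where st: "(Plain p, Delay d1, s) \<in> trans (mirror A)" "(Plain q, Delay d1, t) \<in> trans (mirror B)"
          "m = disj_st s t" using m(1) tr(1) by blast
      have "s \<in> states A" "t \<in> states B"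
        using wf_trans_plain(3)[OF wfs(1) st(1)] wf_trans_plain(3)[OF wfs(2) st(2)] by simp_all
      then obtain s' t' where "(s, Delay d2, s') \<in> trans (mirror A)" "(t, Delay d2, t') \<in> trans (mirror B)"
          "x = disj_st s' t'"
        using rest[of s t] m(2,3) st(3) by blast
      moreover have "s \<noteq> Bot" "t \<noteq> Bot" using m(2) st(3) by (auto simp: disj_st_eq)
      ultimately show ?thesis using A'.delay_add[OF d st(1)] B'.delay_add[OF d st(2)] Both tr(1) by blast
    next
      case (Fst p)
      then obtain s where s: "(Plain p, Delay d1, s) \<in> trans (mirror A)" "m = disj_st s Top"
        using m(1) tr(2) by auto
      have "s \<in> states A" using wf_trans_plain(3)[OF wfs(1) s(1)] by simp
      then obtain s' t' where s': "(s, Delay d2, s') \<in> trans (mirror A)" "(Top, Delay d2, t') \<in> trans (mirror B)"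
          "x = disj_st s' t'"
        using rest[of s Top] m(2,3) s(2) consts_in_states(1) by blast
      then have "x = map_st Fst s'" using wf_trans_Top[OF wfs(2)] by auto
      moreover have "s \<noteq> Bot" using m(2) s(2) by auto
      ultimately show ?thesis using A'.delay_add[OF d s(1) _ s'(1)] Fst tr(2) by blast
    next
      case (Snd q)
      then obtain t where t: "(Plain q, Delay d1, t) \<in> trans (mirror B)" "m = disj_st Top t"
        using m(1) tr(3) by auto
      have "t \<in> states B" using wf_trans_plain(3)[OF wfs(2) t(1)] by simp
      then obtain s' t' where t': "(Top, Delay d2, s') \<in> trans (mirror A)" "(t, Delay d2, t') \<in> trans (mirror B)"
          "x = disj_st s' t'"
        using rest[of Top t] m(2,3) t(2) consts_in_states(1) by blast
      then have "x = map_st Snd t'" using wf_trans_Top[OF wfs(1)] by auto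
      moreover have "t \<noteq> Bot" using m(2) t(2) by auto
      ultimately show ?thesis using B'.delay_add[OF d t(1) _ t'(2)] Snd tr(3) by blast
    qed
    show "(Plain z, \<alpha>, x) \<in> trans (prod_conj A B) \<longleftrightarrow> (Plain z, \<alpha>, dual x) \<in> trans D" for z \<alpha> x
    proof -
      have Y: "(Plain z, \<alpha>, x) \<in> trans (prod_conj A B) \<longleftrightarrow> prod_step conj_st A B (Plain z) \<alpha> x"
        by (simp add: prod_conj_def product_def)
      show ?thesis
      proof (cases z)
        case (Both p q)
        have "(Plain (Both p q), \<alpha>, dual x) \<in> trans D \<longleftrightarrow>
            \<alpha> \<in> tA A \<union> tA B \<and> (\<exists>s t. moves A p \<alpha> (dual s) \<and> moves B q \<alpha> (dual t) \<and> dual x = disj_st s t)"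
          using prod_step_Both[where f = disj_st, OF wfs, of p q \<alpha> "dual x"]
          by (simp add: D_def prod_disj_step moves_mirror)
        also have "\<dots> \<longleftrightarrow> \<alpha> \<in> tA A \<union> tA B \<and> (\<exists>s t. moves A p \<alpha> s \<and> moves B q \<alpha> t \<and> x = conj_st s t)"
          by (metis dual_conj_st dual_dual)
        finally show ?thesis
          unfolding Y unfolding Both prod_step_Both[where f = conj_st, OF A.wf B.wf, simplified] by simp
      next
        case (Fst p)
        show ?thesis unfolding Y unfolding Fst tr(2)
          by (simp add: prod_step_Fst) (metis dual_dual dual_map_st)
      next
        case (Snd q)
        show ?thesis unfolding Y unfolding Snd tr(3)
          by (simp add: prod_step_Snd) (metis dual_dual dual_map_st)
      qed
    qed
  qed
qed

text \<open>\<open>K\<close> consists of the pairs only: a tagged copy knows only the actions of its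
  own operand. Two additive operands do not make the product additive beyond \<open>Bot\<close>,
  which is why \<open>delay_add\<close> leaves that case out.\<close>

lemma realisation_quot:
  assumes A: "regular A" "time_additive A" and B: "regular B" "time_additive B"
    and comp: "quot_composable A B"
  defines "D \<equiv> spec_par (mirror A) B"
  shows "realisation D (prod_quot A B) {Both p q | p q. p \<in> plains A \<and> q \<in> plains B}"
proof -
  interpret A: regular A by (rule A(1))
  interpret B: regular B by (rule B(1))
  interpret A': regular "mirror A" by (rule regular_mirror[OF A])
  note wfs = A'.wf B.wf
  have sub: "actions B \<subseteq> actions A" "outputs B \<subseteq> outputs A" using comp by (auto simp: quot_composable_def)
  have wfD: "wf_tiots D" unfolding D_def by (rule wf_spec_par[OF wfs])
  have sel: "inputs D = outputs A - outputs B" "outputs D = inputs A \<union> outputs B"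
    "tA D = tA A \<union> tA B" "init D = par_st (dual (init A)) (init B)"
    using sub A.disj B.disj by (auto simp: D_def spec_par_sel actions_def)
  note tr = spec_par_step[OF wfs, folded D_def]
  have delay: "(Plain (Both p q), Delay d, x) \<in> trans D \<longleftrightarrow>
      (\<exists>s t. (Plain p, Delay d, s) \<in> trans (mirror A) \<and> (Plain q, Delay d, t) \<in> trans B \<and> x = par_st s t)"
    if "0 < d" for p q d x
    using that tr[of p q "Delay d" x] by (simp add: moves_def)
  have ta: "(p, Delay (d1 + d2), s) \<in> trans (mirror A)"
    if "0 < d1" "0 < d2" "(p, Delay d1, m) \<in> trans (mirror A)" "(m, Delay d2, s) \<in> trans (mirror A)" for p m s d1 d2
    using time_additive_mirror[OF A(2)] that unfolding time_additive_def by blast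
  have tb: "(p, Delay (d1 + d2), s) \<in> trans B"
    if "0 < d1" "0 < d2" "(p, Delay d1, m) \<in> trans B" "(m, Delay d2, s) \<in> trans B" for p m s d1 d2
    using B(2) that unfolding time_additive_def by blast
  show ?thesis
  \<comment> \<open>The goals are the assumptions of \<open>realisation\<close> in their
    order.\<close>
  proof (unfold_locales, goal_cases)
    case 1 show ?case by fact
  next
    case 2 show ?case using A.fin by (simp add: sel)
  next
    case 3 show ?case using A.fin B.fin by (simp add: sel)
  next
    case 4 show ?case using A.disj by (auto simp: sel)
  next
    case 5
    show ?case unfolding D_def
      using nonzeno_spec_par[OF wfs A'.nonzeno B.nonzeno] sub by simp
  next
    case (6 z \<alpha> s t)
    then obtain p q where "z = Both p q" by blast
    then show ?case
      using 6(2,3) moves_functional[OF A'.functional] moves_functional[OF B.functional] by (metis tr)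
  next
    case (7 z \<alpha>)
    then obtain p q where z: "z = Both p q" "p \<in> plains A" "q \<in> plains B" by blast
    obtain s where "moves (mirror A) p \<alpha> s" using moves_complete[OF A'.complete] z(2) by fastforce
    moreover obtain t where "moves B q \<alpha> t" using moves_complete[OF B.complete] z(3) by fastforce
    ultimately show ?case using 7(2) z(1) tr by (fastforce simp: sel)
  next
    case (8 z d1 d2 m x)
    then obtain p q where z: "z = Both p q" by blast
    then obtain s t where st: "(Plain p, Delay d1, s) \<in> trans (mirror A)" "(Plain q, Delay d1, t) \<in> trans B"
        "m = par_st s t" using 8(4) delay[OF 8(2)] by blast
    have sts: "s \<in> states (mirror A)" "t \<in> states B"
      using wf_trans_plain(3)[OF wfs(1) st(1)] wf_trans_plain(3)[OF wfs(2) st(2)] .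
    have "\<exists>s' t'. (s, Delay d2, s') \<in> trans (mirror A) \<and> (t, Delay d2, t') \<in> trans B \<and> x = par_st s' t'"
    \<comment> \<open>One operand is in \<open>Top\<close> and remains there; completeness supplies
      a delay for the other one, so that both can be continued by \<open>d2\<close>.\<close>
    proof (cases "m = Top")
      case True
      obtain s' t' where s't': "(s, Delay d2, s') \<in> trans (mirror A)" "(t, Delay d2, t') \<in> trans B"
        using complete_states[OF wfs(1) A'.complete sts(1), of "Delay d2"]
          complete_states[OF wfs(2) B.complete sts(2), of "Delay d2"] 8(3) by auto
      moreover have "x = Top" using True 8(6) wf_trans_Top[OF wfD] by simp
      moreover have "s = Top \<or> t = Top" using True st(3) par_st_eq_Top by metis
      then have "s' = Top \<or> t' = Top" using s't' wf_trans_Top[OF wfs(1)] wf_trans_Top[OF wfs(2)] by auto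
      ultimately show ?thesis by (metis par_st_eq_Top)
    next
      case False
      then obtain y where "m = Plain y" using 8(5) by (cases m) auto
      then obtain p' q' where "s = Plain p'" "t = Plain q'" "m = Plain (Both p' q')"
        using st(3) par_st_eq_Plain by metis
      then show ?thesis using 8(6) delay[OF 8(3)] by auto
    qed
    then show ?case using ta[OF 8(2,3) st(1)] tb[OF 8(2,3) st(2)] delay[of "d1 + d2"] 8(2,3) z
      by (metis add_pos_pos)
  next
    case 9
    show ?case unfolding prod_quot_def
    proof (rule product_wf[OF A.wf B.wf])
      fix s t x assume "quot_st s t = Plain x"
      then show "case x of Both p q \<Rightarrow> s = Plain p \<and> t = Plain q | Fst p \<Rightarrow> s = Plain p | Snd q \<Rightarrow> t = Plain q"
        by (cases s; cases t) auto
    qed (use sub in \<open>auto simp: actions_def\<close>)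
  next
    case 10 show ?case by (simp add: prod_quot_def product_def sel)
  next
    case 11 show ?case by (simp add: prod_quot_def product_def sel)
  next
    case 12
    show ?case by (simp add: prod_quot_def product_def sel dual_swap dual_quot_st)
  next
    case (13 z)
    have "init (mirror A) \<in> states (mirror A)" "init B \<in> states B" using wfs by (auto simp: wf_tiots_def)
    then show ?case using 13 par_st_eq_Plain[of "dual (init A)" "init B" z] by (auto simp: sel)
  next
    case 14 show ?case by (auto simp: D_def spec_par_sel)
  next
    case (15 z \<alpha> y)
    then obtain p q where "z = Both p q" by blast
    then obtain s t where st: "moves (mirror A) p \<alpha> s" "moves B q \<alpha> t" "par_st s t = Plain y"
      using 15(2) tr by metis
    then show ?case
      using moves_plains[OF wfs(1) st(1)] moves_plains[OF wfs(2) st(2)] by (auto simp: par_st_eq_Plain)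
  next
    case (16 z \<alpha> x)
    then obtain p q where z: "z = Both p q" by blast
    have "(Plain z, \<alpha>, x) \<in> trans (prod_quot A B) \<longleftrightarrow> prod_step quot_st A B (Plain (Both p q)) \<alpha> x"
      by (simp add: prod_quot_def product_def z)
    also have "\<dots> \<longleftrightarrow> \<alpha> \<in> tA A \<union> tA B \<and> (\<exists>s t. moves A p \<alpha> s \<and> moves B q \<alpha> t \<and> x = quot_st s t)"
      using prod_step_Both[where f = quot_st, OF A.wf B.wf, of p q \<alpha> x] by simp
    also have "\<dots> \<longleftrightarrow> \<alpha> \<in> tA A \<union> tA B \<and> (\<exists>s t. moves A p \<alpha> (dual s) \<and> moves B q \<alpha> t \<and> dual x = par_st s t)"
      by (metis dual_quot_st dual_dual)
    also have "\<dots> \<longleftrightarrow> (Plain z, \<alpha>, dual x) \<in> trans D" by (simp add: z tr moves_mirror)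
    finally show ?case .
  qed
qed

lemma same_alphabet_normal_form:
  "same_alphabet P Q \<Longrightarrow> same_alphabet (normal_form P) (normal_form Q)"
  by (simp add: same_alphabet_def normal_form_sel)

lemma spec_conj_eq: "spec_conj P Q = realise (prod_conj (normal_form P) (normal_form Q))"
  by (simp add: spec_conj_def normal_form_def)

lemma spec_quot_eq: "spec_quot P Q = realise (prod_quot (normal_form P) (top_completion (det Q)))"
  by (simp add: spec_quot_def normal_form_def)

lemma not_clash_conj:
  assumes P: "is_spec P" "tiots (det P)" and Q: "is_spec Q" "tiots (det Q)" and same: "same_alphabet P Q"
    and S: "wf_tiots S" "same_alphabet P S"
  defines "D \<equiv> prod_disj (mirror (normal_form P)) (mirror (normal_form Q))"
  shows "\<not> clash D S (init D) (init S) \<longleftrightarrow> refines P S \<and> refines Q S"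
proof -
  interpret N: regular "mirror (normal_form P)" by (rule regular_mirror[OF normal_form_regular[OF P]])
  interpret N': regular "mirror (normal_form Q)" by (rule regular_mirror[OF normal_form_regular[OF Q]])
  have tA: "tA Q = tA P" "tA S = tA P" using same S(2) by (auto simp: same_alphabet_def tA_def actions_def)
  have same': "same_alphabet Q S" using same S(2) by (simp add: same_alphabet_def)
  have "clash D S (init D) (init S) \<longleftrightarrow>
      clash (mirror (normal_form P)) S (init (mirror (normal_form P))) (init S) \<or>
      clash (mirror (normal_form Q)) S (init (mirror (normal_form Q))) (init S)"
    unfolding D_def prod_disj_sel using N.wf N'.wf tA
    by (intro clash_prod_disj N.complete N'.complete) (auto simp: wf_tiots_def normal_form_sel)
  then show ?thesis
    unfolding refines_iff_normal_form[OF P S] refines_iff_normal_form[OF Q S(1) same']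
    by (simp add: clash_commute_iff[of S])
qed

text \<open>The residuation law of the quotient: up to clashes, the product of mirror,
  \<open>Q\<close> and \<open>S\<close> can be rebracketed, which moves \<open>Q\<close> from the
  side of the mirror to the side of \<open>S\<close>. On the way the determinisation and completion
  of \<open>Q\<close> are dropped, as neither affects clashes.\<close>

lemma not_clash_quot:
  assumes P: "is_spec P" "tiots (det P)" and Q: "is_spec Q" and comp: "quot_composable P Q"
    and S: "wf_tiots S" "inputs S = inputs P \<union> outputs Q" "outputs S = outputs P - outputs Q"
  defines "D \<equiv> spec_par (mirror (normal_form P)) (top_completion (det Q))"
  shows "\<not> clash D S (init D) (init S) \<longleftrightarrow> refines P (spec_par S Q)"
proof -
  let ?M = "mirror (normal_form P)" and ?E = "top_completion (det Q)"
  interpret N: regular ?M by (rule regular_mirror[OF normal_form_regular[OF P]])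
  have wfQ: "wf_tiots Q" and wfE: "wf_tiots ?E" using spec_wf[OF Q] by (auto intro: wf_top_completion wf_det)
  have "inputs P \<inter> outputs P = {}" "inputs Q \<inter> outputs Q = {}" using P Q by (auto simp: is_spec_def tiots_def)
  then have same: "same_alphabet P (spec_par S Q)"
    using comp S(2,3) by (auto simp: same_alphabet_def spec_par_sel quot_composable_def actions_def)
  have "clash D S (init D) (init S) \<longleftrightarrow> clash (spec_par ?E ?M) S (par_st (init ?E) (init ?M)) (init S)"
    unfolding D_def spec_par_sel by (rule clash_par_swap[OF N.wf wfE])
  also have "\<dots> \<longleftrightarrow> clash (det Q) (spec_par ?M S) (init (det Q)) (par_st (init ?M) (init S))"
    using clash_par_assoc[OF wfE N.wf S(1)] by simp
  also have "\<dots> \<longleftrightarrow> clash Q (spec_par ?M S) (init Q) (par_st (init ?M) (init S))" by (rule clash_det[OF wfQ])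
  also have "\<dots> \<longleftrightarrow> clash (spec_par ?M S) Q (par_st (init ?M) (init S)) (init Q)" by (rule clash_commute_iff)
  also have "\<dots> \<longleftrightarrow> clash ?M (spec_par S Q) (init ?M) (par_st (init S) (init Q))"
    by (rule clash_par_assoc[OF N.wf S(1) wfQ])
  also have "\<dots> \<longleftrightarrow> clash (spec_par S Q) ?M (init (spec_par S Q)) (init ?M)"
    unfolding spec_par_sel by (rule clash_commute_iff)
  finally show ?thesis
    using refines_iff_normal_form[OF P wf_spec_par[OF S(1) wfQ] same] by blast
qed

text \<open>\<open>realise Y'\<close> is safe with \<open>D'\<close> unless it starts in
  \<open>Top\<close>, and \<open>realise Y\<close> is the greatest specification safe with
  \<open>D\<close>. It therefore suffices that safety with \<open>D'\<close> entails safety with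
  \<open>D\<close>, and this is needed for \<open>realise Y'\<close> only. A start in
  \<open>Top\<close> rules out any clash.\<close>

lemma refines_realise:
  fixes D Y :: "('a, 's) tiots" and D' Y' :: "('a, 't) tiots"
  assumes Y: "realisation D Y K" and Y': "realisation D' Y' K'" and same: "same_alphabet D D'"
    and imp: "is_spec (realise Y') \<Longrightarrow> \<not> clash D' (realise Y') (init D') (init (realise Y')) \<Longrightarrow>
      \<not> clash D (realise Y') (init D) (init (realise Y'))"
  shows "refines (realise Y) (realise Y')"
  unfolding refines_def
proof (intro conjI allI impI)
  interpret Y: realisation D Y K by (rule Y)
  interpret Y': realisation D' Y' K' by (rule Y')
  show "same_alphabet (realise Y) (realise Y')"
    using same by (simp add: same_alphabet_def Y.realise_sel Y'.realise_sel)
  fix R :: "('a, real) tiots"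
  assume R: "is_spec R" "environment R (realise Y)" and free: "bot_free (spec_par (realise Y) R)"
  show "bot_free (spec_par (realise Y') R)"
  proof (cases "init (realise Y') = Top")
    case True
    then show ?thesis using bot_free_iff_clash[OF Y'.wf_realise spec_wf[OF R(1)]] by simp
  next
    case False
    have tA: "tA R = tA D"
      using R(2) by (auto simp: environment_def Y.realise_sel tA_def actions_def)
    have "\<not> clash (realise Y') R (init (realise Y')) (init R)"
    proof (rule Y.realise_greatest[OF Y'.spec_realise[OF False] _ _ tA])
      show "inputs (realise Y') = outputs D" "outputs (realise Y') = inputs D"
        using same by (simp_all add: same_alphabet_def Y'.realise_sel)
      show "\<not> clash D (realise Y') (init D) (init (realise Y'))"
        using imp Y'.spec_realise[OF False] Y'.realise_sound[OF False] by blast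
      show "\<not> clash (realise Y) R (init (realise Y)) (init R)"
        using free bot_free_iff_clash[OF Y.wf_realise spec_wf[OF R(1)]] by blast
    qed
    then show ?thesis using bot_free_iff_clash[OF Y'.wf_realise spec_wf[OF R(1)]] by blast
  qed
qed

lemma refines_conj:
  assumes P: "is_spec P" "tiots (det P)" and P': "is_spec P'" "tiots (det P')"
    and Q: "is_spec Q" "tiots (det Q)" and Q': "is_spec Q'" "tiots (det Q')"
    and same: "same_alphabet P Q" and ref: "refines P P'" "refines Q Q'"
  shows "refines (spec_conj P Q) (spec_conj P' Q')"
  unfolding spec_conj_eq
proof (rule refines_realise)
  have same': "same_alphabet P' Q'" "same_alphabet P P'"
    using same ref by (auto simp: refines_def same_alphabet_def)
  let ?D = "\<lambda>P Q. prod_disj (mirror (normal_form P)) (mirror (normal_form Q))"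
  show "realisation (?D P Q) (prod_conj (normal_form P) (normal_form Q)) (plains (?D P Q))"
    by (intro realisation_conj normal_form_regular P Q same_alphabet_normal_form same)
  show Y': "realisation (?D P' Q') (prod_conj (normal_form P') (normal_form Q')) (plains (?D P' Q'))"
    by (intro realisation_conj normal_form_regular P' Q' same_alphabet_normal_form same')
  show "same_alphabet (?D P Q) (?D P' Q')"
    using same' by (simp add: same_alphabet_def normal_form_sel)
  let ?S = "realise (prod_conj (normal_form P') (normal_form Q'))"
  assume S: "is_spec ?S" and nc: "\<not> clash (?D P' Q') ?S (init (?D P' Q')) (init ?S)"
  have alph: "same_alphabet P' ?S" "same_alphabet P ?S"
    using realisation.realise_sel[OF Y'] same' by (auto simp: same_alphabet_def normal_form_sel)
  have "refines P ?S" "refines Q ?S"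
    using nc refines_trans ref unfolding not_clash_conj[OF P' Q' same'(1) spec_wf[OF S] alph(1)] by blast+
  then show "\<not> clash (?D P Q) ?S (init (?D P Q)) (init ?S)"
    unfolding not_clash_conj[OF P Q same spec_wf[OF S] alph(2)] by blast
qed

text \<open>The quotient is contravariant in its second operand: from
  \<open>refines P' (S \<parallel> Q')\<close> one gets to
  \<open>refines P (S \<parallel> Q)\<close> by monotonicity of the parallel product in
  \<open>Q'\<close>, and by transitivity.\<close>

lemma refines_quot:
  assumes P: "is_spec P" "tiots (det P)" and P': "is_spec P'" "tiots (det P')"
    and Q: "is_spec Q" "tiots (det Q)" and Q': "is_spec Q'" "tiots (det Q')"
    and comp: "quot_composable P Q" and ref: "refines P P'" "refines Q' Q"
  shows "refines (spec_quot P Q) (spec_quot P' Q')"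
  unfolding spec_quot_eq
proof (rule refines_realise)
  have same: "same_alphabet P P'" "same_alphabet Q' Q" using ref by (auto simp: refines_def)
  have comp': "quot_composable P' Q'"
    using same comp by (auto simp: quot_composable_def same_alphabet_def actions_def)
  have nf: "quot_composable (normal_form P) (top_completion (det Q))"
      "quot_composable (normal_form P') (top_completion (det Q'))"
    using comp comp' by (simp_all add: quot_composable_def normal_form_sel)
  let ?D = "\<lambda>P Q. spec_par (mirror (normal_form P)) (top_completion (det Q))"
    and ?K = "\<lambda>P Q. {Both p q | p q. p \<in> plains (normal_form P) \<and> q \<in> plains (top_completion (det Q))}"
  show "realisation (?D P Q) (prod_quot (normal_form P) (top_completion (det Q))) (?K P Q)"
    by (intro realisation_quot normal_form_regular regular_det P Q nf)
  show Y': "realisation (?D P' Q') (prod_quot (normal_form P') (top_completion (det Q'))) (?K P' Q')"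
    by (intro realisation_quot normal_form_regular regular_det P' Q' nf)
  show "same_alphabet (?D P Q) (?D P' Q')"
    using same by (simp add: same_alphabet_def spec_par_sel normal_form_sel)
  let ?S = "realise (prod_quot (normal_form P') (top_completion (det Q')))"
  assume S: "is_spec ?S" and nc: "\<not> clash (?D P' Q') ?S (init (?D P' Q')) (init ?S)"
  have "inputs P' \<inter> outputs P' = {}" using P' by (auto simp: is_spec_def tiots_def)
  then have alph: "inputs ?S = inputs P' \<union> outputs Q'" "outputs ?S = outputs P' - outputs Q'"
    using realisation.realise_sel[OF Y'] comp'
    by (auto simp: spec_par_sel normal_form_sel quot_composable_def actions_def)
  have alph': "inputs ?S = inputs P \<union> outputs Q" "outputs ?S = outputs P - outputs Q"
    using alph same by (simp_all add: same_alphabet_def)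
  have 1: "refines P' (spec_par ?S Q')"
    using nc unfolding not_clash_quot[OF P' Q'(1) comp' spec_wf[OF S] alph] .
  have 2: "refines (spec_par ?S Q') (spec_par ?S Q)"
    using alph by (intro refines_par S Q(1) Q'(1) ref) (auto simp: par_composable_def refines_def same_alphabet_def)
  have "refines P (spec_par ?S Q)" using refines_trans[OF refines_trans[OF ref(1) 1] 2] .
  then show "\<not> clash (?D P Q) ?S (init (?D P Q)) (init ?S)"
    unfolding not_clash_quot[OF P Q(1) comp spec_wf[OF S] alph'] .
qed

theorem theorem31:
  fixes P :: "('a, 'p) tiots" and P' :: "('a, 'p1) tiots"
    and Q :: "('a, 'q) tiots" and Q' :: "('a, 'q1) tiots"
  assumes "is_spec P" and "is_spec P'" and "is_spec Q" and "is_spec Q'"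
    and "ref_equiv P P'" and "ref_equiv Q Q'"
  shows "(par_composable P Q \<longrightarrow> ref_equiv (spec_par P Q) (spec_par P' Q')) \<and>
    (same_alphabet P Q \<longrightarrow> ref_equiv (spec_disj P Q) (spec_disj P' Q')) \<and>
    (tiots (det P) \<and> tiots (det P') \<and> tiots (det Q) \<and> tiots (det Q') \<longrightarrow>
      (same_alphabet P Q \<longrightarrow> ref_equiv (spec_conj P Q) (spec_conj P' Q')) \<and>
      (quot_composable P Q \<longrightarrow> ref_equiv (spec_quot P Q) (spec_quot P' Q')))"
proof -
  note spec = assms(1-4)
  have ref: "refines P P'" "refines P' P" "refines Q Q'" "refines Q' Q"
    using assms(5,6) by (auto simp: ref_equiv_def)
  have alph: "same_alphabet P P'" "same_alphabet Q Q'" using ref by (auto simp: refines_def)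
  have "par_composable P' Q'" if "par_composable P Q"
    using that alph by (simp add: par_composable_def same_alphabet_def)
  moreover have "same_alphabet P' Q'" if "same_alphabet P Q"
    using that alph by (simp add: same_alphabet_def)
  moreover have "quot_composable P' Q'" if "quot_composable P Q"
    using that alph by (simp add: quot_composable_def same_alphabet_def actions_def)
  ultimately show ?thesis
    unfolding ref_equiv_def using spec ref
    by (auto intro: refines_par refines_disj refines_conj refines_quot)
qed

end
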